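(* Let $\sigma\in\mathcal{C}^\infty(\mathbb{R}^d)$ and assume that for some constant $C>0$ $$|\partial^\alpha_\xi\sigma(\xi)|\le C^{|\alpha|+1},\qquad \xi\in\mathbb{R}^d,\ \alpha\in\mathbb{N}^d.$$ Then the Wigner kernel of $\sigma(D_x)$ is given by $$k_W(z,w)=\delta(\xi-\eta)\,\chi_{\{|x-y|\le T\}}\,a(x-y,\xi),\qquad z=(x,\xi),\ w=(y,\eta)\in\mathbb{R}^{2d},$$ where $\chi_{\{|x-y|\le T\}}$ is the characteristic function of $\{(x,y)\in\mathbb{R}^{2d}:|x-y|\le T\}$, with $T>0$ depending on $C$ (and not on $\xi$), and $a(\cdot,\xi)=\mathcal{F}^{-1}(b(\xi,\cdot))$ with $b(\xi,r)=\sigma(\xi+r/2)\overline{\sigma(\xi-r/2)}$. That is, $k_W(z,w)=\delta(\xi-\eta)a(x-y,\xi)$ and, for every $\xi\in\mathbb{R}^d$, the tempered distribution $a(\cdot,\xi)$ is supported in $\{s\in\mathbb{R}^d:|s|\le T\}$.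
   Context: Fourier transform: $\widehat f(\xi)=\mathcal{F}f(\xi)=\int f(x)e^{-2\pi i x\cdot\xi}dx$, $\mathcal{F}^{-1}$ its inverse; $\sigma(D_x)f=\mathcal{F}^{-1}(\sigma\widehat f)$. Cross-Wigner distribution: $W(f,g)(x,\xi)=\int_{\mathbb{R}^d}f(x+\frac y2)\overline{g(x-\frac y2)}e^{-2\pi i y\cdot\xi}dy$. The Wigner kernel of a continuous linear $T:\mathcal{S}(\mathbb{R}^d)\to\mathcal{S}'(\mathbb{R}^d)$ is the unique $k_W\in\mathcal{S}'(\mathbb{R}^{4d})$ with $W(Tf,Tg)(z)=\int_{\mathbb{R}^{2d}}k_W(z,w)W(f,g)(w)\,dw$ for all $f,g\in\mathcal{S}(\mathbb{R}^d)$, in the distributional sense. $\delta(\xi-\eta)a(x-y,\xi)$ denotes the tempered distribution $\Phi\mapsto\langle a(s,\xi),\int_{\mathbb{R}^d}\Phi(y+s,\xi,y,\xi)\,dy\rangle$ (bilinear pairing in $(s,\xi)$). *)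

theory Defs
  imports "HOL-Analysis.Analysis"
begin

section \<open>Partial derivatives and the Schwartz space\<close>

definition partial :: "'a::euclidean_space \<Rightarrow> ('a \<Rightarrow> complex) \<Rightarrow> 'a \<Rightarrow> complex" where
  "partial b f x = vector_derivative (\<lambda>t. f (x + t *\<^sub>R b)) (at 0)"

definition iter_partial :: "'a::euclidean_space list \<Rightarrow> ('a \<Rightarrow> complex) \<Rightarrow> 'a \<Rightarrow> complex" where
  "iter_partial bs f = foldr partial bs f"

definition smooth :: "('a::euclidean_space \<Rightarrow> complex) \<Rightarrow> bool" where
  "smooth f \<longleftrightarrow> (\<forall>bs x. set bs \<subseteq> Basis \<longrightarrow> iter_partial bs f differentiable (at x))"

text \<open>A multi-index is a function \<open>\<alpha> :: 'a \<Rightarrow> nat\<close> of which only the values on the standard basis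
  matter.  In \<open>mderiv \<alpha> f\<close> the partial derivatives are taken in some fixed order; for smooth \<open>f\<close>,
  the only functions to which it is applied below, the order is immaterial.\<close>

definition mi_order :: "('a::euclidean_space \<Rightarrow> nat) \<Rightarrow> nat" where
  "mi_order \<alpha> = (\<Sum>b\<in>Basis. \<alpha> b)"

definition mderiv :: "('a::euclidean_space \<Rightarrow> nat) \<Rightarrow> ('a \<Rightarrow> complex) \<Rightarrow> 'a \<Rightarrow> complex" where
  "mderiv \<alpha> f = iter_partial (SOME bs. set bs \<subseteq> Basis \<and> (\<forall>b\<in>Basis. count_list bs b = \<alpha> b)) f"

definition schwartz :: "('a::euclidean_space \<Rightarrow> complex) \<Rightarrow> bool" where
  "schwartz f \<longleftrightarrow> smooth f \<and>
     (\<forall>N \<alpha>. bounded (range (\<lambda>x. (1 + norm x) ^ N *\<^sub>R mderiv \<alpha> f x)))"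

definition schwartz_norm :: "nat \<Rightarrow> ('a::euclidean_space \<Rightarrow> complex) \<Rightarrow> real" where
  "schwartz_norm N f =
     (SUP (\<alpha>, x) \<in> {\<alpha>. mi_order \<alpha> \<le> N} \<times> UNIV. (1 + norm x) ^ N * norm (mderiv \<alpha> f x))"


section \<open>Tempered distributions\<close>

text \<open>Distributions are total functionals on functions, but only their values on Schwartz
  functions are meaningful; two of them are equal iff they agree on Schwartz functions.\<close>

definition tempered_distribution :: "(('a::euclidean_space \<Rightarrow> complex) \<Rightarrow> complex) \<Rightarrow> bool" where
  "tempered_distribution u \<longleftrightarrow>
     (\<forall>\<phi> \<psi>. schwartz \<phi> \<longrightarrow> schwartz \<psi> \<longrightarrow> u (\<lambda>x. \<phi> x + \<psi> x) = u \<phi> + u \<psi>) \<and>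
     (\<forall>c \<phi>. schwartz \<phi> \<longrightarrow> u (\<lambda>x. c * \<phi> x) = c * u \<phi>) \<and>
     (\<exists>A N. \<forall>\<phi>. schwartz \<phi> \<longrightarrow> norm (u \<phi>) \<le> A * schwartz_norm N \<phi>)"

definition reg_dist :: "('a::euclidean_space \<Rightarrow> complex) \<Rightarrow> ('a \<Rightarrow> complex) \<Rightarrow> complex" where
  "reg_dist h \<phi> = (LINT x|lborel. h x * \<phi> x)"

definition dist_cnj :: "(('a::euclidean_space \<Rightarrow> complex) \<Rightarrow> complex) \<Rightarrow> ('a \<Rightarrow> complex) \<Rightarrow> complex" where
  "dist_cnj u \<phi> = cnj (u (\<lambda>x. cnj (\<phi> x)))"

definition dist_tensor ::
  "(('a::euclidean_space \<Rightarrow> complex) \<Rightarrow> complex) \<Rightarrow> (('b::euclidean_space \<Rightarrow> complex) \<Rightarrow> complex)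
    \<Rightarrow> ('a \<times> 'b \<Rightarrow> complex) \<Rightarrow> complex" where
  "dist_tensor u v \<Phi> = u (\<lambda>x. v (\<lambda>y. \<Phi> (x, y)))"

definition dist_support :: "(('a::euclidean_space \<Rightarrow> complex) \<Rightarrow> complex) \<Rightarrow> 'a set" where
  "dist_support u = - \<Union>{U. open U \<and>
     (\<forall>\<phi>. smooth \<phi> \<and> compact (closure {x. \<phi> x \<noteq> 0}) \<and> closure {x. \<phi> x \<noteq> 0} \<subseteq> U \<longrightarrow> u \<phi> = 0)}"


section \<open>Fourier transform and Fourier multipliers\<close>

definition fourier :: "('a::euclidean_space \<Rightarrow> complex) \<Rightarrow> 'a \<Rightarrow> complex" where
  "fourier f \<xi> = (LINT x|lborel. f x * cis (- 2 * pi * (x \<bullet> \<xi>)))"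

definition inv_fourier :: "('a::euclidean_space \<Rightarrow> complex) \<Rightarrow> 'a \<Rightarrow> complex" where
  "inv_fourier f x = (LINT \<xi>|lborel. f \<xi> * cis (2 * pi * (x \<bullet> \<xi>)))"

definition inv_fourier_dist ::
  "(('a::euclidean_space \<Rightarrow> complex) \<Rightarrow> complex) \<Rightarrow> ('a \<Rightarrow> complex) \<Rightarrow> complex" where
  "inv_fourier_dist u \<phi> = u (inv_fourier \<phi>)"

text \<open>The multiplier \<open>\<sigma>(D)\<close>, as an operator from Schwartz functions to tempered distributions.\<close>

definition fourier_multiplier ::
  "('a::euclidean_space \<Rightarrow> complex) \<Rightarrow> ('a \<Rightarrow> complex) \<Rightarrow> ('a \<Rightarrow> complex) \<Rightarrow> complex" where
  "fourier_multiplier \<sigma> f = inv_fourier_dist (reg_dist (\<lambda>\<xi>. \<sigma> \<xi> * fourier f \<xi>))"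


section \<open>Wigner distribution and Wigner kernel\<close>

definition wigner ::
  "('a::euclidean_space \<Rightarrow> complex) \<Rightarrow> ('a \<Rightarrow> complex) \<Rightarrow> 'a \<times> 'a \<Rightarrow> complex" where
  "wigner f g = (\<lambda>(x, \<xi>). LINT y|lborel.
     f (x + y /\<^sub>R 2) * cnj (g (x - y /\<^sub>R 2)) * cis (- 2 * pi * (y \<bullet> \<xi>)))"

text \<open>The cross-Wigner distribution of two tempered distributions: in the pairing of
  \<open>wigner f g\<close> with \<open>\<Phi>\<close> substitute \<open>s = x + y/2\<close>, \<open>t = x - y/2\<close> (a change of variables with
  Jacobian 1) to move all operations other than \<open>f \<otimes> cnj g\<close> to the test function.\<close>

definition wigner_dist ::
  "(('a::euclidean_space \<Rightarrow> complex) \<Rightarrow> complex) \<Rightarrow> (('a \<Rightarrow> complex) \<Rightarrow> complex)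
    \<Rightarrow> ('a \<times> 'a \<Rightarrow> complex) \<Rightarrow> complex" where
  "wigner_dist u v \<Phi> = dist_tensor u (dist_cnj v)
     (\<lambda>(s, t). LINT \<xi>|lborel. \<Phi> ((s + t) /\<^sub>R 2, \<xi>) * cis (- 2 * pi * ((s - t) \<bullet> \<xi>)))"

text \<open>Continuity is with respect to the weak-* topology of the tempered distributions; on the
  Schwartz space, which is a Frechet space, this is the same as continuity for the strong dual
  topology.\<close>

definition continuous_linear_op ::
  "(('a::euclidean_space \<Rightarrow> complex) \<Rightarrow> ('a \<Rightarrow> complex) \<Rightarrow> complex) \<Rightarrow> bool" where
  "continuous_linear_op T \<longleftrightarrow>
     (\<forall>f. schwartz f \<longrightarrow> tempered_distribution (T f)) \<and>
     (\<forall>\<phi>. schwartz \<phi> \<longrightarrow> tempered_distribution (\<lambda>f. T f \<phi>))"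

definition wigner_kernel_identity ::
  "(('a::euclidean_space \<Rightarrow> complex) \<Rightarrow> ('a \<Rightarrow> complex) \<Rightarrow> complex)
    \<Rightarrow> ((('a \<times> 'a) \<times> ('a \<times> 'a) \<Rightarrow> complex) \<Rightarrow> complex) \<Rightarrow> bool" where
  "wigner_kernel_identity T k \<longleftrightarrow>
     (\<forall>f g \<Phi>. schwartz f \<longrightarrow> schwartz g \<longrightarrow> schwartz \<Phi> \<longrightarrow>
        wigner_dist (T f) (T g) \<Phi> = k (\<lambda>(z, w). \<Phi> z * wigner f g w))"

definition is_wigner_kernel ::
  "(('a::euclidean_space \<Rightarrow> complex) \<Rightarrow> ('a \<Rightarrow> complex) \<Rightarrow> complex)
    \<Rightarrow> ((('a \<times> 'a) \<times> ('a \<times> 'a) \<Rightarrow> complex) \<Rightarrow> complex) \<Rightarrow> bool" where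
  "is_wigner_kernel T k \<longleftrightarrow> continuous_linear_op T \<and>
     tempered_distribution k \<and> wigner_kernel_identity T k \<and>
     (\<forall>k'. tempered_distribution k' \<and> wigner_kernel_identity T k' \<longrightarrow>
        (\<forall>\<Phi>. schwartz \<Phi> \<longrightarrow> k' \<Phi> = k \<Phi>))"

text \<open>For a family \<open>a \<xi>\<close> of distributions in \<open>s\<close>, \<open>delta_kernel a\<close> is the distribution
  \<open>\<delta>(\<xi> - \<eta>) a(x - y, \<xi>)\<close> in the variables \<open>((x, \<xi>), (y, \<eta>))\<close>.\<close>

definition delta_kernel ::
  "('a::euclidean_space \<Rightarrow> ('a \<Rightarrow> complex) \<Rightarrow> complex)
    \<Rightarrow> (('a \<times> 'a) \<times> ('a \<times> 'a) \<Rightarrow> complex) \<Rightarrow> complex" where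
  "delta_kernel a \<Phi> = (LINT \<xi>|lborel. a \<xi> (\<lambda>s. LINT y|lborel. \<Phi> ((y + s, \<xi>), (y, \<xi>))))"

definition b_symbol :: "('a::euclidean_space \<Rightarrow> complex) \<Rightarrow> 'a \<Rightarrow> 'a \<Rightarrow> complex" where
  "b_symbol \<sigma> \<xi> r = \<sigma> (\<xi> + r /\<^sub>R 2) * cnj (\<sigma> (\<xi> - r /\<^sub>R 2))"

definition a_dist :: "('a::euclidean_space \<Rightarrow> complex) \<Rightarrow> 'a \<Rightarrow> ('a \<Rightarrow> complex) \<Rightarrow> complex" where
  "a_dist \<sigma> \<xi> = inv_fourier_dist (reg_dist (b_symbol \<sigma> \<xi>))"

end

theory Submission
  imports Defs "HOL-Probability.Sinc_Integral" "HOL-Probability.Characteristic_Functions"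
begin

text \<open>Identity: writing everything on the Fourier side, Fubini's theorem, the measure preserving map
  \<open>(x, p) \<mapsto> (x + p/2, x - p/2)\<close> and Fourier inversion turn both sides of the kernel identity into the
  integral of \<open>b(\<xi>, r)\<close> times \<open>f^(\<xi> + r/2) cnj (g^(\<xi> - r/2))\<close> times the inverse Fourier transform of
  \<open>\<Phi>(\<cdot>, \<xi>)\<close> at \<open>r\<close>.

  Uniqueness: the Wigner distributions of Gaussian wave packets are, up to constants, all time-frequency
  shifts of one Gaussian on phase space. Every Schwartz function is a superposition of such shifts
  that converges in the Schwartz seminorms (first over the modulations, by Fourier inversion, then over
  the translations, because the translates of a Gaussian integrate to a constant). Hence a tempered
  distribution that annihilates all shifts is zero.

  Support: the hypothesis bounds the derivatives of order \<open>n\<close> of \<open>b(\<xi>, \<cdot>)\<close> by \<open>C\<^sup>2 C^n\<close>. If \<open>\<phi>\<close> is a test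
  function supported in \<open>\<bar>s\<bar> > T\<close>, write \<open>\<phi> = \<bar>s\<bar>^(2k) \<phi>\<^sub>k\<close>; then the pairing of \<open>a(\<cdot>, \<xi>)\<close> with \<open>\<phi>\<close> is
  \<open>(-4\<pi>\<^sup>2)^(-k)\<close> times the integral of the \<open>k\<close>-th power of the Laplacian of \<open>b(\<xi>, \<cdot>)\<close> against the inverse
  Fourier transform of \<open>\<phi>\<^sub>k\<close>. This is at most \<open>(d C\<^sup>2 / 4\<pi>\<^sup>2 T\<^sup>2)^k\<close> times a polynomial in \<open>k\<close>, so it
  vanishes as soon as \<open>T\<^sup>2 \<ge> d C\<^sup>2\<close>.\<close>

section \<open>Partial derivatives of smooth functions\<close>

text \<open>The derivative bounds make \<open>\<sigma>\<close> extend to an entire function of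
  exponential type, so the support could come from a Paley-Wiener theorem. The estimate used instead
  needs real derivatives only. Its competing terms are geometric in \<open>k\<close>: derivatives of
  \<open>b\<close> give \<open>C^(2k)\<close>, division by \<open>|s|^(2k)\<close> gives
  \<open>T^(-2k)\<close>, and differentiating the quotient costs only powers of \<open>k\<close>.
  The halved arguments in \<open>b\<close> cancel the doubling of the Leibniz rule, so the rate
  stays \<open>C\<close>; the \<open>4 pi^2\<close> of two Fourier derivatives leaves the room that
  beats the powers of \<open>k\<close>. The obstacle to uniqueness is that a kernel is tested only
  on products of \<open>\<Phi>\<close> with \<open>wigner f g\<close>, while a tempered distribution
  is controlled by seminorms. Pointwise superposition is therefore not enough, and Lipschitz
  constants in the parameters have to be tracked. The function of \<open>s\<close> fed to
  \<open>a_dist\<close> inside \<open>delta_kernel\<close> is never shown to be Schwartz: a shear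
  computes its inverse Fourier transform, which is then bounded directly.\<close>

lemma partial_eqI:
  "((\<lambda>t. f (x + t *\<^sub>R b)) has_vector_derivative D) (at 0) \<Longrightarrow> partial b f x = D"
  unfolding partial_def by (rule vector_derivative_at)

lemma has_vector_derivative_line:
  assumes "(f has_derivative f') (at (x + t *\<^sub>R b))"
  shows "((\<lambda>t. f (x + t *\<^sub>R b)) has_vector_derivative f' b) (at t)"
proof -
  have "((\<lambda>t::real. x + t *\<^sub>R b) has_derivative (\<lambda>t. t *\<^sub>R b)) (at t)"
    by (auto intro!: derivative_eq_intros)
  then have "((f \<circ> (\<lambda>t::real. x + t *\<^sub>R b)) has_derivative (f' \<circ> (\<lambda>t. t *\<^sub>R b))) (at t)"
    by (rule diff_chain_at) (use assms in simp)
  moreover have "(f' \<circ> (\<lambda>t. t *\<^sub>R b)) = (\<lambda>t. t *\<^sub>R f' b)"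
    using has_derivative_bounded_linear[OF assms] by (auto simp: linear_simps)
  ultimately show ?thesis
    by (simp add: has_vector_derivative_def o_def)
qed

lemma partial_has_derivative:
  assumes "(f has_derivative f') (at x)"
  shows "partial b f x = f' b"
  by (rule partial_eqI[OF has_vector_derivative_line]) (use assms in simp)

lemma has_vector_derivative_partial:
  assumes "f differentiable at (x + t *\<^sub>R b)"
  shows "((\<lambda>t. f (x + t *\<^sub>R b)) has_vector_derivative partial b f (x + t *\<^sub>R b)) (at t)"
  using assms has_vector_derivative_line partial_has_derivative
  unfolding differentiable_def by metis

lemma partial_add:
  assumes "f differentiable at x" "g differentiable at x"
  shows "partial b (\<lambda>x. f x + g x) x = partial b f x + partial b g x"
  using has_vector_derivative_partial[of f x 0 b] has_vector_derivative_partial[of g x 0 b] assms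
  by (intro partial_eqI) (auto intro!: derivative_eq_intros)

lemma partial_mult:
  assumes "f differentiable at x" "g differentiable at x"
  shows "partial b (\<lambda>x. f x * g x) x = partial b f x * g x + f x * partial b g x"
  using has_vector_derivative_partial[of f x 0 b] has_vector_derivative_partial[of g x 0 b] assms
  by (intro partial_eqI) (auto intro!: derivative_eq_intros)

lemma partial_const: "partial b (\<lambda>x. c) x = 0"
  by (rule partial_eqI) (auto intro!: derivative_eq_intros)

lemma partial_cmult:
  assumes "f differentiable at x"
  shows "partial b (\<lambda>x. c * f x) x = c * partial b f x"
  using partial_mult[of "\<lambda>_. c" x f b] assms by (simp add: partial_const)

lemma partial_cnj:
  assumes "f differentiable at x"
  shows "partial b (\<lambda>x. cnj (f x)) x = cnj (partial b f x)"
  using bounded_linear.has_vector_derivative[OF bounded_linear_cnj has_vector_derivative_partial[of f x 0 b]] assms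
  by (intro partial_eqI) simp

lemma partial_affine:
  assumes "linear A"
  shows "partial b (\<lambda>x. f (A x + c)) x = partial (A b) f (A x + c)"
  unfolding partial_def using assms by (simp add: linear_add linear_scale algebra_simps)

lemma partial_scaleR_dir:
  assumes "f differentiable at x"
  shows "partial (s *\<^sub>R b) f x = s *\<^sub>R partial b f x"
proof -
  obtain f' where f': "(f has_derivative f') (at x)"
    using assms by (auto simp: differentiable_def)
  show ?thesis
    using partial_has_derivative[OF f'] has_derivative_bounded_linear[OF f']
    by (simp add: linear_simps)
qed

text \<open>Expanding a direction in the basis bounds the differential, whence the factor
  \<open>DIM('a)\<close>. This later turns bounds on coordinate derivatives into Lipschitz bounds in
  a translation parameter.\<close>

lemma norm_diff_le_partial:
  fixes f :: "'a::euclidean_space \<Rightarrow> complex" and B :: real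
  assumes f: "\<And>x. f differentiable at x" and B: "\<And>b x. b \<in> Basis \<Longrightarrow> norm (partial b f x) \<le> B"
  shows "norm (f x - f y) \<le> DIM('a) * B * norm (x - y)"
proof -
  define f' where "f' x = frechet_derivative f (at x)" for x
  have f': "(f has_derivative f' x) (at x)" for x
    unfolding f'_def using f by (simp add: frechet_derivative_works)
  have B0: "0 \<le> B"
    using B[OF SOME_Basis, of 0] norm_ge_zero order_trans by blast
  have "onorm (f' x) \<le> DIM('a) * B" for x
  proof (rule onorm_le)
    fix h
    interpret bounded_linear "f' x" by (rule has_derivative_bounded_linear[OF f'])
    have "f' x h = f' x (\<Sum>b\<in>Basis. (h \<bullet> b) *\<^sub>R b)" by (simp add: euclidean_representation)
    also have "\<dots> = (\<Sum>b\<in>Basis. (h \<bullet> b) *\<^sub>R partial b f x)"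
      by (simp add: sum scaleR partial_has_derivative[OF f'])
    also have "norm \<dots> \<le> (\<Sum>b\<in>(Basis::'a set). norm h * B)"
    proof (rule sum_norm_le)
      fix b :: 'a assume b: "b \<in> Basis"
      show "norm ((h \<bullet> b) *\<^sub>R partial b f x) \<le> norm h * B"
        unfolding norm_scaleR using Basis_le_norm[OF b, of h] B[OF b] by (intro mult_mono) auto
    qed
    finally show "norm (f' x h) \<le> DIM('a) * B * norm h" by (simp add: mult_ac)
  qed
  then have "norm (f x - f y) \<le> (DIM('a) * B) * norm (x - y)"
    by (intro differentiable_bound[of UNIV f f']) (auto intro: has_derivative_at_withinI f')
  then show ?thesis .
qed

section \<open>Iterated coordinate derivatives and a coinduction principle for smoothness\<close>

lemma iter_partial_Nil [simp]: "iter_partial [] f = f"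
  and iter_partial_Cons: "iter_partial (b # bs) f = partial b (iter_partial bs f)"
  and iter_partial_append: "iter_partial (bs @ cs) f = iter_partial bs (iter_partial cs f)"
  and iter_partial_snoc: "iter_partial (bs @ [b]) f = iter_partial bs (partial b f)"
  by (simp_all add: iter_partial_def)

lemma smooth_differentiable: "smooth f \<Longrightarrow> f differentiable at x"
  unfolding smooth_def by (metis empty_set empty_subsetI iter_partial_Nil)

lemma smooth_iter_partial:
  assumes "smooth f" "set bs \<subseteq> Basis"
  shows "smooth (iter_partial bs f)"
  unfolding smooth_def
proof (intro allI impI)
  fix cs :: "'a list" and x
  assume "set cs \<subseteq> Basis"
  then have "iter_partial (cs @ bs) f differentiable at x"
    using assms unfolding smooth_def by (metis Un_subset_iff set_append)
  then show "iter_partial cs (iter_partial bs f) differentiable at x"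
    by (simp add: iter_partial_append)
qed

lemma smooth_partial: "smooth f \<Longrightarrow> b \<in> Basis \<Longrightarrow> smooth (partial b f)"
  using smooth_iter_partial[of f "[b]"] by (simp add: iter_partial_Cons)

lemma smooth_continuous_on: "smooth f \<Longrightarrow> continuous_on S f"
  by (meson continuous_at_imp_continuous_on differentiable_imp_continuous_within smooth_differentiable)

lemma smooth_isCont: "smooth f \<Longrightarrow> isCont f x"
  by (meson differentiable_imp_continuous_within smooth_differentiable)

text \<open>A class of functions is shown to be smooth coinductively, where the partial derivatives need
  only be finite sums of members of the class.\<close>

inductive sum_closure :: "(('a::euclidean_space \<Rightarrow> complex) \<Rightarrow> bool) \<Rightarrow> ('a \<Rightarrow> complex) \<Rightarrow> bool"
  for P where
  base: "P f \<Longrightarrow> sum_closure P f"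
| add: "sum_closure P f \<Longrightarrow> sum_closure P g \<Longrightarrow> sum_closure P (\<lambda>x. f x + g x)"

lemma sum_closure_prod:
  "Q f \<Longrightarrow> R g \<Longrightarrow> sum_closure (\<lambda>h. \<exists>f g. Q f \<and> R g \<and> h = (\<lambda>x. f x * g x)) (\<lambda>x. f x * g x)"
  by (rule sum_closure.base) blast

lemma sum_closure_differentiable:
  assumes "\<And>f x. P f \<Longrightarrow> f differentiable at x"
  shows "sum_closure P f \<Longrightarrow> f differentiable at x"
  by (induction arbitrary: x rule: sum_closure.induct) (use assms in auto)

lemma sum_closure_partial:
  assumes "\<And>f x. P f \<Longrightarrow> f differentiable at x"
    and "\<And>f b. P f \<Longrightarrow> b \<in> Basis \<Longrightarrow> sum_closure P (partial b f)"
  shows "sum_closure P f \<Longrightarrow> b \<in> Basis \<Longrightarrow> sum_closure P (partial b f)"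
proof (induction rule: sum_closure.induct)
  case (base f)
  then show ?case using assms by blast
next
  case (add f g)
  have "partial b (\<lambda>x. f x + g x) = (\<lambda>x. partial b f x + partial b g x)"
    using sum_closure_differentiable[of P, OF assms(1)] add.hyps by (intro ext partial_add) blast+
  then show ?case
    using add by (auto intro: sum_closure.add)
qed

lemma sum_closure_iter_partial:
  assumes "\<And>f x. P f \<Longrightarrow> f differentiable at x"
    and "\<And>f b. P f \<Longrightarrow> b \<in> Basis \<Longrightarrow> sum_closure P (partial b f)"
  shows "sum_closure P f \<Longrightarrow> set bs \<subseteq> Basis \<Longrightarrow> sum_closure P (iter_partial bs f)"
  by (induction bs) (auto simp: iter_partial_Cons intro: sum_closure_partial[of P] assms)

lemma smooth_coinduct:
  assumes "sum_closure P f"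
    and "\<And>f x. P f \<Longrightarrow> f differentiable at x"
    and "\<And>f b. P f \<Longrightarrow> b \<in> Basis \<Longrightarrow> sum_closure P (partial b f)"
  shows "smooth f"
  unfolding smooth_def
  using sum_closure_iter_partial[of P] sum_closure_differentiable[of P] assms by blast

lemma smooth_const: "smooth (\<lambda>x. c)"
proof (rule smooth_coinduct[where P="\<lambda>f. \<exists>c. f = (\<lambda>x. c)"])
  show "sum_closure (\<lambda>f. \<exists>c. f = (\<lambda>x. c)) (\<lambda>x. c)"
    by (rule sum_closure.base) blast
next
  fix f :: "'a \<Rightarrow> complex" and b :: 'a
  assume "\<exists>c. f = (\<lambda>x. c)"
  then have "\<exists>c. partial b f = (\<lambda>x. c)" by (intro exI[of _ 0]) (auto simp: partial_const)
  then show "sum_closure (\<lambda>f. \<exists>c. f = (\<lambda>x. c)) (partial b f)"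
    by (rule sum_closure.base)
qed auto

lemma smooth_mult:
  fixes f g :: "'a::euclidean_space \<Rightarrow> complex"
  assumes "smooth f" "smooth g"
  shows "smooth (\<lambda>x. f x * g x)"
proof (rule smooth_coinduct)
  let ?P = "\<lambda>h. \<exists>f g :: 'a \<Rightarrow> complex. smooth f \<and> smooth g \<and> h = (\<lambda>x. f x * g x)"
  show "sum_closure ?P (\<lambda>x. f x * g x)"
    by (rule sum_closure.base) (use assms in blast)
  fix h assume h: "?P h"
  show "h differentiable at x" for x using h by (auto simp: smooth_differentiable)
  fix b :: 'a assume b: "b \<in> Basis"
  from h obtain f g where fg: "smooth f" "smooth g" and h: "h = (\<lambda>x. f x * g x)" by blast
  have "partial b h = (\<lambda>x. partial b f x * g x + f x * partial b g x)"
    using fg unfolding h by (auto intro!: partial_mult smooth_differentiable)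
  then show "sum_closure ?P (partial b h)"
    using fg b by (simp only:) (intro sum_closure.add sum_closure_prod smooth_partial)
qed

lemma iter_partial_add:
  assumes "smooth f" "smooth g" "set bs \<subseteq> Basis"
  shows "iter_partial bs (\<lambda>x. f x + g x) = (\<lambda>x. iter_partial bs f x + iter_partial bs g x)"
  using assms(3)
proof (induction bs)
  case (Cons b bs)
  then show ?case
    by (auto simp: iter_partial_Cons intro!: partial_add smooth_differentiable smooth_iter_partial assms)
qed simp

lemma iter_partial_cmult:
  assumes "smooth f" "set bs \<subseteq> Basis"
  shows "iter_partial bs (\<lambda>x. c * f x) = (\<lambda>x. c * iter_partial bs f x)"
  using assms(2)
proof (induction bs)
  case (Cons b bs)
  then show ?case
    by (auto simp: iter_partial_Cons intro!: partial_cmult smooth_differentiable smooth_iter_partial assms)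
qed simp

lemma iter_partial_cnj:
  assumes "smooth f" "set bs \<subseteq> Basis"
  shows "iter_partial bs (\<lambda>x. cnj (f x)) = (\<lambda>x. cnj (iter_partial bs f x))"
  using assms(2)
proof (induction bs)
  case (Cons b bs)
  then show ?case
    by (auto simp: iter_partial_Cons intro!: partial_cnj smooth_differentiable smooth_iter_partial assms)
qed simp

lemma smooth_cmult: "smooth f \<Longrightarrow> smooth (\<lambda>x. c * f x)"
  by (intro smooth_mult smooth_const)

lemma smooth_cnj:
  fixes f :: "'a::euclidean_space \<Rightarrow> complex"
  assumes "smooth f"
  shows "smooth (\<lambda>x. cnj (f x))"
proof (rule smooth_coinduct)
  let ?P = "\<lambda>h. \<exists>f :: 'a \<Rightarrow> complex. smooth f \<and> h = (\<lambda>x. cnj (f x))"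
  show "sum_closure ?P (\<lambda>x. cnj (f x))"
    by (rule sum_closure.base) (use assms in blast)
  fix h assume h: "?P h"
  then obtain f where f: "smooth f" and h: "h = (\<lambda>x. cnj (f x))" by blast
  show "h differentiable at x" for x
    using smooth_differentiable[OF f, of x] unfolding h differentiable_def
    by (auto intro!: has_derivative_cnj)
  fix b :: 'a assume "b \<in> Basis"
  moreover have "partial b h = (\<lambda>x. cnj (partial b f x))"
    using f unfolding h by (auto intro!: partial_cnj smooth_differentiable)
  ultimately show "sum_closure ?P (partial b h)"
    using f by (auto intro!: sum_closure.base intro: smooth_partial)
qed

text \<open>Smoothness is phrased with coordinate derivatives only. Sending coordinate directions to
  multiples of coordinate directions keeps the class of composites closed under them, and it covers
  the slices, translations, dilations and reflections that occur below.\<close>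

lemma smooth_affine:
  fixes A :: "'a::euclidean_space \<Rightarrow> 'b::euclidean_space"
  assumes "smooth f" "linear A" "\<And>b. b \<in> Basis \<Longrightarrow> A b \<in> (\<lambda>c. s *\<^sub>R c) ` Basis"
  shows "smooth (\<lambda>x. f (A x + c))"
proof (rule smooth_coinduct)
  let ?P = "\<lambda>h. \<exists>f. smooth f \<and> h = (\<lambda>x. f (A x + c))"
  show "sum_closure ?P (\<lambda>x. f (A x + c))"
    by (rule sum_closure.base) (use assms in blast)
  fix h assume h: "?P h"
  then obtain f where f: "smooth f" and h: "h = (\<lambda>x. f (A x + c))" by blast
  show "h differentiable at x" for x
    unfolding h using differentiable_chain_at[of "\<lambda>x. A x + c" x f] smooth_differentiable[OF f]
      linear_imp_differentiable[OF assms(2)] by (simp add: o_def)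
  fix b :: 'a assume "b \<in> Basis"
  then obtain d where d: "d \<in> Basis" "A b = s *\<^sub>R d" using assms(3) by auto
  have "partial b h = (\<lambda>x. s *\<^sub>R partial d f (A x + c))"
    unfolding h using partial_affine[OF assms(2), of b f c] d f
    by (auto simp: partial_scaleR_dir smooth_differentiable)
  also have "\<dots> = (\<lambda>x. (\<lambda>y. complex_of_real s * partial d f y) (A x + c))"
    by (simp add: scaleR_conv_of_real)
  finally show "sum_closure ?P (partial b h)"
    using f d smooth_cmult[OF smooth_partial[OF f d(1)]] by (auto intro!: sum_closure.base)
qed

lemma iter_partial_affine_Basis:
  fixes A :: "'a::euclidean_space \<Rightarrow> 'b::euclidean_space"
  assumes "linear A"
  shows "iter_partial bs (\<lambda>x. f (A x + c)) = (\<lambda>x. iter_partial (map A bs) f (A x + c))"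
  using assms by (induction bs) (auto simp: iter_partial_Cons partial_affine)

lemma iter_partial_scale:
  assumes "smooth f" "set bs \<subseteq> Basis"
  shows "iter_partial bs (\<lambda>x. f (s *\<^sub>R x + c)) = (\<lambda>x. s ^ length bs *\<^sub>R iter_partial bs f (s *\<^sub>R x + c))"
  using assms(2)
proof (induction bs)
  case (Cons b bs)
  let ?g = "\<lambda>x. complex_of_real (s ^ length bs) * iter_partial bs f x"
  have sm: "smooth (iter_partial bs f)" using Cons.prems assms by (simp add: smooth_iter_partial)
  have "iter_partial (b # bs) (\<lambda>x. f (s *\<^sub>R x + c)) = partial b (\<lambda>x. ?g (s *\<^sub>R x + c))"
    using Cons by (simp add: iter_partial_Cons scaleR_conv_of_real)
  also have "\<dots> = (\<lambda>x. partial (s *\<^sub>R b) ?g (s *\<^sub>R x + c))"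
    by (intro ext partial_affine linear_scale_self)
  also have "\<dots> = (\<lambda>x. s ^ length (b # bs) *\<^sub>R iter_partial (b # bs) f (s *\<^sub>R x + c))"
    using sm by (simp add: partial_scaleR_dir smooth_differentiable smooth_cmult partial_cmult
        iter_partial_Cons scaleR_conv_of_real)
      (simp add: mult_ac)
  finally show ?case .
qed simp

text \<open>Increments of \<open>f\<close> along \<open>b\<close> are integrals of
  \<open>partial b f\<close>. Differentiating these under the integral along \<open>c\<close>, and
  then at the upper limit, gives the mixed derivative in the other order. The last derivative is
  one-sided, which suffices because \<open>partial c f\<close> is differentiable and derivatives
  within an interval are unique.\<close>

lemma partial_commute_aux:
  assumes f: "\<And>x. f differentiable at x"
    and fb: "\<And>x. partial b f differentiable at x"
    and fc: "\<And>x. partial c f differentiable at x"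
    and cont: "\<And>x. isCont (partial c (partial b f)) x"
  shows "partial b (partial c f) x = partial c (partial b f) x"
proof -
  let ?g = "\<lambda>t s. f (x + s *\<^sub>R b + t *\<^sub>R c)"
  let ?h = "\<lambda>t s. partial b f (x + s *\<^sub>R b + t *\<^sub>R c)"
  let ?k = "\<lambda>t s. partial c (partial b f) (x + s *\<^sub>R b + t *\<^sub>R c)"
  have contb: "continuous_on UNIV (partial b f)"
    using fb by (meson continuous_at_imp_continuous_on differentiable_imp_continuous_within)
  have contk: "continuous_on UNIV (partial c (partial b f))"
    using cont by (meson continuous_at_imp_continuous_on)
  have ftc: "(?h t has_integral (?g t s - ?g t 0)) {0..s}" if "0 \<le> s" for s t
  proof (rule fundamental_theorem_of_calculus[OF that])
    fix r
    have sw: "x + t *\<^sub>R c + r *\<^sub>R b = x + r *\<^sub>R b + t *\<^sub>R c" for r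
      by (simp add: algebra_simps)
    show "(?g t has_vector_derivative ?h t r) (at r within {0..s})"
      using has_vector_derivative_partial[of f "x + t *\<^sub>R c" r b, OF f] unfolding sw
      by (rule has_vector_derivative_at_within)
  qed
  have eq: "partial c f (x + s *\<^sub>R b) - partial c f x = integral {0..s} (?k 0)" if s: "0 \<le> s" for s
  proof -
    have "((\<lambda>t. integral (cbox 0 s) (?h t)) has_vector_derivative integral (cbox 0 s) (?k 0)) (at 0 within UNIV)"
    proof (rule leibniz_rule_vector_derivative)
      fix t r :: real
      show "((\<lambda>t. ?h t r) has_vector_derivative ?k t r) (at t within UNIV)"
        using has_vector_derivative_partial[of "partial b f" "x + r *\<^sub>R b" t c] fb by simp
    next
      fix t :: real
      show "?h t integrable_on cbox 0 s"
        by (intro integrable_continuous continuous_on_compose2[OF contb] continuous_intros) auto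
    next
      show "continuous_on (UNIV \<times> cbox 0 s) (\<lambda>(t, s). ?k t s)"
        unfolding split_beta
        by (intro continuous_on_compose2[OF contk] continuous_intros) auto
    qed auto
    moreover have "((\<lambda>t. ?g t s - ?g t 0) has_vector_derivative (partial c f (x + s *\<^sub>R b) - partial c f x)) (at 0)"
      using has_vector_derivative_partial[of f "x + s *\<^sub>R b" 0 c] has_vector_derivative_partial[of f x 0 c] f
      by (auto intro!: derivative_eq_intros)
    moreover have "integral (cbox 0 s) (?h t) = ?g t s - ?g t 0" for t
      using ftc[OF s, of t] by (simp add: integral_unique)
    ultimately show ?thesis
      using vector_derivative_unique_at by (metis (no_types, lifting) box_real(2) ext)
  qed
  have "((\<lambda>s. integral {0..s} (?k 0)) has_vector_derivative ?k 0 0) (at 0 within {0..1})"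
    by (rule integral_has_vector_derivative)
      (auto intro!: continuous_on_compose2[OF contk] continuous_intros)
  then have 1: "((\<lambda>s. partial c f (x + s *\<^sub>R b) - partial c f x) has_vector_derivative
      partial c (partial b f) x) (at 0 within {0..1})"
    using has_vector_derivative_transform[of 0 "{0..1}" "\<lambda>s. partial c f (x + s *\<^sub>R b) - partial c f x"] eq
    by simp
  have "((\<lambda>s. partial c f (x + s *\<^sub>R b) - partial c f x) has_vector_derivative
      partial b (partial c f) x) (at 0 within {0..1})"
    using has_vector_derivative_partial[of "partial c f" x 0 b] fc
    by (auto intro!: derivative_eq_intros intro: has_vector_derivative_at_within)
  from vector_derivative_unique_within_closed_interval[OF _ _ this[unfolded box_real(2)[symmetric]]
      1[unfolded box_real(2)[symmetric]]]
  show ?thesis by simp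
qed

lemma partial_commute:
  assumes "smooth f" "b \<in> Basis" "c \<in> Basis"
  shows "partial b (partial c f) = partial c (partial b f)"
  by (intro ext partial_commute_aux)
    (use assms in \<open>auto intro: smooth_differentiable smooth_isCont smooth_partial\<close>)

section \<open>Derivatives along lists depend only on the multi-index\<close>

lemma iter_partial_rotate:
  assumes "smooth f" "set bs \<subseteq> Basis" "b \<in> Basis"
  shows "iter_partial (bs @ [b]) f = iter_partial (b # bs) f"
  using assms(2)
proof (induction bs)
  case (Cons c bs)
  then have "iter_partial ((c # bs) @ [b]) f = partial c (partial b (iter_partial bs f))"
    by (simp add: iter_partial_Cons)
  also have "\<dots> = iter_partial (b # c # bs) f"
    using partial_commute[of "iter_partial bs f" c b] Cons.prems assms
    by (simp add: iter_partial_Cons smooth_iter_partial)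
  finally show ?case .
qed simp

lemma iter_partial_mset:
  assumes "smooth f" "set bs \<subseteq> Basis" "mset bs = mset cs"
  shows "iter_partial bs f = iter_partial cs f"
  using assms(2,3)
proof (induction bs arbitrary: cs)
  case (Cons b bs)
  then have "b \<in> set cs" by (metis list.set_intros(1) set_mset_mset)
  then obtain xs ys where cs: "cs = xs @ b # ys" by (meson split_list)
  have sub: "set (xs @ ys) \<subseteq> Basis" "b \<in> Basis"
    using Cons.prems mset_eq_setD[OF Cons.prems(2)] cs by auto
  have "iter_partial cs f = iter_partial (b # xs @ ys) f"
    using iter_partial_rotate[of "iter_partial ys f" xs b] assms(1) sub cs
    by (simp add: iter_partial_append smooth_iter_partial iter_partial_Cons)
  also have "\<dots> = iter_partial (b # bs) f"
    using Cons.IH[of "xs @ ys"] Cons.prems cs by (simp add: iter_partial_Cons)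
  finally show ?case by simp
qed auto

lemma ex_list_count:
  fixes \<alpha> :: "'a::euclidean_space \<Rightarrow> nat"
  shows "\<exists>bs. set bs \<subseteq> Basis \<and> (\<forall>b\<in>Basis. count_list bs b = \<alpha> b)"
proof -
  \<comment> \<open>Values of \<open>\<alpha>\<close> outside \<open>Basis\<close> are arbitrary;
    cutting them off gives the finite support that a multiset requires.\<close>
  let ?f = "\<lambda>b. if b \<in> Basis then \<alpha> b else 0"
  have "{x. 0 < ?f x} \<subseteq> Basis" by auto
  then have fin: "finite {x. 0 < ?f x}" by (rule finite_subset) simp
  obtain bs where bs: "mset bs = Abs_multiset ?f" using ex_mset by blast
  have cnt: "count_list bs b = ?f b" for b
    unfolding count_mset[symmetric] bs by (subst Abs_multiset_inverse) (use fin in auto)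
  have "set bs \<subseteq> Basis"
    using cnt by (metis count_list_0_iff subsetI)
  then show ?thesis using cnt by auto
qed

lemma length_eq_sum_count_list:
  assumes "set bs \<subseteq> Basis"
  shows "length bs = (\<Sum>b\<in>Basis. count_list bs b)"
  using sum_count_set[of bs Basis] assms by simp

lemma mderiv_eq_iter_partial:
  fixes \<alpha> :: "'a::euclidean_space \<Rightarrow> nat"
  obtains bs where "set bs \<subseteq> Basis" "length bs = mi_order \<alpha>" "\<And>f. mderiv \<alpha> f = iter_partial bs f"
proof -
  define bs where "bs = (SOME bs. set bs \<subseteq> Basis \<and> (\<forall>b\<in>Basis. count_list bs b = \<alpha> b))"
  have bs: "set bs \<subseteq> Basis \<and> (\<forall>b\<in>Basis. count_list bs b = \<alpha> b)"
    unfolding bs_def by (rule someI_ex) (rule ex_list_count)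
  show thesis
    by (rule that[of bs]) (use bs in \<open>auto simp: mderiv_def bs_def length_eq_sum_count_list mi_order_def\<close>)
qed

text \<open>\<open>mderiv\<close> hides an order of differentiation in a choice. Since the order is
  immaterial for smooth functions, multi-indices can be traded for lists, on which induction is
  possible.\<close>

lemma iter_partial_eq_mderiv:
  assumes "smooth f" "set bs \<subseteq> Basis"
  shows "iter_partial bs f = mderiv (count_list bs) f" "mi_order (count_list bs) = length bs"
proof -
  define cs where "cs = (SOME cs. set cs \<subseteq> Basis \<and> (\<forall>b\<in>Basis. count_list cs b = count_list bs b))"
  have cs: "set cs \<subseteq> Basis \<and> (\<forall>b\<in>Basis. count_list cs b = count_list bs b)"
    unfolding cs_def by (rule someI_ex) (rule ex_list_count)
  have "count_list bs b = count_list cs b" for b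
    using cs assms by (cases "b \<in> Basis") (auto, metis count_list_0_iff subsetD)
  then have "mset bs = mset cs"
    by (intro multiset_eqI) (simp add: count_mset)
  then show "iter_partial bs f = mderiv (count_list bs) f"
    using iter_partial_mset[OF assms] by (simp add: mderiv_def cs_def)
  show "mi_order (count_list bs) = length bs"
    using assms by (simp add: mi_order_def length_eq_sum_count_list)
qed

section \<open>Schwartz functions and their seminorms\<close>

lemma one_plus_norm_pos [simp]: "0 < 1 + norm x"
  by (rule add_pos_nonneg) simp_all

lemma schwartz_iff:
  fixes f :: "'a::euclidean_space \<Rightarrow> complex"
  shows "schwartz f \<longleftrightarrow> smooth f \<and>
    (\<forall>N bs. set bs \<subseteq> Basis \<longrightarrow> (\<exists>K. \<forall>x. (1 + norm x) ^ N * norm (iter_partial bs f x) \<le> K))"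
    (is "_ \<longleftrightarrow> _ \<and> ?R")
proof -
  have eq: "bounded (range (\<lambda>x. (1 + norm x) ^ N *\<^sub>R g x)) \<longleftrightarrow> (\<exists>K. \<forall>x. (1 + norm x) ^ N * norm (g x) \<le> K)"
    for N and g :: "'a \<Rightarrow> complex"
    by (auto simp: bounded_iff abs_of_nonneg)
  show ?thesis
  proof (cases "smooth f")
    case True
    have "(\<forall>N \<alpha>. bounded (range (\<lambda>x. (1 + norm x) ^ N *\<^sub>R mderiv \<alpha> f x))) \<longleftrightarrow> ?R"
      unfolding eq
    proof safe
      fix N and bs :: "'a list"
      assume "\<forall>N \<alpha>. \<exists>K. \<forall>x. (1 + norm x) ^ N * norm (mderiv \<alpha> f x) \<le> K" "set bs \<subseteq> Basis"
      then show "\<exists>K. \<forall>x. (1 + norm x) ^ N * norm (iter_partial bs f x) \<le> K"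
        using iter_partial_eq_mderiv[OF True, of bs] by simp
    next
      fix N and \<alpha> :: "'a \<Rightarrow> nat"
      assume *: ?R
      obtain bs where "set bs \<subseteq> Basis" "\<And>f. mderiv \<alpha> f = iter_partial bs f"
        using mderiv_eq_iter_partial[of \<alpha>] by metis
      then show "\<exists>K. \<forall>x. (1 + norm x) ^ N * norm (mderiv \<alpha> f x) \<le> K"
        using * by simp
    qed
    then show ?thesis by (simp add: schwartz_def)
  qed (simp add: schwartz_def)
qed

lemma schwartz_smooth: "schwartz f \<Longrightarrow> smooth f"
  by (simp add: schwartz_def)

lemma schwartz_bound:
  assumes "schwartz f" "set bs \<subseteq> Basis"
  obtains K where "K > 0" "\<And>x. (1 + norm x) ^ N * norm (iter_partial bs f x) \<le> K"
proof -
  obtain K where K: "\<And>x. (1 + norm x) ^ N * norm (iter_partial bs f x) \<le> K"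
    using assms unfolding schwartz_iff by blast
  show thesis
    by (rule that[of "\<bar>K\<bar> + 1"]) (use K in \<open>auto intro: order_trans[OF K]\<close>)
qed

lemma schwartz_weight_bounded:
  assumes "schwartz f"
  shows "\<exists>K. \<forall>x. (1 + norm x) ^ N * norm (f x) \<le> K"
  using schwartz_bound[OF assms, of "[]" N] by (metis empty_set empty_subsetI iter_partial_Nil)

lemma schwartz_decay:
  fixes f :: "'a::euclidean_space \<Rightarrow> complex"
  assumes "schwartz f"
  obtains K where "K > 0" "\<And>x. norm (f x) \<le> K / (1 + norm x) ^ N"
proof -
  obtain K where K: "K > 0" "\<And>x. (1 + norm x) ^ N * norm (iter_partial [] f x) \<le> K"
    using schwartz_bound[OF assms, of "[]" N] by auto
  show thesis
  proof (rule that[OF K(1)])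
    fix x :: 'a
    have "0 < (1 + norm x) ^ N" by (intro zero_less_power one_plus_norm_pos)
    then show "norm (f x) \<le> K / (1 + norm x) ^ N"
      using K(2)[of x] by (simp add: field_simps)
  qed
qed

text \<open>Iterated derivatives are again finite sums of members of the class, so decay has to be
  checked only for the members themselves, never for their derivatives.\<close>

lemma schwartz_coinduct:
  fixes f :: "'a::euclidean_space \<Rightarrow> complex"
  assumes "sum_closure P f"
    and "\<And>f x. P f \<Longrightarrow> f differentiable at x"
    and "\<And>f b. P f \<Longrightarrow> b \<in> Basis \<Longrightarrow> sum_closure P (partial b f)"
    and "\<And>f N. P f \<Longrightarrow> \<exists>K. \<forall>x. (1 + norm x) ^ N * norm (f x) \<le> K"
  shows "schwartz f"
proof -
  have dec: "\<exists>K. \<forall>x. (1 + norm x) ^ N * norm (g x) \<le> K" if "sum_closure P g" for g N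
    using that
  proof induction
    case (add f g)
    then obtain K L where "\<And>x. (1 + norm x) ^ N * norm (f x) \<le> K" "\<And>x. (1 + norm x) ^ N * norm (g x) \<le> L"
      by blast
    then have "(1 + norm x) ^ N * norm (f x + g x) \<le> K + L" for x
      by (smt (verit, best) distrib_left mult_left_mono norm_ge_zero norm_triangle_ineq zero_le_power)
    then show ?case by blast
  qed (use assms(4) in blast)
  show ?thesis
    unfolding schwartz_iff
    using smooth_coinduct[of P f] sum_closure_iter_partial[of P f] dec assms(1-3) by blast
qed

lemma schwartz_partial:
  assumes "schwartz f" "b \<in> Basis"
  shows "schwartz (partial b f)"
proof -
  have "\<exists>K. \<forall>x. (1 + norm x) ^ N * norm (iter_partial bs (partial b f) x) \<le> K"
    if "set bs \<subseteq> Basis" for N bs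
  proof -
    have "set (bs @ [b]) \<subseteq> Basis" using that assms by simp
    then show ?thesis using assms unfolding schwartz_iff iter_partial_snoc[symmetric] by blast
  qed
  then show ?thesis
    using assms by (simp add: schwartz_iff smooth_partial)
qed

lemma schwartz_iter_partial:
  "schwartz f \<Longrightarrow> set bs \<subseteq> Basis \<Longrightarrow> schwartz (iter_partial bs f)"
  by (induction bs) (auto simp: iter_partial_Cons schwartz_partial)

lemma schwartz_add:
  assumes "schwartz f" "schwartz g"
  shows "schwartz (\<lambda>x. f x + g x)"
  by (rule schwartz_coinduct[where P=schwartz])
    (use assms in \<open>auto intro: sum_closure.intros schwartz_partial smooth_differentiable schwartz_smooth
      schwartz_weight_bounded\<close>)

text \<open>The slowly increasing smooth functions, usually written \<open>O_M\<close>, which act on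
  Schwartz functions by multiplication. The growth exponent may depend on the derivative.\<close>

definition moderate :: "('a::euclidean_space \<Rightarrow> complex) \<Rightarrow> bool" where
  "moderate g \<longleftrightarrow> smooth g \<and>
     (\<forall>bs. set bs \<subseteq> Basis \<longrightarrow> (\<exists>K N. \<forall>x. norm (iter_partial bs g x) \<le> K * (1 + norm x) ^ N))"

lemma moderate_partial:
  assumes "moderate g" "b \<in> Basis"
  shows "moderate (partial b g)"
proof -
  have "\<exists>K N. \<forall>x. norm (iter_partial bs (partial b g) x) \<le> K * (1 + norm x) ^ N"
    if "set bs \<subseteq> Basis" for bs
  proof -
    have "set (bs @ [b]) \<subseteq> Basis" using that assms by simp
    then show ?thesis using assms unfolding moderate_def iter_partial_snoc[symmetric] by blast
  qed
  then show ?thesis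
    using assms by (simp add: moderate_def smooth_partial)
qed

lemma moderate_bound:
  assumes "moderate g"
  obtains K N where "K > 0" "\<And>x. norm (g x) \<le> K * (1 + norm x) ^ N"
proof -
  obtain K N where K: "\<And>x. norm (iter_partial [] g x) \<le> K * (1 + norm x) ^ N"
    using assms unfolding moderate_def by (metis empty_set empty_subsetI)
  have "norm (g x) \<le> (\<bar>K\<bar> + 1) * (1 + norm x) ^ N" for x
    by (rule order_trans[of _ "K * (1 + norm x) ^ N"]) (use K[of x] in \<open>auto intro!: mult_right_mono\<close>)
  then show thesis by (intro that[of "\<bar>K\<bar> + 1" N]) auto
qed

lemma moderate_bounded: "moderate g \<Longrightarrow> \<exists>K N. \<forall>x. norm (g x) \<le> K * (1 + norm x) ^ N"
  by (metis moderate_bound)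

lemma moderate_coinduct:
  fixes f :: "'a::euclidean_space \<Rightarrow> complex"
  assumes "sum_closure P f"
    and "\<And>f x. P f \<Longrightarrow> f differentiable at x"
    and "\<And>f b. P f \<Longrightarrow> b \<in> Basis \<Longrightarrow> sum_closure P (partial b f)"
    and "\<And>f. P f \<Longrightarrow> \<exists>K N. \<forall>x. norm (f x) \<le> K * (1 + norm x) ^ N"
  shows "moderate f"
proof -
  have dec: "\<exists>K N. \<forall>x. norm (g x) \<le> K * (1 + norm x) ^ N" if "sum_closure P g" for g
    using that
  proof induction
    case (add f g)
    then obtain K L M N where *: "\<And>x. norm (f x) \<le> K * (1 + norm x) ^ M" "\<And>x. norm (g x) \<le> L * (1 + norm x) ^ N"
      by blast
    have "norm (f x + g x) \<le> (\<bar>K\<bar> + \<bar>L\<bar>) * (1 + norm x) ^ (M + N)" for x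
    proof -
      have "norm (f x) \<le> \<bar>K\<bar> * (1 + norm x) ^ (M + N)"
        by (rule order_trans[OF *(1)]) (auto intro!: mult_mono power_increasing)
      moreover have "norm (g x) \<le> \<bar>L\<bar> * (1 + norm x) ^ (M + N)"
        by (rule order_trans[OF *(2)]) (auto intro!: mult_mono power_increasing)
      ultimately show ?thesis
        using norm_triangle_ineq[of "f x" "g x"] by (simp add: distrib_right)
    qed
    then show ?case by blast
  qed (use assms(4) in blast)
  show ?thesis
    unfolding moderate_def
    using smooth_coinduct[of P f] sum_closure_iter_partial[of P f] dec assms(1-3) by blast
qed

lemma moderate_smooth: "moderate g \<Longrightarrow> smooth g"
  by (simp add: moderate_def)

lemma schwartz_moderate:
  assumes "schwartz f"
  shows "moderate f"
  unfolding moderate_def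
proof (intro conjI allI impI)
  fix bs :: "'a list" assume "set bs \<subseteq> Basis"
  then obtain K where "\<And>x. (1 + norm x) ^ 0 * norm (iter_partial bs f x) \<le> K"
    using assms unfolding schwartz_iff by blast
  then show "\<exists>K N. \<forall>x. norm (iter_partial bs f x) \<le> K * (1 + norm x) ^ N"
    by (intro exI[of _ K] exI[of _ 0]) simp
qed (use assms schwartz_smooth in blast)

lemma schwartz_mult_moderate:
  fixes f g :: "'a::euclidean_space \<Rightarrow> complex"
  assumes "schwartz f" "moderate g"
  shows "schwartz (\<lambda>x. f x * g x)"
proof (rule schwartz_coinduct)
  let ?P = "\<lambda>h. \<exists>f g :: 'a \<Rightarrow> complex. schwartz f \<and> moderate g \<and> h = (\<lambda>x. f x * g x)"
  show "sum_closure ?P (\<lambda>x. f x * g x)"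
    by (rule sum_closure.base) (use assms in blast)
  fix h assume "?P h"
  then obtain f g where fg: "schwartz f" "moderate g" and h: "h = (\<lambda>x. f x * g x)" by blast
  note d = smooth_differentiable[OF schwartz_smooth[OF fg(1)]] smooth_differentiable[OF moderate_smooth[OF fg(2)]]
  show "h differentiable at x" for x
    unfolding h using d by simp
  show "sum_closure ?P (partial b h)" if "b \<in> Basis" for b
  proof -
    have "partial b h = (\<lambda>x. partial b f x * g x + f x * partial b g x)"
      unfolding h by (intro ext partial_mult d)
    then show ?thesis
      using fg that by (simp only:) (intro sum_closure.add sum_closure_prod schwartz_partial moderate_partial)
  qed
  fix N
  obtain K M where K: "K > 0" "\<And>x. norm (g x) \<le> K * (1 + norm x) ^ M" using moderate_bound[OF fg(2)] by blast
  \<comment> \<open>Asking \<open>f\<close> for the larger weight \<open>N + M\<close> absorbs the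
    growth of \<open>g\<close>.\<close>
  obtain L where L: "L > 0" "\<And>x. (1 + norm x) ^ (N + M) * norm (iter_partial [] f x) \<le> L"
    using schwartz_bound[OF fg(1), of "[]" "N + M"] by auto
  have "(1 + norm x) ^ N * norm (h x) \<le> L * K" for x
  proof -
    have "(1 + norm x) ^ N * norm (h x) \<le> (1 + norm x) ^ N * (norm (f x) * (K * (1 + norm x) ^ M))"
      unfolding h norm_mult by (intro mult_left_mono K) auto
    also have "\<dots> = (1 + norm x) ^ (N + M) * norm (f x) * K"
      by (simp add: power_add)
    also have "\<dots> \<le> L * K" using L(2)[of x] K(1) by (intro mult_right_mono) auto
    finally show ?thesis .
  qed
  then show "\<exists>K. \<forall>x. (1 + norm x) ^ N * norm (h x) \<le> K" by blast
qed

lemma moderate_mult: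
  fixes f g :: "'a::euclidean_space \<Rightarrow> complex"
  assumes "moderate f" "moderate g"
  shows "moderate (\<lambda>x. f x * g x)"
proof (rule moderate_coinduct)
  let ?P = "\<lambda>h. \<exists>f g :: 'a \<Rightarrow> complex. moderate f \<and> moderate g \<and> h = (\<lambda>x. f x * g x)"
  show "sum_closure ?P (\<lambda>x. f x * g x)"
    by (rule sum_closure.base) (use assms in blast)
  fix h assume "?P h"
  then obtain f g where fg: "moderate f" "moderate g" and h: "h = (\<lambda>x. f x * g x)" by blast
  note d = smooth_differentiable[OF moderate_smooth[OF fg(1)]] smooth_differentiable[OF moderate_smooth[OF fg(2)]]
  show "h differentiable at x" for x
    unfolding h using d by simp
  show "sum_closure ?P (partial b h)" if "b \<in> Basis" for b
  proof -
    have "partial b h = (\<lambda>x. partial b f x * g x + f x * partial b g x)"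
      unfolding h by (intro ext partial_mult d)
    then show ?thesis
      using fg that by (simp only:) (intro sum_closure.add sum_closure_prod moderate_partial)
  qed
  obtain K M where K: "K > 0" "\<And>x. norm (f x) \<le> K * (1 + norm x) ^ M" using moderate_bound[OF fg(1)] by blast
  obtain L N where L: "L > 0" "\<And>x. norm (g x) \<le> L * (1 + norm x) ^ N" using moderate_bound[OF fg(2)] by blast
  have "norm (h x) \<le> (K * L) * (1 + norm x) ^ (M + N)" for x
    unfolding h norm_mult using mult_mono[OF K(2)[of x] L(2)[of x]] K L by (simp add: power_add mult_ac)
  then show "\<exists>K N. \<forall>x. norm (h x) \<le> K * (1 + norm x) ^ N" by blast
qed

lemma moderate_add:
  assumes "moderate f" "moderate g"
  shows "moderate (\<lambda>x. f x + g x)"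
  by (rule moderate_coinduct[where P=moderate])
    (use assms in \<open>auto intro: sum_closure.intros moderate_partial smooth_differentiable moderate_smooth
      moderate_bounded\<close>)

lemma moderate_const: "moderate (\<lambda>x. c)"
proof -
  have z: "moderate (\<lambda>x::'a. 0)"
  proof (rule moderate_coinduct[where P="\<lambda>f. f = (\<lambda>x. 0)"])
    show "\<exists>K N. \<forall>x. norm (f x) \<le> K * (1 + norm x) ^ N" if "f = (\<lambda>x. 0)" for f :: "'a \<Rightarrow> complex"
      using that by (intro exI[of _ 1]) simp
    show "sum_closure (\<lambda>f. f = (\<lambda>x. 0)) (partial b f)" if "f = (\<lambda>x. 0)" for f :: "'a \<Rightarrow> complex" and b
      using that by (intro sum_closure.base) (auto simp: partial_const)
  qed (auto intro: sum_closure.base)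
  show ?thesis
  proof (rule moderate_coinduct[where P="\<lambda>f. f = (\<lambda>x. c) \<or> f = (\<lambda>x. 0)"])
    show "\<exists>K N. \<forall>x. norm (f x) \<le> K * (1 + norm x) ^ N" if "f = (\<lambda>x. c) \<or> f = (\<lambda>x. 0)" for f :: "'a \<Rightarrow> complex"
      using that by (intro exI[of _ "norm c"] exI[of _ 0]) auto
    show "sum_closure (\<lambda>f. f = (\<lambda>x. c) \<or> f = (\<lambda>x. 0)) (partial b f)" if "f = (\<lambda>x. c) \<or> f = (\<lambda>x. 0)" for f :: "'a \<Rightarrow> complex" and b
      using that by (intro sum_closure.base) (auto simp: partial_const)
  qed (auto intro: sum_closure.base)
qed

lemma partial_inner: "partial b (\<lambda>x. complex_of_real (x \<bullet> v)) x = of_real (b \<bullet> v)"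
  by (rule partial_has_derivative[where f'="\<lambda>h. of_real (h \<bullet> v)"]) (auto intro!: derivative_eq_intros)

lemma moderate_inner: "moderate (\<lambda>x. complex_of_real (x \<bullet> v))"
proof (rule moderate_coinduct[where P="\<lambda>f. f = (\<lambda>x. of_real (x \<bullet> v)) \<or> moderate f"])
  show "\<exists>K N. \<forall>x. norm (f x) \<le> K * (1 + norm x) ^ N"
    if "f = (\<lambda>x. of_real (x \<bullet> v)) \<or> moderate f" for f :: "'a \<Rightarrow> complex"
    using that
  proof
    assume f: "f = (\<lambda>x. of_real (x \<bullet> v))"
    have "norm (f x) \<le> norm v * (1 + norm x) ^ 1" for x
      unfolding f using Cauchy_Schwarz_ineq2[of x v] by (simp add: algebra_simps add_increasing)
    then show ?thesis by blast
  qed (use moderate_bounded in blast)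
  show "sum_closure (\<lambda>f. f = (\<lambda>x. of_real (x \<bullet> v)) \<or> moderate f) (partial b f)"
    if "f = (\<lambda>x. of_real (x \<bullet> v)) \<or> moderate f" "b \<in> Basis" for f :: "'a \<Rightarrow> complex" and b
  proof (rule sum_closure.base)
    have "partial b (\<lambda>x. complex_of_real (x \<bullet> v)) = (\<lambda>x. of_real (b \<bullet> v))"
      by (intro ext partial_inner)
    then show "partial b f = (\<lambda>x. of_real (x \<bullet> v)) \<or> moderate (partial b f)"
      using that moderate_const moderate_partial by (metis)
  qed
  show "f differentiable at x" if "f = (\<lambda>x. of_real (x \<bullet> v)) \<or> moderate f" for f :: "'a \<Rightarrow> complex" and x
  proof -
    have "(\<lambda>x. complex_of_real (x \<bullet> v)) differentiable at x"
      unfolding differentiable_def by (rule exI[of _ "\<lambda>h. of_real (h \<bullet> v)"]) (auto intro!: derivative_eq_intros)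
    then show ?thesis using that by (auto intro: smooth_differentiable moderate_smooth)
  qed
qed (auto intro: sum_closure.base)

lemma moderate_sum: "finite I \<Longrightarrow> (\<And>i. i \<in> I \<Longrightarrow> moderate (f i)) \<Longrightarrow> moderate (\<lambda>x. \<Sum>i\<in>I. f i x)"
  by (induction rule: finite_induct) (simp_all add: moderate_const moderate_add)

lemma moderate_power: "moderate f \<Longrightarrow> moderate (\<lambda>x. f x ^ n)"
  by (induction n) (simp_all add: moderate_const moderate_mult)

lemma moderate_norm_square: "moderate (\<lambda>x :: 'a::euclidean_space. complex_of_real ((norm x)\<^sup>2))"
proof -
  have "moderate (\<lambda>x :: 'a. \<Sum>b\<in>Basis. complex_of_real (x \<bullet> b) * complex_of_real (x \<bullet> b))"
    by (intro moderate_sum moderate_mult moderate_inner finite_Basis)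
  moreover have "(\<Sum>b\<in>Basis. complex_of_real (x \<bullet> b) * complex_of_real (x \<bullet> b)) = complex_of_real ((norm x)\<^sup>2)" for x :: 'a
    unfolding power2_norm_eq_inner by (subst euclidean_inner) simp
  ultimately show ?thesis by simp
qed

section \<open>Closure properties of the Schwartz space and estimates for its norms\<close>

lemma schwartz_cmult: "schwartz f \<Longrightarrow> schwartz (\<lambda>x. c * f x)"
  using schwartz_mult_moderate[OF _ moderate_const[of c], of f] by (simp add: mult.commute)

lemma schwartz_mult: "schwartz f \<Longrightarrow> schwartz g \<Longrightarrow> schwartz (\<lambda>x. f x * g x)"
  by (intro schwartz_mult_moderate schwartz_moderate)

lemma schwartz_minus:
  assumes "schwartz f" "schwartz g"
  shows "schwartz (\<lambda>x. f x - g x)"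
  using schwartz_add[OF assms(1) schwartz_cmult[OF assms(2), of "-1"]] by simp

lemma schwartz_sum:
  "finite I \<Longrightarrow> (\<And>i. i \<in> I \<Longrightarrow> schwartz (f i)) \<Longrightarrow> schwartz (\<lambda>x. \<Sum>i\<in>I. f i x)"
proof (induction rule: finite_induct)
  case empty
  have "schwartz (\<lambda>x::'b. 0)"
    unfolding schwartz_iff
    using moderate_smooth[OF moderate_const[of 0]]
  proof (intro conjI allI impI)
    fix N and bs :: "'b list"
    have "iter_partial bs (\<lambda>x. 0) = (\<lambda>x. 0)"
      by (induction bs) (auto simp: iter_partial_Cons partial_const)
    then show "\<exists>K. \<forall>x. (1 + norm x) ^ N * norm (iter_partial bs (\<lambda>x. 0) x) \<le> K" by auto
  qed
  then show ?case by simp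
qed (simp add: schwartz_add)

lemma schwartz_zero: "schwartz (\<lambda>x. 0)"
  using schwartz_sum[of "{}"] by simp

lemma iter_partial_diff:
  assumes "smooth f" "smooth g" "set bs \<subseteq> Basis"
  shows "iter_partial bs (\<lambda>x. f x - g x) x = iter_partial bs f x - iter_partial bs g x"
  using iter_partial_add[OF assms(1) smooth_cmult[OF assms(2), of "-1"] assms(3)]
    iter_partial_cmult[OF assms(2,3), of "-1"] by simp

lemma iter_partial_sum:
  assumes "finite I" "\<And>i. i \<in> I \<Longrightarrow> schwartz (f i)" "set bs \<subseteq> Basis"
  shows "iter_partial bs (\<lambda>x. \<Sum>i\<in>I. c i * f i x) x = (\<Sum>i\<in>I. c i * iter_partial bs (f i) x)"
  using assms(1,2)
proof (induction arbitrary: x rule: finite_induct)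
  case empty
  have "iter_partial bs (\<lambda>x. 0) = (\<lambda>x. 0)"
    by (induction bs) (auto simp: iter_partial_Cons partial_const)
  then show ?case by simp
next
  case (insert i I)
  have "smooth (\<lambda>x. c i * f i x)" "smooth (\<lambda>x. \<Sum>i\<in>I. c i * f i x)"
    using insert by (auto intro!: schwartz_smooth schwartz_cmult schwartz_sum)
  from iter_partial_add[OF this assms(3)] show ?case
    using insert iter_partial_cmult[OF _ assms(3)] by (simp add: schwartz_smooth)
qed

lemma schwartz_norm_bdd:
  assumes "schwartz f"
  shows "bdd_above ((\<lambda>(\<alpha>, x). (1 + norm x) ^ N * norm (mderiv \<alpha> f x)) ` ({\<alpha>. mi_order \<alpha> \<le> N} \<times> UNIV))"
proof -
  let ?L = "{bs. set bs \<subseteq> (Basis :: 'a set) \<and> length bs \<le> N}"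
  have fin: "finite ?L" by (rule finite_lists_length_le) simp
  have "\<forall>bs\<in>?L. \<exists>K. \<forall>x. (1 + norm x) ^ N * norm (iter_partial bs f x) \<le> K"
    using assms by (auto simp: schwartz_iff)
  then obtain K where K: "\<And>bs x. bs \<in> ?L \<Longrightarrow> (1 + norm x) ^ N * norm (iter_partial bs f x) \<le> K bs"
    by metis
  show ?thesis
  proof (rule bdd_aboveI2[where M="Max (K ` ?L)"])
    fix p :: "('a \<Rightarrow> nat) \<times> 'a"
    assume p: "p \<in> {\<alpha>. mi_order \<alpha> \<le> N} \<times> UNIV"
    obtain \<alpha> x where p': "p = (\<alpha>, x)" by force
    obtain bs where bs: "set bs \<subseteq> Basis" "length bs = mi_order \<alpha>" "mderiv \<alpha> f = iter_partial bs f"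
      using mderiv_eq_iter_partial[of \<alpha>] by metis
    then have "bs \<in> ?L" using p p' by auto
    then show "(case p of (\<alpha>, x) \<Rightarrow> (1 + norm x) ^ N * norm (mderiv \<alpha> f x)) \<le> Max (K ` ?L)"
      using K[of bs x] fin p' bs by (auto intro: order_trans[OF _ Max_ge])
  qed
qed

lemma schwartz_norm_ge:
  assumes "schwartz f" "set bs \<subseteq> Basis" "length bs \<le> N"
  shows "(1 + norm x) ^ N * norm (iter_partial bs f x) \<le> schwartz_norm N f"
proof -
  have "(count_list bs, x) \<in> {\<alpha>. mi_order \<alpha> \<le> N} \<times> UNIV"
    using assms iter_partial_eq_mderiv[OF schwartz_smooth[OF assms(1)] assms(2)] by simp
  from cSUP_upper[OF this schwartz_norm_bdd[OF assms(1)]] show ?thesis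
    using iter_partial_eq_mderiv[OF schwartz_smooth[OF assms(1)] assms(2)]
    by (simp add: schwartz_norm_def)
qed

lemma schwartz_norm_le:
  fixes f :: "'a::euclidean_space \<Rightarrow> complex"
  assumes "\<And>bs x. set bs \<subseteq> Basis \<Longrightarrow> length bs \<le> N \<Longrightarrow> (1 + norm x) ^ N * norm (iter_partial bs f x) \<le> e"
  shows "schwartz_norm N f \<le> e"
  unfolding schwartz_norm_def
proof (rule cSUP_least)
  have "(\<lambda>_. 0) \<in> {\<alpha> :: 'a \<Rightarrow> nat. mi_order \<alpha> \<le> N}"
    by (simp add: mi_order_def)
  then show "{\<alpha> :: 'a \<Rightarrow> nat. mi_order \<alpha> \<le> N} \<times> (UNIV :: 'a set) \<noteq> {}"
    by auto
next
  fix p :: "('a \<Rightarrow> nat) \<times> 'a"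
  assume p: "p \<in> {\<alpha>. mi_order \<alpha> \<le> N} \<times> UNIV"
  obtain \<alpha> x where p': "p = (\<alpha>, x)" by force
  obtain bs where bs: "set bs \<subseteq> Basis" "length bs = mi_order \<alpha>" "mderiv \<alpha> f = iter_partial bs f"
    using mderiv_eq_iter_partial[of \<alpha>] by metis
  then show "(case p of (\<alpha>, x) \<Rightarrow> (1 + norm x) ^ N * norm (mderiv \<alpha> f x)) \<le> e"
    using assms[of bs x] p p' by auto
qed

lemma schwartz_norm_nonneg: "schwartz f \<Longrightarrow> 0 \<le> schwartz_norm N f"
  using schwartz_norm_ge[of f "[]" N 0] by (auto intro: order_trans[OF norm_ge_zero])

lemma schwartz_norm_mono:
  assumes "schwartz f" "M \<le> N"
  shows "schwartz_norm M f \<le> schwartz_norm N f"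
proof (rule schwartz_norm_le)
  fix bs x assume bs: "set bs \<subseteq> (Basis :: 'a set)" "length bs \<le> M"
  have "(1 + norm x) ^ M * norm (iter_partial bs f x) \<le> (1 + norm x) ^ N * norm (iter_partial bs f x)"
    by (intro mult_right_mono power_increasing assms) auto
  also have "\<dots> \<le> schwartz_norm N f"
    using schwartz_norm_ge[OF assms(1), of bs N x] bs assms by simp
  finally show "(1 + norm x) ^ M * norm (iter_partial bs f x) \<le> schwartz_norm N f" .
qed

section \<open>Lebesgue measure\<close>

lemma borel_measurable_fst_borel [measurable]:
  "(fst :: 'a::second_countable_topology \<times> 'b::second_countable_topology \<Rightarrow> 'a) \<in> borel_measurable borel"
  and borel_measurable_snd_borel [measurable]:
  "(snd :: 'a \<times> 'b \<Rightarrow> 'b) \<in> borel_measurable borel"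
  by (simp_all add: borel_prod[symmetric])

lemma borel_measurable_cis [measurable]: "cis \<in> borel_measurable borel"
  by (intro borel_measurable_continuous_onI continuous_on_cis continuous_on_id)

lemma borel_measurable_smooth: "smooth f \<Longrightarrow> f \<in> borel_measurable borel"
  by (intro borel_measurable_continuous_onI smooth_continuous_on)

lemma borel_measurable_compose_continuous:
  fixes h :: "'a::topological_space \<Rightarrow> 'b::topological_space"
  assumes "f \<in> borel_measurable borel" "continuous_on UNIV h"
  shows "(\<lambda>x. f (h x)) \<in> borel_measurable borel"
  by (rule measurable_compose[OF borel_measurable_continuous_onI[OF assms(2)] assms(1)])

lemma borel_measurable_LINT:
  fixes F :: "'a::euclidean_space \<times> 'b::euclidean_space \<Rightarrow> 'c::{banach, second_countable_topology}"
  assumes "F \<in> borel_measurable borel"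
  shows "(\<lambda>x. LBINT y. F (x, y)) \<in> borel_measurable borel"
proof -
  have "case_prod (\<lambda>x y. F (x, y)) \<in> borel_measurable (lborel \<Otimes>\<^sub>M lborel)"
    using assms by (simp add: lborel_prod)
  from lborel.borel_measurable_lebesgue_integral[OF this] show ?thesis by simp
qed

lemma borel_measurable_Pair_section:
  fixes F :: "'a::euclidean_space \<times> 'b::euclidean_space \<Rightarrow> 'c::topological_space"
  assumes "F \<in> borel_measurable borel"
  shows "(\<lambda>x. F (x, y)) \<in> borel_measurable borel" "(\<lambda>y. F (x, y)) \<in> borel_measurable borel"
  by (rule measurable_compose[OF _ assms], rule borel_measurable_continuous_onI, intro continuous_intros)+

lemma borel_measurable_schwartz: "schwartz f \<Longrightarrow> f \<in> borel_measurable borel"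
  by (intro borel_measurable_smooth schwartz_smooth)

section \<open>Affine substitutions, Fubini's theorem and measure preserving maps\<close>

lemma lborel_integrable_affine:
  fixes f :: "'a::euclidean_space \<Rightarrow> 'b::{banach, second_countable_topology}"
  assumes "c \<noteq> 0" "integrable lborel f"
  shows "integrable lborel (\<lambda>x. f (t + c *\<^sub>R x))"
proof -
  have [measurable]: "f \<in> borel_measurable borel" using assms(2) by auto
  have "integrable (density (distr lborel borel (\<lambda>x. t + c *\<^sub>R x)) (\<lambda>_. \<bar>c\<bar> ^ DIM('a))) f"
    using assms lborel_affine[of c t] by simp
  then have "integrable lborel (\<lambda>x. \<bar>c\<bar> ^ DIM('a) *\<^sub>R f (t + c *\<^sub>R x))"
    by (subst (asm) integrable_density) (simp_all add: integrable_distr_eq)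
  then have "integrable lborel (\<lambda>x. (1 / \<bar>c\<bar> ^ DIM('a)) *\<^sub>R \<bar>c\<bar> ^ DIM('a) *\<^sub>R f (t + c *\<^sub>R x))"
    by (rule integrable_scaleR_right)
  then show ?thesis using assms by simp
qed

lemma lborel_integral_affine:
  fixes f :: "'a::euclidean_space \<Rightarrow> 'b::{banach, second_countable_topology}"
  assumes "c \<noteq> 0" and [measurable]: "f \<in> borel_measurable borel"
  shows "(LBINT x. f x) = \<bar>c\<bar> ^ DIM('a) *\<^sub>R (LBINT x. f (t + c *\<^sub>R x))"
proof -
  have "(LBINT x. f x) = (LINT x|density (distr lborel borel (\<lambda>x. t + c *\<^sub>R x)) (\<lambda>_. \<bar>c\<bar> ^ DIM('a)). f x)"
    using assms lborel_affine[of c t] by simp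
  also have "\<dots> = (LBINT x. \<bar>c\<bar> ^ DIM('a) *\<^sub>R f (t + c *\<^sub>R x))"
    by (subst integral_density) (simp_all add: integral_distr)
  finally show ?thesis using assms by simp
qed

lemma lborel_integral_translate:
  fixes f :: "'a::euclidean_space \<Rightarrow> 'b::{banach, second_countable_topology}"
  assumes [measurable]: "f \<in> borel_measurable borel"
  shows "(LBINT x. f (x + t)) = (LBINT x. f x)"
    "(LBINT x. f (t - x)) = (LBINT x. f x)"
  using lborel_integral_affine[of 1 f t] lborel_integral_affine[of "-1" f t] by (simp_all add: add.commute)

lemma lborel_integrable_translate:
  fixes f :: "'a::euclidean_space \<Rightarrow> 'b::{banach, second_countable_topology}"
  assumes "integrable lborel f"
  shows "integrable lborel (\<lambda>x. f (x + t))" "integrable lborel (\<lambda>x. f (t - x))"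
  using lborel_integrable_affine[of 1 f t] lborel_integrable_affine[of "-1" f t] assms
  by (simp_all add: add.commute)

lemma
  fixes F :: "'a::euclidean_space \<times> 'b::euclidean_space \<Rightarrow> 'c::{banach, second_countable_topology}"
  assumes "integrable lborel F"
  shows lborel_AE_integrable_fst: "AE x in lborel. integrable lborel (\<lambda>y. F (x, y))"
    and lborel_integrable_fst: "integrable lborel (\<lambda>x. LBINT y. F (x, y))"
    and lborel_integral_fst: "(LBINT x. LBINT y. F (x, y)) = (LBINT z. F z)"
    and lborel_integral_snd: "(LBINT y. LBINT x. F (x, y)) = (LBINT z. F z)"
proof -
  have *: "integrable (lborel \<Otimes>\<^sub>M lborel) (case_prod (\<lambda>x y. F (x, y)))"
    using assms by (simp add: lborel_prod)
  show "AE x in lborel. integrable lborel (\<lambda>y. F (x, y))"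
    "integrable lborel (\<lambda>x. LBINT y. F (x, y))"
    using lborel_pair.AE_integrable_fst[OF *] lborel_pair.integrable_fst[OF *] by auto
  show "(LBINT x. LBINT y. F (x, y)) = (LBINT z. F z)"
    "(LBINT y. LBINT x. F (x, y)) = (LBINT z. F z)"
    using lborel_pair.integral_fst[OF *] lborel_pair.integral_snd[OF *] by (simp_all add: lborel_prod)
qed

lemma lborel_Fubini:
  fixes F :: "'a::euclidean_space \<times> 'b::euclidean_space \<Rightarrow> 'c::{banach, second_countable_topology}"
  assumes "integrable lborel F"
  shows "(LBINT x. LBINT y. F (x, y)) = (LBINT y. LBINT x. F (x, y))"
  using lborel_integral_fst[OF assms] lborel_integral_snd[OF assms] by simp

lemma lborel_integrable_prod_mult:
  fixes u :: "'a::euclidean_space \<Rightarrow> 'c::{real_normed_field, banach, second_countable_topology}"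
    and v :: "'b::euclidean_space \<Rightarrow> 'c"
  assumes "integrable lborel u" "integrable lborel v"
  shows "integrable lborel (\<lambda>z. u (fst z) * v (snd z))"
proof -
  have [measurable]: "u \<in> borel_measurable borel" "v \<in> borel_measurable borel"
    using assms by auto
  have "integrable (lborel \<Otimes>\<^sub>M lborel) (\<lambda>z. u (fst z) * v (snd z))"
  proof (rule lborel_pair.Fubini_integrable)
    have "(\<lambda>x. LBINT y. norm (u x * v y)) = (\<lambda>x. norm (u x) * (LBINT y. norm (v y)))"
      by (simp add: norm_mult)
    then show "integrable lborel (\<lambda>x. LBINT y. norm (u (fst (x, y)) * v (snd (x, y))))"
      using assms by simp
  qed (use assms in auto)
  then show ?thesis by (simp add: lborel_prod)
qed

lemma lborel_integrable_prod_bound: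
  fixes F :: "'a::euclidean_space \<times> 'b::euclidean_space \<Rightarrow> 'c::{banach, second_countable_topology}"
    and u :: "'a \<Rightarrow> real" and v :: "'b \<Rightarrow> real"
  assumes "F \<in> borel_measurable borel" "integrable lborel u" "integrable lborel v"
    and "\<And>x y. norm (F (x, y)) \<le> u x * v y"
  shows "integrable lborel F"
  by (rule Bochner_Integration.integrable_bound[OF lborel_integrable_prod_mult[OF assms(2,3)]])
    (use assms in \<open>auto intro!: AE_I2 simp: order_trans[OF _ abs_ge_self]\<close>)

text \<open>By Tonelli, a map that fixes the first coordinate and preserves Lebesgue measure on
  every fibre preserves it on the product. This replaces the computation of determinants.\<close>

lemma lborel_distr_fibre:
  fixes h :: "'a::euclidean_space \<Rightarrow> 'b::euclidean_space \<Rightarrow> 'b"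
  assumes [measurable]: "(\<lambda>z. h (fst z) (snd z)) \<in> borel_measurable borel"
    and h: "\<And>x. distr lborel borel (h x) = lborel"
  shows "distr lborel borel (\<lambda>z. (fst z, h (fst z) (snd z))) = (lborel :: ('a \<times> 'b) measure)"
proof (rule measure_eqI)
  fix A :: "('a \<times> 'b) set"
  assume "A \<in> sets (distr lborel borel (\<lambda>z. (fst z, h (fst z) (snd z))))"
  then have [measurable]: "A \<in> sets borel" by simp
  have [measurable]: "(\<lambda>z. (fst z, h (fst z) (snd z))) \<in> borel_measurable borel"
    by (subst borel_prod[symmetric]) measurable
  have [measurable]: "h x \<in> borel_measurable borel" for x
  proof -
    have "continuous_on UNIV (Pair x :: 'b \<Rightarrow> 'a \<times> 'b)"
      by (rule continuous_on_Pair[OF continuous_on_const continuous_on_id])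
    then have "(Pair x :: 'b \<Rightarrow> 'a \<times> 'b) \<in> borel_measurable borel"
      by (rule borel_measurable_continuous_onI)
    from measurable_compose[OF this assms(1)] show ?thesis by simp
  qed
  have [measurable]: "indicator A \<in> borel_measurable (lborel \<Otimes>\<^sub>M lborel)"
    by (simp add: lborel_prod)
  have sl: "(\<lambda>y. indicator A (x, y) :: ennreal) \<in> borel_measurable borel" for x
  proof -
    have "continuous_on UNIV (Pair x :: 'b \<Rightarrow> 'a \<times> 'b)"
      by (rule continuous_on_Pair[OF continuous_on_const continuous_on_id])
    then have "(Pair x :: 'b \<Rightarrow> 'a \<times> 'b) \<in> borel_measurable borel"
      by (rule borel_measurable_continuous_onI)
    from measurable_compose[OF this, of "indicator A" borel] show ?thesis by simp
  qed
  have "emeasure (distr lborel borel (\<lambda>z. (fst z, h (fst z) (snd z)))) A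
      = (\<integral>\<^sup>+z. indicator A z \<partial>distr lborel borel (\<lambda>z. (fst z, h (fst z) (snd z))))"
    by (simp add: nn_integral_indicator)
  also have "\<dots> = (\<integral>\<^sup>+z. indicator A (fst z, h (fst z) (snd z)) \<partial>lborel)"
    by (rule nn_integral_distr) auto
  also have "\<dots> = (\<integral>\<^sup>+x. \<integral>\<^sup>+y. indicator A (fst (x, y), h (fst (x, y)) (snd (x, y))) \<partial>lborel \<partial>lborel)"
  proof -
    have "(\<lambda>z. indicator A (fst z, h (fst z) (snd z)) :: ennreal) \<in> borel_measurable (lborel \<Otimes>\<^sub>M lborel)"
      by (simp add: lborel_prod) measurable
    from lborel.nn_integral_fst[OF this] show ?thesis by (simp add: lborel_prod)
  qed
  also have "\<dots> = (\<integral>\<^sup>+x. \<integral>\<^sup>+y. indicator A (x, y) \<partial>distr lborel borel (h x) \<partial>lborel)"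
    by (intro nn_integral_cong) (simp add: nn_integral_distr sl)
  also have "\<dots> = (\<integral>\<^sup>+z. indicator A z \<partial>lborel)"
    unfolding h using lborel.nn_integral_fst[of "indicator A" lborel] by (simp add: lborel_prod)
  finally show "emeasure (distr lborel borel (\<lambda>z. (fst z, h (fst z) (snd z)))) A = emeasure lborel A"
    by simp
qed simp

lemma lborel_distr_swap:
  "distr lborel borel prod.swap = (lborel :: ('a::euclidean_space \<times> 'b::euclidean_space) measure)"
proof -
  have "(lborel :: ('a \<times> 'b) measure) = distr (lborel \<Otimes>\<^sub>M lborel) (lborel \<Otimes>\<^sub>M lborel) (\<lambda>(x, y). (y, x))"
    using lborel_pair.distr_pair_swap by (metis lborel_prod)
  also have "\<dots> = distr lborel borel prod.swap"
    unfolding lborel_prod by (intro distr_cong) auto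
  finally show ?thesis by simp
qed

lemma borel_measurable_swap [measurable]:
  "(prod.swap :: 'a::second_countable_topology \<times> 'b::second_countable_topology \<Rightarrow> _) \<in> borel_measurable borel"
  by (intro borel_measurable_continuous_onI continuous_intros continuous_on_swap)

lemma lborel_distr_shear:
  fixes g :: "'b::euclidean_space \<Rightarrow> 'a::euclidean_space"
  assumes [measurable]: "g \<in> borel_measurable borel"
  shows "distr lborel borel (\<lambda>z. (fst z + g (snd z), snd z)) = (lborel :: ('a \<times> 'b) measure)"
proof -
  let ?S = "\<lambda>z :: 'b \<times> 'a. (fst z, g (fst z) + snd z)"
  have [measurable]: "?S \<in> borel_measurable borel"
    by (subst borel_prod[symmetric]) measurable
  have 1: "distr lborel borel ?S = lborel"
    by (rule lborel_distr_fibre) (auto simp: lborel_distr_plus)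
  have "lborel = distr (distr (distr lborel borel (prod.swap :: 'a \<times> 'b \<Rightarrow> _)) borel ?S) borel prod.swap"
    by (simp only: lborel_distr_swap 1)
  also have "\<dots> = distr lborel borel (prod.swap \<circ> ?S \<circ> prod.swap)"
    by (simp add: distr_distr comp_assoc)
  also have "prod.swap \<circ> ?S \<circ> prod.swap = (\<lambda>z :: 'a \<times> 'b. (fst z + g (snd z), snd z))"
    by (auto simp: add.commute)
  finally show ?thesis by simp
qed

lemma borel_measurable_wigner_map:
  "(\<lambda>(x, p :: 'a::euclidean_space). (x + p /\<^sub>R 2, x - p /\<^sub>R 2)) \<in> borel_measurable borel"
  unfolding split_beta by (intro borel_measurable_continuous_onI continuous_intros)

text \<open>The map factors into the shear \<open>?S\<close>, which forms \<open>x + p/2\<close>,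
  followed by \<open>?R\<close>, which reflects each fibre and turns \<open>p\<close> into
  \<open>x + p/2 - p\<close>. Both are covered by the fibre argument.\<close>

lemma lborel_distr_wigner_map:
  "distr lborel borel (\<lambda>(x, p :: 'a::euclidean_space). (x + p /\<^sub>R 2, x - p /\<^sub>R 2)) = (lborel :: ('a \<times> 'a) measure)"
proof -
  let ?S = "\<lambda>z :: 'a \<times> 'a. (fst z + snd z /\<^sub>R 2, snd z)"
  let ?R = "\<lambda>z :: 'a \<times> 'a. (fst z, fst z - snd z)"
  have [measurable]: "?S \<in> borel_measurable borel" "?R \<in> borel_measurable borel"
    by (intro borel_measurable_continuous_onI continuous_intros)+
  have 1: "distr lborel borel ?S = lborel"
    by (rule lborel_distr_shear) auto
  have d: "distr lborel borel (\<lambda>y. x - y) = lborel" for x :: 'a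
    using lborel_affine[of "-1" x] by (simp add: density_1)
  have 2: "distr lborel borel ?R = lborel"
    by (rule lborel_distr_fibre) (auto simp: d)
  have "lborel = distr (distr lborel borel ?S) borel ?R"
    by (simp only: 1 2)
  also have "\<dots> = distr lborel borel (?R \<circ> ?S)"
    by (simp add: distr_distr)
  also have "?R \<circ> ?S = (\<lambda>(x, p). (x + p /\<^sub>R 2, x - p /\<^sub>R 2))"
    by (auto simp: algebra_simps simp flip: scaleR_add_left)
  finally show ?thesis by simp
qed

lemma
  fixes F :: "'a::euclidean_space \<times> 'a \<Rightarrow> 'b::{banach, second_countable_topology}"
  assumes F: "F \<in> borel_measurable borel"
  shows lborel_integrable_wigner_map:
      "integrable lborel (\<lambda>(x, p). F (x + p /\<^sub>R 2, x - p /\<^sub>R 2)) \<longleftrightarrow> integrable lborel F"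
    and lborel_integral_wigner_map:
      "(LBINT z. (case z of (x, p) \<Rightarrow> F (x + p /\<^sub>R 2, x - p /\<^sub>R 2))) = (LBINT z. F z)"
proof -
  let ?M = "\<lambda>(x, p :: 'a). (x + p /\<^sub>R 2, x - p /\<^sub>R 2)"
  have M: "?M \<in> measurable lborel borel"
    using borel_measurable_wigner_map by simp
  have eq: "(\<lambda>(x, p). F (x + p /\<^sub>R 2, x - p /\<^sub>R 2)) = (\<lambda>z. F (?M z))"
    by auto
  show "integrable lborel (\<lambda>(x, p). F (x + p /\<^sub>R 2, x - p /\<^sub>R 2)) \<longleftrightarrow> integrable lborel F"
    unfolding eq integrable_distr_eq[OF M F, symmetric] lborel_distr_wigner_map ..
  show "(LBINT z. (case z of (x, p) \<Rightarrow> F (x + p /\<^sub>R 2, x - p /\<^sub>R 2))) = (LBINT z. F z)"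
    unfolding eq integral_distr[OF M F, symmetric] lborel_distr_wigner_map ..
qed

section \<open>Integrals of products over coordinates and integrable polynomial weights\<close>

lemma lborel_prod_Basis:
  fixes f :: "'a::euclidean_space \<Rightarrow> real \<Rightarrow> 'c::{real_normed_field, banach, second_countable_topology}"
  assumes int: "\<And>b. b \<in> Basis \<Longrightarrow> integrable lborel (f b)"
  shows "integrable lborel (\<lambda>x. \<Prod>b\<in>Basis. f b (x \<bullet> b))"
    "(LBINT x. (\<Prod>b\<in>Basis. f b (x \<bullet> b))) = (\<Prod>b\<in>Basis. (LBINT t. f b t))"
proof -
  interpret product_sigma_finite "\<lambda>_ :: 'a. lborel :: real measure" ..
  have [measurable]: "f b \<in> borel_measurable borel" if "b \<in> Basis" for b
    using int[OF that] by auto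
  have m: "(\<lambda>x. \<Prod>b\<in>Basis. f b (x \<bullet> b)) \<in> borel_measurable borel"
    by measurable
  have c: "(\<Prod>b\<in>Basis. f b ((\<Sum>c\<in>Basis. x c *\<^sub>R c) \<bullet> b)) = (\<Prod>b\<in>Basis. f b (x b))" for x :: "'a \<Rightarrow> real"
    by (intro prod.cong) (auto simp: inner_sum_left inner_Basis if_distrib cong: if_cong)
  show "integrable lborel (\<lambda>x. \<Prod>b\<in>Basis. f b (x \<bullet> b))"
    by (subst lborel_eq, subst integrable_distr_eq) (auto simp: c intro!: product_integrable_prod int m)
  show "(LBINT x. (\<Prod>b\<in>Basis. f b (x \<bullet> b))) = (\<Prod>b\<in>Basis. (LBINT t. f b t))"
    by (subst lborel_eq, subst integral_distr) (auto simp: c intro!: product_integral_prod int m)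
qed

text \<open>The exponent \<open>2 * DIM('a)\<close> comes from comparison with the product of
  \<open>1 / (1 + (x \<bullet> b)^2)\<close> over the coordinates, which is integrated one variable
  at a time.\<close>

lemma integrable_inverse_power_norm:
  assumes "2 * DIM('a::euclidean_space) \<le> N"
  shows "integrable lborel (\<lambda>x :: 'a. 1 / (1 + norm x) ^ N)"
proof (rule Bochner_Integration.integrable_bound)
  have "integrable lborel (\<lambda>t :: real. 1 / (1 + t\<^sup>2))"
    using integrable_inverse_1_plus_square by (simp add: set_integrable_def inverse_eq_divide)
  then show "integrable lborel (\<lambda>x :: 'a. \<Prod>b\<in>Basis. (1 / (1 + (x \<bullet> b)\<^sup>2)))"
    by (rule lborel_prod_Basis(1))
  show "AE x in lborel. norm (1 / (1 + norm (x :: 'a)) ^ N) \<le> norm (\<Prod>b\<in>Basis. (1 / (1 + (x \<bullet> b)\<^sup>2)))"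
  proof (rule AE_I2)
    fix x :: 'a
    have "(\<Prod>b\<in>Basis. (1 + (x \<bullet> b)\<^sup>2)) \<le> (\<Prod>b\<in>(Basis::'a set). (1 + norm x)\<^sup>2)"
    proof (intro prod_mono conjI)
      fix b :: 'a assume "b \<in> Basis"
      then have "\<bar>x \<bullet> b\<bar>\<^sup>2 \<le> (norm x)\<^sup>2" by (intro power_mono Basis_le_norm) auto
      then show "1 + (x \<bullet> b)\<^sup>2 \<le> (1 + norm x)\<^sup>2"
        by (simp add: power2_sum) (smt (verit) norm_ge_zero)
    qed auto
    also have "\<dots> = (1 + norm x) ^ (2 * DIM('a))" by (simp add: power_mult)
    also have "\<dots> \<le> (1 + norm x) ^ N" using assms by (intro power_increasing) auto
    finally have "(\<Prod>b\<in>Basis. (1 + (x \<bullet> b)\<^sup>2)) \<le> (1 + norm x) ^ N" .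
    moreover have "0 < (\<Prod>b\<in>Basis. (1 + (x \<bullet> b)\<^sup>2))"
      by (intro prod_pos) (smt (verit) zero_le_power2)
    ultimately show "norm (1 / (1 + norm x) ^ N) \<le> norm (\<Prod>b\<in>Basis. (1 / (1 + (x \<bullet> b)\<^sup>2)))"
      by (simp add: prod_dividef frac_le)
  qed
qed measurable

lemma integrable_of_decay:
  fixes f :: "'a::euclidean_space \<Rightarrow> 'b::{banach, second_countable_topology}"
  assumes "f \<in> borel_measurable borel" "\<And>x. norm (f x) \<le> K / (1 + norm x) ^ (2 * DIM('a))"
  shows "integrable lborel f"
proof (rule Bochner_Integration.integrable_bound)
  show "integrable lborel (\<lambda>x :: 'a. K * (1 / (1 + norm x) ^ (2 * DIM('a))))"
    by (intro integrable_mult_right integrable_inverse_power_norm) simp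
qed (use assms in \<open>auto intro!: AE_I2 intro: order_trans[OF _ divide_right_mono[OF abs_ge_self]]\<close>)

lemma schwartz_integrable: "schwartz f \<Longrightarrow> integrable lborel f"
  by (metis integrable_of_decay borel_measurable_smooth schwartz_smooth schwartz_decay)

text \<open>The difference \<open>f (x + b) - f x\<close> has integral \<open>0\<close> by translation invariance, and it is the integral of
  the derivative over a unit segment.\<close>

lemma integral_partial_eq_0:
  fixes f :: "'a::euclidean_space \<Rightarrow> complex"
  assumes f: "integrable lborel f" and g: "integrable lborel (partial b f)"
    and diff: "\<And>x. f differentiable at x" and cont: "continuous_on UNIV (partial b f)"
  shows "(LBINT x. partial b f x) = 0"
proof -
  have [measurable]: "partial b f \<in> borel_measurable borel" "f \<in> borel_measurable borel"
    using f g by auto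
  \<comment> \<open>Integrability of \<open>?F\<close> is inherited from the product
    \<open>?G\<close>, of which it is the composition with a shear.\<close>
  let ?F = "\<lambda>z :: 'a \<times> real. indicator {0..1} (snd z) *\<^sub>R partial b f (fst z + snd z *\<^sub>R b)"
  let ?G = "\<lambda>z :: 'a \<times> real. indicator {0..1::real} (snd z) *\<^sub>R partial b f (fst z)"
  have shear: "distr lborel borel (\<lambda>z. (fst z + snd z *\<^sub>R b, snd z)) = (lborel :: ('a \<times> real) measure)"
    by (rule lborel_distr_shear) simp
  have [measurable]: "(\<lambda>z. (fst z + snd z *\<^sub>R b, snd z)) \<in> borel_measurable (borel :: ('a \<times> real) measure)"
    by (intro borel_measurable_continuous_onI continuous_intros)
  have "integrable lborel (\<lambda>t :: real. complex_of_real (indicator {0..1} t))"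
    by (intro integrable_of_real integrable_real_indicator) auto
  then have "integrable lborel (\<lambda>z :: 'a \<times> real. partial b f (fst z) * of_real (indicator {0..1} (snd z)))"
    by (rule lborel_integrable_prod_mult[OF g])
  then have "integrable (distr lborel borel (\<lambda>z. (fst z + snd z *\<^sub>R b, snd z))) ?G"
    by (simp add: shear scaleR_conv_of_real mult.commute)
  then have F: "integrable lborel ?F"
    by (subst (asm) integrable_distr_eq) auto
  have "f (x + b) - f x = (LBINT t. ?F (x, t))" for x
  proof -
    have "(LBINT t. ?F (x, t)) = f (x + 1 *\<^sub>R b) - f (x + 0 *\<^sub>R b)"
      unfolding fst_conv snd_conv
    proof (rule integral_FTC_Icc)
      fix t :: real
      show "((\<lambda>t. f (x + t *\<^sub>R b)) has_vector_derivative partial b f (x + t *\<^sub>R b)) (at t within {0..1})"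
        by (rule has_vector_derivative_at_within[OF has_vector_derivative_partial[OF diff]])
    qed (auto intro!: continuous_on_compose2[OF cont] continuous_intros)
    then show ?thesis by simp
  qed
  then have "(LBINT x. f (x + b) - f x) = (LBINT x. LBINT t. ?F (x, t))"
    by simp
  also have "\<dots> = (LBINT t. LBINT x. ?F (x, t))"
    by (rule lborel_Fubini[OF F])
  also have "\<dots> = (LBINT t. indicator {0..1::real} t *\<^sub>R (LBINT x. partial b f x))"
    by (simp add: lborel_integral_translate)
  also have "\<dots> = (LBINT x. partial b f x)"
    by simp
  also have "(LBINT x. f (x + b) - f x) = 0"
    using f lborel_integrable_translate(1)[OF f, of b] by (simp add: lborel_integral_translate)
  finally show ?thesis by simp
qed

section \<open>The Fourier transform on Schwartz functions\<close>

lemma integrable_mult_cis: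
  fixes f :: "'a \<Rightarrow> complex"
  assumes "integrable M f" "c \<in> borel_measurable M"
  shows "integrable M (\<lambda>x. f x * cis (c x))"
  by (rule Bochner_Integration.integrable_bound[OF assms(1)]) (use assms in \<open>auto simp: norm_mult\<close>)

lemma has_derivative_cis_inner:
  "((\<lambda>x. cis (v \<bullet> x)) has_derivative (\<lambda>h. (\<i> * (v \<bullet> h)) * cis (v \<bullet> x))) (at x)"
proof -
  have "((\<lambda>x. \<i> * complex_of_real (v \<bullet> x)) has_derivative (\<lambda>h. \<i> * of_real (v \<bullet> h))) (at x)"
    by (auto intro!: derivative_eq_intros)
  from has_derivative_compose[OF this DERIV_exp[unfolded has_field_derivative_def]]
  show ?thesis by (simp add: cis_conv_exp mult_ac)
qed

lemma moderate_cis: "moderate (\<lambda>x. cis (v \<bullet> x))"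
proof (rule moderate_coinduct)
  let ?P = "\<lambda>g. \<exists>c. g = (\<lambda>x. c * cis (v \<bullet> x))"
  show "sum_closure ?P (\<lambda>x. cis (v \<bullet> x))"
    by (rule sum_closure.base, rule exI[of _ 1]) simp
  fix g assume "?P g"
  then obtain c where g: "g = (\<lambda>x. c * cis (v \<bullet> x))" by blast
  have d: "(g has_derivative (\<lambda>h. c * ((\<i> * (v \<bullet> h)) * cis (v \<bullet> x)))) (at x)" for x
    unfolding g by (rule has_derivative_mult_right[OF has_derivative_cis_inner])
  show "g differentiable at x" for x using d by (auto simp: differentiable_def)
  have "partial b g = (\<lambda>x. (c * (\<i> * (v \<bullet> b))) * cis (v \<bullet> x))" for b
    using partial_has_derivative[OF d] by (auto simp: mult.assoc)
  then show "sum_closure ?P (partial b g)" for b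
    by (intro sum_closure.base) blast
  show "\<exists>K N. \<forall>x. norm (g x) \<le> K * (1 + norm x) ^ N"
    by (rule exI[of _ "norm c"], rule exI[of _ 0]) (simp add: g norm_mult)
qed

lemma partial_cis: "partial b (\<lambda>x. cis (v \<bullet> x)) x = \<i> * (v \<bullet> b) * cis (v \<bullet> x)"
  by (rule partial_has_derivative[OF has_derivative_cis_inner])

lemma fourier_eq_inv_fourier: "fourier f \<xi> = inv_fourier f (- \<xi>)"
  by (simp add: fourier_def inv_fourier_def inner_commute)

lemma norm_inv_fourier_le:
  "norm (inv_fourier f r) \<le> (LBINT x. norm (f x))"
  unfolding inv_fourier_def by (rule order_trans[OF integral_norm_bound]) (simp add: norm_mult)

text \<open>Integration by parts: the derivative of \<open>f\<close> times the character has
  integral zero, and the product rule splits it into the two transforms.\<close>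

lemma inv_fourier_partial:
  fixes f :: "'a::euclidean_space \<Rightarrow> complex"
  assumes f: "schwartz f" and b: "b \<in> Basis"
  shows "inv_fourier (partial b f) r = - (2 * pi * \<i> * (r \<bullet> b)) * inv_fourier f r"
proof -
  let ?e = "\<lambda>x. cis ((2 * pi) *\<^sub>R r \<bullet> x)"
  let ?g = "\<lambda>x. f x * ?e x"
  have g: "schwartz ?g" by (rule schwartz_mult_moderate[OF f moderate_cis])
  have *: "partial b ?g x = partial b f x * ?e x + (2 * pi * \<i> * (r \<bullet> b)) * (f x * ?e x)" for x
    by (subst partial_mult[OF smooth_differentiable[OF schwartz_smooth[OF f]]
          smooth_differentiable[OF moderate_smooth[OF moderate_cis]]], subst partial_cis)
      (simp add: algebra_simps)
  have "0 = (LBINT x. partial b ?g x)"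
    using integral_partial_eq_0[of ?g b] schwartz_integrable[OF g] schwartz_integrable[OF schwartz_partial[OF g b]]
      smooth_differentiable[OF schwartz_smooth[OF g]] smooth_continuous_on[OF schwartz_smooth[OF schwartz_partial[OF g b]]]
    by simp
  also have "\<dots> = (LBINT x. partial b f x * ?e x) + (2 * pi * \<i> * (r \<bullet> b)) * (LBINT x. f x * ?e x)"
    unfolding *
    using integrable_mult_cis[OF schwartz_integrable[OF schwartz_partial[OF f b]], of "\<lambda>x. (2 * pi) *\<^sub>R r \<bullet> x"]
      integrable_mult_cis[OF schwartz_integrable[OF f], of "\<lambda>x. (2 * pi) *\<^sub>R r \<bullet> x"]
    by (subst Bochner_Integration.integral_add) simp_all
  finally have "inv_fourier (partial b f) r + (2 * pi * \<i> * (r \<bullet> b)) * inv_fourier f r = 0"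
    by (simp add: inv_fourier_def mult.assoc)
  then show ?thesis
    by (simp only: mult_minus_left eq_neg_iff_add_eq_0)
qed

lemma inv_fourier_iter_partial:
  assumes "schwartz f" "b \<in> Basis"
  shows "inv_fourier (iter_partial (replicate n b) f) r = (- (2 * pi * \<i> * (r \<bullet> b))) ^ n * inv_fourier f r"
proof (induction n)
  case (Suc n)
  have "schwartz (iter_partial (replicate n b) f)"
    using assms by (intro schwartz_iter_partial) auto
  then show ?case
    using Suc by (simp add: iter_partial_Cons inv_fourier_partial assms)
qed simp

text \<open>For given \<open>r\<close> take the coordinate \<open>b\<close> in which
  \<open>r\<close> is largest: \<open>n\<close> derivatives along it already control
  \<open>(1 + norm r) ^ n\<close>. Summing over all \<open>b\<close> removes the dependence of the
  choice on \<open>r\<close>. The constant is explicit so that families of functions can later be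
  bounded uniformly.\<close>

lemma inv_fourier_decay:
  fixes f :: "'a::euclidean_space \<Rightarrow> complex"
  assumes f: "schwartz f"
  shows "(1 + norm r) ^ n * norm (inv_fourier f r) \<le> (2 * DIM('a)) ^ n *
    ((LBINT x. norm (f x)) + (\<Sum>b\<in>Basis. (LBINT x. norm (iter_partial (replicate n b) f x))))"
proof -
  let ?d = "real DIM('a)"
  define M where "M = Max ((\<lambda>b. \<bar>r \<bullet> b\<bar>) ` Basis)"
  have "M \<in> (\<lambda>b. \<bar>r \<bullet> b\<bar>) ` Basis"
    unfolding M_def by (rule Max_in) auto
  then obtain b where b: "b \<in> Basis" "M = \<bar>r \<bullet> b\<bar>" by blast
  have "norm r \<le> (\<Sum>c\<in>Basis. \<bar>r \<bullet> c\<bar>)" by (rule norm_le_l1)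
  also have "\<dots> \<le> (\<Sum>c\<in>(Basis::'a set). M)"
    unfolding M_def by (intro sum_mono Max_ge) auto
  finally have r: "norm r \<le> ?d * M" by simp
  have M0: "0 \<le> M" using b by simp
  have d1: "1 \<le> ?d" by (simp add: Suc_leI)
  have "(1 + norm r) ^ n \<le> (2 * max 1 (?d * M)) ^ n"
    using r by (intro power_mono) auto
  also have "\<dots> \<le> 2 ^ n * (1 + (?d * M) ^ n)"
    by (auto simp: power_mult_distrib max_def M0)
  also have "\<dots> \<le> 2 ^ n * (?d ^ n + ?d ^ n * (2 * pi * M) ^ n)"
  proof -
    have "M ^ n \<le> (2 * pi * M) ^ n"
    proof (intro power_mono M0)
      have "1 * M \<le> 2 * pi * M" using pi_gt3 M0 by (intro mult_right_mono) auto
      then show "M \<le> 2 * pi * M" by simp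
    qed
    then show ?thesis
      using d1 by (auto simp: power_mult_distrib intro!: mult_left_mono add_mono)
  qed
  also have "\<dots> = (2 * ?d) ^ n * (1 + (2 * pi * M) ^ n)"
    by (simp add: power_mult_distrib algebra_simps)
  finally have "(1 + norm r) ^ n * norm (inv_fourier f r)
      \<le> (2 * ?d) ^ n * (1 + (2 * pi * M) ^ n) * norm (inv_fourier f r)"
    by (rule mult_right_mono) simp
  also have "\<dots> = (2 * ?d) ^ n * (norm (inv_fourier f r) + norm (inv_fourier (iter_partial (replicate n b) f) r))"
    by (simp add: inv_fourier_iter_partial f b norm_mult norm_power algebra_simps abs_mult)
  also have "\<dots> \<le> (2 * ?d) ^ n * ((LBINT x. norm (f x)) +
      (\<Sum>b\<in>Basis. (LBINT x. norm (iter_partial (replicate n b) f x))))"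
  proof (intro mult_left_mono add_mono norm_inv_fourier_le)
    have "norm (inv_fourier (iter_partial (replicate n b) f) r) \<le> (LBINT x. norm (iter_partial (replicate n b) f x))"
      by (rule norm_inv_fourier_le)
    also have "\<dots> \<le> (\<Sum>b\<in>Basis. (LBINT x. norm (iter_partial (replicate n b) f x)))"
      using b by (intro member_le_sum) (auto intro!: integral_nonneg)
    finally show "norm (inv_fourier (iter_partial (replicate n b) f) r)
      \<le> (\<Sum>b\<in>Basis. (LBINT x. norm (iter_partial (replicate n b) f x)))" .
  qed simp
  finally show ?thesis by simp
qed

lemma borel_measurable_inv_fourier:
  assumes [measurable]: "f \<in> borel_measurable borel"
  shows "inv_fourier f \<in> borel_measurable borel"
proof -
  have "inv_fourier f = (\<lambda>x. LBINT \<xi>. f \<xi> * cis (2 * pi * (x \<bullet> \<xi>)))"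
    by (auto simp: inv_fourier_def)
  then show ?thesis by simp
qed

lemma borel_measurable_fourier:
  assumes [measurable]: "f \<in> borel_measurable borel"
  shows "fourier f \<in> borel_measurable borel"
proof -
  have "fourier f = (\<lambda>x. LBINT \<xi>. f \<xi> * cis (- 2 * pi * (\<xi> \<bullet> x)))"
    by (auto simp: fourier_def)
  then show ?thesis by simp
qed

lemma inv_fourier_rapid_decay:
  fixes f :: "'a::euclidean_space \<Rightarrow> complex"
  assumes "schwartz f"
  obtains K where "K > 0" "\<And>r. norm (inv_fourier f r) \<le> K / (1 + norm r) ^ n"
proof -
  define K where "K = (2 * DIM('a)) ^ n *
    ((LBINT x. norm (f x)) + (\<Sum>b\<in>Basis. (LBINT x. norm (iter_partial (replicate n b) f x))))"
  have "norm (inv_fourier f r) \<le> (\<bar>K\<bar> + 1) / (1 + norm r) ^ n" for r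
  proof -
    have "0 < (1 + norm r) ^ n" by (intro zero_less_power one_plus_norm_pos)
    then show ?thesis
      using inv_fourier_decay[OF assms, of r n] unfolding K_def[symmetric] by (simp add: field_simps)
  qed
  then show thesis by (intro that[of "\<bar>K\<bar> + 1"]) auto
qed

lemma integrable_inv_fourier_moment:
  fixes f :: "'a::euclidean_space \<Rightarrow> complex"
  assumes "schwartz f"
  shows "integrable lborel (\<lambda>r. (1 + norm r) ^ n * norm (inv_fourier f r))"
proof -
  have [measurable]: "inv_fourier f \<in> borel_measurable borel"
    by (intro borel_measurable_inv_fourier borel_measurable_smooth schwartz_smooth assms)
  \<comment> \<open>The surplus exponent \<open>2 * DIM('a)\<close> is what makes the moment
    integrable.\<close>
  obtain K where K: "\<And>r. norm (inv_fourier f r) \<le> K / (1 + norm r) ^ (n + 2 * DIM('a))"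
    using inv_fourier_rapid_decay[OF assms] by metis
  show ?thesis
  proof (rule integrable_of_decay[where K=K])
    fix r :: 'a
    have "1 + norm r \<noteq> 0" using one_plus_norm_pos[of r] by linarith
    then show "norm ((1 + norm r) ^ n * norm (inv_fourier f r)) \<le> K / (1 + norm r) ^ (2 * DIM('a))"
      using mult_left_mono[OF K[of r], of "(1 + norm r) ^ n"] by (simp add: power_add abs_mult)
  qed measurable
qed

lemma schwartz_inv_fourier_integrable:
  assumes "schwartz f"
  shows "integrable lborel (inv_fourier f)"
proof (rule Bochner_Integration.integrable_bound[OF integrable_inv_fourier_moment[OF assms, of 0]])
  show "inv_fourier f \<in> borel_measurable lborel"
    using borel_measurable_inv_fourier borel_measurable_smooth[OF schwartz_smooth[OF assms]] by simp
qed simp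

lemma schwartz_fourier_integrable:
  assumes "schwartz f"
  shows "integrable lborel (fourier f)"
  using lborel_integrable_affine[OF _ schwartz_inv_fourier_integrable[OF assms], of "-1" 0]
  by (simp add: fourier_eq_inv_fourier[abs_def])

section \<open>Gaussians and the inversion formula\<close>

text \<open>Combine \<open>(1 + u)^2 \<le> 2 * (1 + u^2)\<close> with the \<open>n\<close>-th power
  of \<open>1 + v / n \<le> exp (v / n)\<close>. The maximum in \<open>A\<close> serves the constant
  and the quadratic term at once, and \<open>n\<close> is \<open>Suc N\<close> so that the division
  is legitimate for \<open>N = 0\<close>.\<close>

lemma power_le_exp_square:
  fixes c u :: real
  assumes "c > 0"
  obtains K where "K > 0" "\<And>u. 0 \<le> u \<Longrightarrow> (1 + u) ^ N \<le> K * exp (c * u\<^sup>2)"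
proof -
  define n where "n = real (Suc N)"
  define A where "A = 2 * max 1 (n / c)"
  have n: "n > 0" by (simp add: n_def)
  have "(1 + u) ^ N \<le> A ^ Suc N * exp (c * u\<^sup>2)" if u: "0 \<le> u" for u
  proof -
    have "(1 + u) ^ N \<le> ((1 + u)\<^sup>2) ^ Suc N"
      unfolding power_mult[symmetric] using u by (intro power_increasing) auto
    also have "\<dots> \<le> (A * (1 + c * u\<^sup>2 / n)) ^ Suc N"
    proof (rule power_mono)
      have "(1 + u)\<^sup>2 \<le> 2 * (1 + u\<^sup>2)"
        using zero_le_power2[of "1 - u"] by (simp add: power2_eq_square algebra_simps)
      also have "\<dots> \<le> A * (1 + c * u\<^sup>2 / n)"
      proof -
        have "2 * u\<^sup>2 = 2 * (n / c) * (c * u\<^sup>2 / n)" using assms n by simp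
        also have "\<dots> \<le> A * (c * u\<^sup>2 / n)"
          unfolding A_def using assms n by (intro mult_right_mono) auto
        finally show ?thesis by (simp add: A_def algebra_simps)
      qed
      finally show "(1 + u)\<^sup>2 \<le> A * (1 + c * u\<^sup>2 / n)" .
    qed simp
    also have "\<dots> \<le> (A * exp (c * u\<^sup>2 / n)) ^ Suc N"
      using assms n by (intro power_mono mult_left_mono exp_ge_add_one_self mult_nonneg_nonneg)
        (auto simp: A_def)
    also have "\<dots> = A ^ Suc N * exp (c * u\<^sup>2)"
      using n by (simp only: power_mult_distrib exp_of_nat_mult[symmetric]) (simp add: n_def)
    finally show ?thesis .
  qed
  then show thesis by (intro that[of "A ^ Suc N"]) (auto simp: A_def)
qed

lemma has_derivative_gauss:
  "((\<lambda>x. complex_of_real (exp (- c * (norm x)\<^sup>2))) has_derivative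
    (\<lambda>h. of_real (- 2 * c * (x \<bullet> h) * exp (- c * (norm x)\<^sup>2)))) (at x)"
  unfolding power2_norm_eq_inner
  by (auto intro!: derivative_eq_intros simp: inner_commute algebra_simps)

text \<open>Differentiating a Gaussian brings down a linear factor, so moderate multiples of a fixed
  Gaussian form a class closed under derivatives. A Gaussian alone would not.\<close>

lemma schwartz_moderate_gauss:
  fixes m :: "'a::euclidean_space \<Rightarrow> complex"
  assumes "moderate m" "c > 0"
  shows "schwartz (\<lambda>x. m x * of_real (exp (- c * (norm x)\<^sup>2)))"
proof (rule schwartz_coinduct)
  let ?g = "\<lambda>x :: 'a. complex_of_real (exp (- c * (norm x)\<^sup>2))"
  let ?P = "\<lambda>h. \<exists>m. moderate m \<and> h = (\<lambda>x. m x * ?g x)"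
  show "sum_closure ?P (\<lambda>x. m x * ?g x)"
    by (rule sum_closure.base) (use assms in blast)
  fix h assume "?P h"
  then obtain m where m: "moderate m" and h: "h = (\<lambda>x. m x * ?g x)" by blast
  note d = smooth_differentiable[OF moderate_smooth[OF m]] has_derivative_gauss[of c, THEN differentiableI]
  show "h differentiable at x" for x
    unfolding h by (intro differentiable_mult d)
  show "sum_closure ?P (partial b h)" if "b \<in> Basis" for b
  proof -
    let ?m = "\<lambda>x. partial b m x + m x * (of_real (- 2 * c) * of_real (x \<bullet> b))"
    have "partial b h = (\<lambda>x. ?m x * ?g x)"
      unfolding h
      by (rule ext, subst partial_mult[OF d], subst partial_has_derivative[OF has_derivative_gauss])
        (simp add: algebra_simps)
    moreover have "moderate ?m"
      using m that by (intro moderate_add moderate_mult moderate_partial moderate_const moderate_inner)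
    ultimately show ?thesis by (intro sum_closure.base) blast
  qed
  fix N
  obtain K M where K: "K > 0" "\<And>x. norm (m x) \<le> K * (1 + norm x) ^ M"
    using moderate_bound[OF m] by blast
  obtain L where L: "L > 0" "\<And>u. 0 \<le> u \<Longrightarrow> (1 + u) ^ (N + M) \<le> L * exp (c * u\<^sup>2)"
    using power_le_exp_square[OF assms(2)] by blast
  have "(1 + norm x) ^ N * norm (h x) \<le> K * L" for x
  proof -
    have "(1 + norm x) ^ N * norm (h x) \<le> (1 + norm x) ^ N * (K * (1 + norm x) ^ M * exp (- c * (norm x)\<^sup>2))"
      unfolding h norm_mult norm_of_real abs_exp_cancel by (intro mult_left_mono mult_right_mono K) auto
    also have "\<dots> = K * ((1 + norm x) ^ (N + M) * exp (- c * (norm x)\<^sup>2))"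
      by (simp add: power_add)
    also have "\<dots> \<le> K * ((L * exp (c * (norm x)\<^sup>2)) * exp (- c * (norm x)\<^sup>2))"
      using K by (intro mult_left_mono mult_right_mono L) auto
    also have "\<dots> = K * L" by (simp add: exp_minus)
    finally show ?thesis .
  qed
  then show "\<exists>K. \<forall>x. (1 + norm x) ^ N * norm (h x) \<le> K" by blast
qed

lemma schwartz_gauss: "c > 0 \<Longrightarrow> schwartz (\<lambda>x. of_real (exp (- c * (norm x)\<^sup>2)))"
  using schwartz_moderate_gauss[OF moderate_const[of 1]] by simp

lemma integral_gauss_cis_real:
  fixes s :: real
  shows "integrable lborel (\<lambda>t. of_real (exp (- pi * t\<^sup>2)) * cis (2 * pi * (s * t)))" (is ?I)
    "(LBINT t. of_real (exp (- pi * t\<^sup>2)) * cis (2 * pi * (s * t))) = of_real (exp (- pi * s\<^sup>2))" (is ?E)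
proof -
  show ?I
    using integrable_mult_cis[OF schwartz_integrable[OF schwartz_gauss[of pi]], of "\<lambda>t::real. 2 * pi * (s * t)"] by simp
  \<comment> \<open>Rescaling by \<open>sqrt (2 * pi)\<close> carries the standard normal density to
    \<open>exp (- pi * t^2)\<close> and its characteristic function to the same Gaussian.\<close>
  define q where "q = sqrt (2 * pi)"
  have q: "q > 0" "q\<^sup>2 = 2 * pi" by (simp_all add: q_def)
  let ?f = "\<lambda>x. std_normal_density x *\<^sub>R exp (\<i> * of_real (s * q * x))"
  have "of_real (exp (- ((s * q)\<^sup>2 / 2))) = char std_normal_distribution (s * q)"
    by (simp add: char_std_normal_distribution)
  also have "\<dots> = (LBINT x. ?f x)"
    unfolding char_def by (subst integral_density) (auto simp: normal_density_nonneg)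
  also have "\<dots> = \<bar>q\<bar> *\<^sub>R (LBINT t. ?f (0 + q * t))"
    by (rule lborel_integral_real_affine) (use q in simp)
  also have "\<dots> = (LBINT t. q *\<^sub>R ?f (q * t))"
    using q by (simp only: integral_scaleR_right abs_of_pos add_0)
  also have "(\<lambda>t. q *\<^sub>R ?f (q * t)) = (\<lambda>t. of_real (exp (- pi * t\<^sup>2)) * cis (2 * pi * (s * t)))"
  proof
    fix t
    have "q * std_normal_density (q * t) = exp (- pi * t\<^sup>2)"
      using q by (simp add: std_normal_density_def q_def[symmetric] power_mult_distrib)
    moreover have "exp (\<i> * of_real (s * q * (q * t))) = cis (2 * pi * (s * t))"
      using q by (simp add: cis_conv_exp power2_eq_square flip: of_real_mult) (metis mult.commute mult.left_commute)
    ultimately show "q *\<^sub>R ?f (q * t) = of_real (exp (- pi * t\<^sup>2)) * cis (2 * pi * (s * t))"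
      by (metis scaleR_conv_of_real scaleR_scaleR)
  qed
  also have "(s * q)\<^sup>2 / 2 = pi * s\<^sup>2" using q by (simp add: power_mult_distrib)
  finally show ?E by simp
qed

text \<open>Both the Gaussian and the character factor over the coordinates, which reduces the claim
  to the line. The normalisation \<open>pi\<close> is the one that makes the Gaussian its own
  transform, with integral 1.\<close>

lemma inv_fourier_gauss:
  fixes r :: "'a::euclidean_space"
  shows "inv_fourier (\<lambda>x. of_real (exp (- pi * (norm x)\<^sup>2))) r = of_real (exp (- pi * (norm r)\<^sup>2))"
proof -
  have e: "complex_of_real (exp (- pi * (norm x)\<^sup>2)) = (\<Prod>b\<in>Basis. of_real (exp (- pi * (x \<bullet> b)\<^sup>2)))" for x :: 'a
  proof -
    have "(norm x)\<^sup>2 = (\<Sum>b\<in>Basis. (x \<bullet> b)\<^sup>2)"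
      unfolding power2_norm_eq_inner by (subst euclidean_inner) (simp only: power2_eq_square)
    then show ?thesis by (simp add: sum_distrib_left exp_sum flip: of_real_prod sum_negf)
  qed
  have c: "cis (2 * pi * (r \<bullet> x)) = (\<Prod>b\<in>Basis. cis (2 * pi * ((r \<bullet> b) * (x \<bullet> b))))" for x :: 'a
    by (subst euclidean_inner) (simp add: cis_conv_exp sum_distrib_left exp_sum)
  have "inv_fourier (\<lambda>x. of_real (exp (- pi * (norm x)\<^sup>2))) r
      = (LBINT x. (\<Prod>b\<in>Basis. of_real (exp (- pi * (x \<bullet> b)\<^sup>2)) * cis (2 * pi * ((r \<bullet> b) * (x \<bullet> b)))))"
    unfolding inv_fourier_def e c prod.distrib ..
  also have "\<dots> = (\<Prod>b\<in>Basis. (LBINT t. of_real (exp (- pi * t\<^sup>2)) * cis (2 * pi * ((r \<bullet> b) * t))))"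
    by (intro lborel_prod_Basis integral_gauss_cis_real)
  also have "\<dots> = of_real (exp (- pi * (norm r)\<^sup>2))"
    by (simp only: integral_gauss_cis_real e)
  finally show ?thesis .
qed

lemma integral_gauss: "(LBINT x. complex_of_real (exp (- pi * (norm (x :: 'a::euclidean_space))\<^sup>2))) = 1"
  using inv_fourier_gauss[of "0 :: 'a"] by (simp add: inv_fourier_def)

text \<open>Gaussian summation: a factor \<open>?g (e n *\<^sub>R v)\<close> makes the double
  integral absolutely convergent. One side tends to the inversion integral by dominated convergence.
  The other becomes an average of \<open>f (x - e n *\<^sub>R z)\<close> against a Gaussian of mass
  1 and tends to \<open>f x\<close>.\<close>

theorem fourier_inversion:
  fixes f :: "'a::euclidean_space \<Rightarrow> complex"
  assumes f: "schwartz f"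
  shows "inv_fourier (fourier f) x = f x"
proof -
  let ?g = "\<lambda>v :: 'a. complex_of_real (exp (- pi * (norm v)\<^sup>2))"
  define e where "e n = 1 / real (Suc n)" for n
  have e: "e n > 0" "e n \<noteq> 0" for n by (simp_all add: e_def)
  have e0: "e \<longlonglongrightarrow> 0" unfolding e_def by (rule LIMSEQ_Suc[OF lim_const_over_n])
  have [measurable]: "f \<in> borel_measurable borel"
    by (rule borel_measurable_smooth[OF schwartz_smooth[OF f]])
  then have [measurable]: "fourier f \<in> borel_measurable borel"
    by (rule borel_measurable_fourier)
  have gi: "integrable lborel ?g" by (intro schwartz_integrable schwartz_gauss) simp
  have gn: "norm (?g v) \<le> 1" for v by simp
  obtain B where B: "\<And>y. norm (f y) \<le> B"
    using schwartz_decay[OF f, of 0] by auto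
  let ?L = "\<lambda>n. LBINT v. fourier f v * cis (2 * pi * (x \<bullet> v)) * ?g (e n *\<^sub>R v)"
  have L1: "?L \<longlonglongrightarrow> (LBINT v. fourier f v * cis (2 * pi * (x \<bullet> v)) * ?g (0 *\<^sub>R v))"
  proof (rule integral_dominated_convergence[where w="\<lambda>v. norm (fourier f v)"])
    show "AE v in lborel. (\<lambda>n. fourier f v * cis (2 * pi * (x \<bullet> v)) * ?g (e n *\<^sub>R v))
        \<longlonglongrightarrow> fourier f v * cis (2 * pi * (x \<bullet> v)) * ?g (0 *\<^sub>R v)"
      by (intro AE_I2 tendsto_intros e0)
    show "AE v in lborel. norm (fourier f v * cis (2 * pi * (x \<bullet> v)) * ?g (e n *\<^sub>R v)) \<le> norm (fourier f v)" for n
      by (auto simp: norm_mult mult_left_le)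
  qed (use schwartz_fourier_integrable[OF f] in auto)
  have L2: "?L n = (LBINT z. f (x - e n *\<^sub>R z) * ?g z)" for n
  proof -
    let ?F = "\<lambda>p :: 'a \<times> 'a. f (snd p) * cis (2 * pi * ((x - snd p) \<bullet> fst p)) * ?g (e n *\<^sub>R fst p)"
    have F: "integrable lborel ?F"
      by (rule lborel_integrable_prod_bound[OF _ integrable_norm[OF lborel_integrable_affine[OF e(2)[of n] gi, where t=0]]
            integrable_norm[OF schwartz_integrable[OF f]]])
        (auto simp: norm_mult mult.commute)
    have "?L n = (LBINT v. LBINT y. ?F (v, y))"
    proof (rule Bochner_Integration.integral_cong[OF refl])
      fix v
      have "fourier f v * cis (2 * pi * (x \<bullet> v)) * ?g (e n *\<^sub>R v)
          = (LBINT y. f y * cis (- 2 * pi * (y \<bullet> v)) * (cis (2 * pi * (x \<bullet> v)) * ?g (e n *\<^sub>R v)))"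
        by (simp only: fourier_def integral_mult_left_zero[symmetric] mult.assoc)
      also have "\<dots> = (LBINT y. ?F (v, y))"
      proof (intro Bochner_Integration.integral_cong refl)
        fix y
        have "cis (2 * pi * ((x - y) \<bullet> v)) = cis (- 2 * pi * (y \<bullet> v)) * cis (2 * pi * (x \<bullet> v))"
          by (simp add: cis_mult inner_diff_left algebra_simps)
        then show "f y * cis (- 2 * pi * (y \<bullet> v)) * (cis (2 * pi * (x \<bullet> v)) * ?g (e n *\<^sub>R v)) = ?F (v, y)"
          by (simp only: fst_conv snd_conv mult.assoc)
      qed
      finally show "fourier f v * cis (2 * pi * (x \<bullet> v)) * ?g (e n *\<^sub>R v) = (LBINT y. ?F (v, y))" .
    qed
    also have "\<dots> = (LBINT y. LBINT v. ?F (v, y))"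
      by (rule lborel_Fubini[OF F])
    \<comment> \<open>Substituting \<open>y = x - e n *\<^sub>R z\<close> yields the power of
      \<open>e n\<close> that undoes the dilation of the Gaussian in the inner integral, which is
      then self-dual.\<close>
    also have "\<dots> = \<bar>- e n\<bar> ^ DIM('a) *\<^sub>R (LBINT z. LBINT v. ?F (v, x + (- e n) *\<^sub>R z))"
      by (rule lborel_integral_affine) (use e in auto)
    also have "\<dots> = (LBINT z. f (x - e n *\<^sub>R z) * (\<bar>e n\<bar> ^ DIM('a) *\<^sub>R
        (LBINT v. ?g (0 + e n *\<^sub>R v) * cis (2 * pi * (z \<bullet> (0 + e n *\<^sub>R v))))))"
      by (simp add: mult_ac flip: integral_scaleR_right integral_mult_right_zero)
    also have "\<dots> = (LBINT z. f (x - e n *\<^sub>R z) * inv_fourier ?g z)"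
      unfolding inv_fourier_def by (subst lborel_integral_affine[OF e(2), symmetric]) auto
    finally show ?thesis by (simp only: inv_fourier_gauss)
  qed
  have "(\<lambda>n. LBINT z. f (x - e n *\<^sub>R z) * ?g z) \<longlonglongrightarrow> (LBINT z. f (x - 0 *\<^sub>R z) * ?g z)"
  proof (rule integral_dominated_convergence[where w="\<lambda>z. B * norm (?g z)"])
    show "AE z in lborel. (\<lambda>n. f (x - e n *\<^sub>R z) * ?g z) \<longlonglongrightarrow> f (x - 0 *\<^sub>R z) * ?g z"
      by (intro AE_I2 tendsto_mult tendsto_const isCont_tendsto_compose[of _ f] smooth_isCont schwartz_smooth f tendsto_intros e0)
    show "AE z in lborel. norm (f (x - e n *\<^sub>R z) * ?g z) \<le> B * norm (?g z)" for n
      by (intro AE_I2) (auto simp: norm_mult intro!: mult_right_mono B)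
  qed (use integrable_norm[OF gi] in auto)
  with L1 have "(LBINT v. fourier f v * cis (2 * pi * (x \<bullet> v)) * ?g (0 *\<^sub>R v)) = (LBINT z. f (x - 0 *\<^sub>R z) * ?g z)"
    unfolding L2 by (rule LIMSEQ_unique)
  then show ?thesis
    using integral_gauss[where 'a='a] by (simp add: inv_fourier_def)
qed

section \<open>Slices and decay\<close>

text \<open>The fixed integrable weight behind the estimates below. Its exponent is proportional to
  the dimension, so exponents add up on products.\<close>

definition decay :: "'a::euclidean_space \<Rightarrow> real" where
  "decay x = 1 / (1 + norm x) ^ (2 * DIM('a))"

lemma decay_pos:
  fixes x :: "'a::euclidean_space"
  shows "0 < decay x"
proof -
  have "0 < 1 + norm x" by simp
  then show ?thesis unfolding decay_def by (intro divide_pos_pos zero_less_power) auto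
qed

lemma decay_nonneg [simp]: "0 \<le> decay x"
  using decay_pos[of x] by simp

lemma decay_le_1:
  fixes x :: "'a::euclidean_space"
  shows "decay x \<le> 1"
proof -
  have "1 \<le> (1 + norm x) ^ (2 * DIM('a))" by (rule one_le_power) simp
  then show ?thesis unfolding decay_def by (subst divide_le_eq_1_pos) linarith+
qed

lemma borel_measurable_decay [measurable]: "decay \<in> borel_measurable borel"
  unfolding decay_def by measurable

lemma integrable_decay: "integrable lborel decay"
  unfolding decay_def by (rule integrable_inverse_power_norm) simp

text \<open>Each component has norm at most that of the pair, and dimensions add. This lets a decay
  bound in joint variables be separated into integrable factors.\<close>

lemma decay_Pair: "decay (x, y) \<le> decay x * decay y"
proof -
  have "(1 + norm x) ^ (2 * DIM('a)) * (1 + norm y) ^ (2 * DIM('b))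
      \<le> (1 + norm (x, y)) ^ (2 * DIM('a)) * (1 + norm (x, y)) ^ (2 * DIM('b))"
    using norm_fst_le[of x y] norm_snd_le[of y x] by (intro mult_mono power_mono) auto
  also have "\<dots> = (1 + norm (x, y)) ^ (2 * DIM('a \<times> 'b))"
    by (simp add: power_add algebra_simps)
  finally have le: "(1 + norm x) ^ (2 * DIM('a)) * (1 + norm y) ^ (2 * DIM('b)) \<le> (1 + norm (x, y)) ^ (2 * DIM('a \<times> 'b))" .
  have "0 < 1 + norm x" "0 < 1 + norm y" by simp_all
  then have "0 < (1 + norm x) ^ (2 * DIM('a)) * (1 + norm y) ^ (2 * DIM('b))" by simp
  then show ?thesis
    unfolding decay_def using le by (simp add: divide_le_eq_1 frac_le)
qed

lemma le_decay_mult: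
  fixes r :: "'a::euclidean_space"
  assumes "(1 + norm r) ^ (2 * DIM('a)) * x \<le> y"
  shows "x \<le> decay r * y"
proof -
  have "0 < 1 + norm r" by simp
  then have "0 < (1 + norm r) ^ (2 * DIM('a))" by (rule zero_less_power)
  with assms show ?thesis by (simp add: decay_def pos_le_divide_eq mult.commute)
qed

lemma schwartz_norm_decay:
  fixes f :: "'a::euclidean_space \<Rightarrow> complex"
  assumes "schwartz f" "set bs \<subseteq> Basis" "length bs \<le> 2 * DIM('a)"
  shows "norm (iter_partial bs f x) \<le> schwartz_norm (2 * DIM('a)) f * decay x"
proof -
  show ?thesis
    using le_decay_mult[OF schwartz_norm_ge[OF assms, of x]] by (simp only: mult.commute)
qed

lemma mem_Basis_prod: "b \<in> Basis \<Longrightarrow> (b, 0) \<in> Basis" "b \<in> Basis \<Longrightarrow> (0, b) \<in> Basis"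
  unfolding Basis_prod_def by blast+

lemma schwartz_affine:
  fixes A :: "'a::euclidean_space \<Rightarrow> 'b::euclidean_space"
  assumes f: "schwartz f" and A: "linear A" "\<And>b. b \<in> Basis \<Longrightarrow> A b \<in> Basis" "\<And>x. norm x \<le> norm (A x)"
  shows "schwartz (\<lambda>x. f (A x + c))"
  unfolding schwartz_iff
proof (intro conjI allI impI)
  show "smooth (\<lambda>x. f (A x + c))"
    using A by (intro smooth_affine[where s=1]) (auto intro: schwartz_smooth f)
  fix N and bs :: "'a list" assume bs: "set bs \<subseteq> Basis"
  then have "set (map A bs) \<subseteq> Basis" using A(2) by auto
  then obtain K where K: "K > 0" "\<And>x. (1 + norm x) ^ N * norm (iter_partial (map A bs) f x) \<le> K"
    using schwartz_bound[OF f, of "map A bs" N] by metis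
  have "(1 + norm x) ^ N * norm (iter_partial bs (\<lambda>x. f (A x + c)) x) \<le> (1 + norm c) ^ N * K" for x
  proof -
    \<comment> \<open>The shift by \<open>c\<close> costs only a constant, since
      \<open>1 + norm x\<close> is at most
      \<open>(1 + norm c) * (1 + norm (A x + c))\<close>.\<close>
    have "norm x \<le> norm (A x + c) + norm c"
      using A(3)[of x] norm_triangle_ineq4[of "A x + c" c] by simp
    also have "\<dots> \<le> (1 + norm c) * (1 + norm (A x + c)) - 1" by (simp add: algebra_simps)
    finally have "(1 + norm x) ^ N \<le> ((1 + norm c) * (1 + norm (A x + c))) ^ N"
      by (intro power_mono) auto
    then have "(1 + norm x) ^ N * norm (iter_partial (map A bs) f (A x + c))
      \<le> (1 + norm c) ^ N * ((1 + norm (A x + c)) ^ N * norm (iter_partial (map A bs) f (A x + c)))"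
      unfolding power_mult_distrib mult.assoc[symmetric] by (rule mult_right_mono) simp
    also have "\<dots> \<le> (1 + norm c) ^ N * K"
      by (intro mult_left_mono K) auto
    finally show ?thesis by (simp add: iter_partial_affine_Basis[OF A(1)])
  qed
  then show "\<exists>K. \<forall>x. (1 + norm x) ^ N * norm (iter_partial bs (\<lambda>x. f (A x + c)) x) \<le> K" by blast
qed

lemma inv_fourier_slice_bound:
  obtains K where "K > 0"
    "\<And>(A :: 'a::euclidean_space \<Rightarrow> 'b::euclidean_space) c q f r.
      schwartz (f :: 'b \<Rightarrow> complex) \<Longrightarrow> linear A \<Longrightarrow> (\<And>b. b \<in> Basis \<Longrightarrow> A b \<in> Basis) \<Longrightarrow> (\<And>x. norm x \<le> norm (A x)) \<Longrightarrow>
      DIM('a) \<le> DIM('b) \<Longrightarrow> (\<And>x. decay (A x + c) \<le> decay x * q) \<Longrightarrow>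
      norm (inv_fourier (\<lambda>x. f (A x + c)) r) \<le> K * schwartz_norm (2 * DIM('b)) f * decay r * q"
proof -
  define J where "J = (LBINT x. decay (x :: 'a))"
  have J0: "0 \<le> J" unfolding J_def by (intro integral_nonneg_AE) simp
  define K where "K = (2 * DIM('a)) ^ (2 * DIM('a)) * (J + DIM('a) * J) + 1"
  show thesis
  proof (rule that[of K])
    show "K > 0" using J0 by (simp add: K_def add_nonneg_pos)
    fix A :: "'a \<Rightarrow> 'b" and c and f :: "'b \<Rightarrow> complex" and r and q :: real
    assume f: "schwartz f" and A: "linear A" "\<And>b. b \<in> Basis \<Longrightarrow> A b \<in> Basis" "\<And>x. norm x \<le> norm (A x)"
      and D: "DIM('a) \<le> DIM('b)" and q: "\<And>x. decay (A x + c) \<le> decay x * q"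
    let ?S = "schwartz_norm (2 * DIM('b)) f"
    have S0: "0 \<le> ?S" by (rule schwartz_norm_nonneg[OF f])
    have q0: "0 \<le> q"
      using q[of 0] decay_pos[of "A 0 + c"] decay_pos[of "0 :: 'a"] by (smt (verit) mult_less_0_iff)
    have sl: "schwartz (\<lambda>x. f (A x + c))" by (rule schwartz_affine[OF f A])
    have b: "(LBINT x. norm (iter_partial bs (\<lambda>x. f (A x + c)) x)) \<le> J * (q * ?S)"
      if bs: "set bs \<subseteq> Basis" "length bs \<le> 2 * DIM('a)" for bs
    proof -
      have "(LBINT x. norm (iter_partial bs (\<lambda>x. f (A x + c)) x)) \<le> (LBINT x. decay (x :: 'a) * (q * ?S))"
      proof (rule integral_mono)
        show "integrable lborel (\<lambda>x. norm (iter_partial bs (\<lambda>x. f (A x + c)) x))"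
          using sl bs by (intro integrable_norm schwartz_integrable schwartz_iter_partial)
        show "integrable lborel (\<lambda>x :: 'a. decay x * (q * ?S))"
          by (intro integrable_mult_left integrable_decay)
        fix x :: 'a
        have "norm (iter_partial (map A bs) f (A x + c)) \<le> ?S * decay (A x + c)"
          using bs A D by (intro schwartz_norm_decay f) auto
        also have "\<dots> \<le> ?S * (decay x * q)" by (intro mult_left_mono q S0)
        finally show "norm (iter_partial bs (\<lambda>x. f (A x + c)) x) \<le> decay x * (q * ?S)"
          by (simp add: iter_partial_affine_Basis[OF A(1)] mult_ac)
      qed
      then show ?thesis by (simp only: J_def integral_mult_left_zero)
    qed
    have "(1 + norm r) ^ (2 * DIM('a)) * norm (inv_fourier (\<lambda>x. f (A x + c)) r)
        \<le> (2 * DIM('a)) ^ (2 * DIM('a)) * (J * (q * ?S) + (\<Sum>b\<in>(Basis::'a set). J * (q * ?S)))"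
      using b[of "[]"]
      by (intro order_trans[OF inv_fourier_decay[OF sl]] mult_left_mono add_mono sum_mono b) auto
    also have "\<dots> = (K - 1) * (q * ?S)"
      by (simp add: K_def algebra_simps)
    also have "\<dots> \<le> K * (q * ?S)"
      by (intro mult_right_mono mult_nonneg_nonneg q0 S0) simp
    finally have *: "(1 + norm r) ^ (2 * DIM('a)) * norm (inv_fourier (\<lambda>x. f (A x + c)) r) \<le> K * (q * ?S)" .
    from le_decay_mult[OF *]
    show "norm (inv_fourier (\<lambda>x. f (A x + c)) r) \<le> K * ?S * decay r * q"
      by (simp only: mult_ac)
  qed
qed

section \<open>Tempered distributions defined by Fourier multipliers\<close>

lemma inv_fourier_add:
  assumes "schwartz f" "schwartz g"
  shows "inv_fourier (\<lambda>x. f x + g x) r = inv_fourier f r + inv_fourier g r"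
  unfolding inv_fourier_def distrib_right
  using integrable_mult_cis[OF schwartz_integrable[OF assms(1)], of "\<lambda>x. 2 * pi * (r \<bullet> x)"]
    integrable_mult_cis[OF schwartz_integrable[OF assms(2)], of "\<lambda>x. 2 * pi * (r \<bullet> x)"]
  by (intro Bochner_Integration.integral_add) auto

lemma inv_fourier_cmult: "inv_fourier (\<lambda>x. c * f x) r = c * inv_fourier f r"
  by (simp add: inv_fourier_def mult.assoc)

lemma tempered_inv_fourier_dist:
  fixes m :: "'a::euclidean_space \<Rightarrow> complex"
  assumes [measurable]: "m \<in> borel_measurable borel" and B: "\<And>x. norm (m x) \<le> B"
  shows "tempered_distribution (inv_fourier_dist (reg_dist m))"
proof -
  have int: "integrable lborel (\<lambda>x. m x * inv_fourier \<phi> x)" if "schwartz \<phi>" for \<phi>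
  proof (rule Bochner_Integration.integrable_bound)
    show "integrable lborel (\<lambda>x. B * norm (inv_fourier \<phi> x))"
      by (intro integrable_mult_right integrable_norm schwartz_inv_fourier_integrable that)
    have [measurable]: "inv_fourier \<phi> \<in> borel_measurable borel"
      by (intro borel_measurable_inv_fourier borel_measurable_smooth schwartz_smooth that)
    show "(\<lambda>x. m x * inv_fourier \<phi> x) \<in> borel_measurable lborel" by measurable
    have "0 \<le> B" using norm_ge_zero order_trans B by blast
    then show "AE x in lborel. norm (m x * inv_fourier \<phi> x) \<le> norm (B * norm (inv_fourier \<phi> x))"
      by (auto simp: norm_mult intro!: AE_I2 mult_right_mono B)
  qed
  obtain K where "K > 0" and slice: "\<And>(A :: 'a \<Rightarrow> 'a) c q f r.
      schwartz f \<Longrightarrow> linear A \<Longrightarrow> (\<And>b. b \<in> Basis \<Longrightarrow> A b \<in> Basis) \<Longrightarrow> (\<And>x. norm x \<le> norm (A x)) \<Longrightarrow>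
      DIM('a) \<le> DIM('a) \<Longrightarrow> (\<And>x. decay (A x + c) \<le> decay x * q) \<Longrightarrow>
      norm (inv_fourier (\<lambda>x. f (A x + c)) r) \<le> K * schwartz_norm (2 * DIM('a)) f * decay r * q"
    using inv_fourier_slice_bound[where 'a='a and 'b='a] by blast
  have K: "norm (inv_fourier f r) \<le> K * schwartz_norm (2 * DIM('a)) f * decay r" if "schwartz f" for f :: "'a \<Rightarrow> complex" and r
    \<comment> \<open>The trivial slice: \<open>A\<close> is the identity, \<open>c = 0\<close> and
      \<open>q = 1\<close>.\<close>
    using slice[OF that, of "\<lambda>x. x" 0 1 r] by (simp add: linear_id[unfolded id_def])
  show ?thesis
    unfolding tempered_distribution_def
  proof (intro conjI allI impI exI)
    fix \<phi> \<psi> :: "'a \<Rightarrow> complex" assume "schwartz \<phi>" "schwartz \<psi>"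
    then show "inv_fourier_dist (reg_dist m) (\<lambda>x. \<phi> x + \<psi> x)
      = inv_fourier_dist (reg_dist m) \<phi> + inv_fourier_dist (reg_dist m) \<psi>"
      using int by (simp add: inv_fourier_dist_def reg_dist_def inv_fourier_add distrib_left)
  next
    fix c and \<phi> :: "'a \<Rightarrow> complex"
    show "inv_fourier_dist (reg_dist m) (\<lambda>x. c * \<phi> x) = c * inv_fourier_dist (reg_dist m) \<phi>"
      by (simp add: inv_fourier_dist_def reg_dist_def inv_fourier_cmult mult.left_commute)
  next
    fix \<phi> :: "'a \<Rightarrow> complex" assume \<phi>: "schwartz \<phi>"
    have "norm (inv_fourier_dist (reg_dist m) \<phi>) \<le> (LBINT x. norm (m x * inv_fourier \<phi> x))"
      unfolding inv_fourier_dist_def reg_dist_def by (rule integral_norm_bound)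
    also have "\<dots> \<le> (LBINT x. decay (x :: 'a) * (B * K * schwartz_norm (2 * DIM('a)) \<phi>))"
    proof (rule integral_mono)
      fix x :: 'a
      have "norm (m x * inv_fourier \<phi> x) \<le> B * (K * schwartz_norm (2 * DIM('a)) \<phi> * decay x)"
        unfolding norm_mult by (intro mult_mono B K \<phi>) (use norm_ge_zero order_trans B in blast, simp)
      then show "norm (m x * inv_fourier \<phi> x) \<le> decay x * (B * K * schwartz_norm (2 * DIM('a)) \<phi>)"
        by (simp only: mult_ac)
    qed (auto intro!: int \<phi> integrable_mult_left integrable_decay)
    also have "\<dots> = ((LBINT x. decay (x :: 'a)) * (B * K)) * schwartz_norm (2 * DIM('a)) \<phi>"
      by (simp only: integral_mult_left_zero mult.assoc)
    finally show "norm (inv_fourier_dist (reg_dist m) \<phi>)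
      \<le> ((LBINT x. decay (x :: 'a)) * (B * K)) * schwartz_norm (2 * DIM('a)) \<phi>" .
  qed
qed

lemma norm_fourier_le: "norm (fourier f r) \<le> (LBINT x. norm (f x))"
  by (simp add: fourier_eq_inv_fourier norm_inv_fourier_le)

lemma tempered_distribution_cong:
  assumes "tempered_distribution u" "\<And>\<phi>. schwartz \<phi> \<Longrightarrow> u \<phi> = v \<phi>"
  shows "tempered_distribution v"
  using assms(1) unfolding tempered_distribution_def
  by (simp add: assms(2)[symmetric] schwartz_add schwartz_cmult)

lemma continuous_linear_op_fourier_multiplier:
  fixes \<sigma> :: "'a::euclidean_space \<Rightarrow> complex"
  assumes [measurable]: "\<sigma> \<in> borel_measurable borel" and B: "\<And>x. norm (\<sigma> x) \<le> B"
  shows "continuous_linear_op (fourier_multiplier \<sigma>)"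
  unfolding continuous_linear_op_def
proof (intro conjI allI impI)
  have B0: "0 \<le> B" using norm_ge_zero order_trans B by blast
  fix f :: "'a \<Rightarrow> complex" assume f: "schwartz f"
  have fm [measurable]: "fourier f \<in> borel_measurable borel" "inv_fourier f \<in> borel_measurable borel"
    by (intro borel_measurable_fourier borel_measurable_inv_fourier borel_measurable_schwartz f)+
  show "tempered_distribution (fourier_multiplier \<sigma> f)"
    unfolding fourier_multiplier_def
  proof (rule tempered_inv_fourier_dist)
    show "norm (\<sigma> \<xi> * fourier f \<xi>) \<le> B * (LBINT x. norm (f x))" for \<xi>
      unfolding norm_mult by (intro mult_mono B norm_fourier_le B0) simp
  qed measurable
  \<comment> \<open>For continuity in the operator's argument the roles are exchanged: after the
    reflection \<open>\<xi> \<mapsto> - \<xi>\<close>, the fixed test function becomes part of the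
    multiplier \<open>?m\<close> and the argument becomes the test function.\<close>
  let ?m = "\<lambda>\<xi>. \<sigma> (- \<xi>) * inv_fourier f (- \<xi>)"
  have m: "?m \<in> borel_measurable borel"
    by (intro borel_measurable_times borel_measurable_compose_continuous[OF assms(1)]
        borel_measurable_compose_continuous[OF fm(2)] continuous_intros)
  have eq: "inv_fourier_dist (reg_dist ?m) g = fourier_multiplier \<sigma> g f" if "schwartz g" for g
  proof -
    have [measurable]: "fourier g \<in> borel_measurable borel"
      by (intro borel_measurable_fourier borel_measurable_schwartz that)
    have "fourier_multiplier \<sigma> g f = (LBINT \<xi>. \<sigma> \<xi> * fourier g \<xi> * inv_fourier f \<xi>)"
      by (simp add: fourier_multiplier_def inv_fourier_dist_def reg_dist_def)
    also have "\<dots> = (LBINT \<xi>. \<sigma> (0 - \<xi>) * fourier g (0 - \<xi>) * inv_fourier f (0 - \<xi>))"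
      by (rule lborel_integral_translate(2)[symmetric]) measurable
    finally show ?thesis
      by (simp add: inv_fourier_dist_def reg_dist_def fourier_eq_inv_fourier mult_ac)
  qed
  have T: "tempered_distribution (inv_fourier_dist (reg_dist ?m))"
  proof (rule tempered_inv_fourier_dist)
    show "norm (?m \<xi>) \<le> B * (LBINT x. norm (f x))" for \<xi>
      unfolding norm_mult by (intro mult_mono B norm_inv_fourier_le B0) simp
  qed (rule m)
  show "tempered_distribution (\<lambda>g. fourier_multiplier \<sigma> g f)"
    by (rule tempered_distribution_cong[OF T eq])
qed

lemma borel_measurable_b_symbol:
  fixes \<sigma> :: "'a::euclidean_space \<Rightarrow> complex"
  assumes [measurable]: "\<sigma> \<in> borel_measurable borel"
  shows "(\<lambda>p. b_symbol \<sigma> (fst p) (snd p)) \<in> borel_measurable borel"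
proof -
  have c: "(\<lambda>x. cnj (\<sigma> x)) \<in> borel_measurable borel"
    by (rule measurable_compose[OF assms borel_measurable_continuous_onI[OF continuous_on_cnj[OF continuous_on_id]]])
  show ?thesis
    unfolding b_symbol_def
    by (intro borel_measurable_times borel_measurable_compose_continuous[OF assms]
        borel_measurable_compose_continuous[OF c] continuous_intros)
qed

lemma norm_b_symbol_le:
  assumes "\<And>x. norm (\<sigma> x) \<le> B"
  shows "norm (b_symbol \<sigma> \<xi> r) \<le> B * B"
proof -
  have "0 \<le> B" using norm_ge_zero order_trans assms by blast
  then show ?thesis
    unfolding b_symbol_def norm_mult complex_mod_cnj by (intro mult_mono assms) auto
qed

lemma tempered_a_dist:
  fixes \<sigma> :: "'a::euclidean_space \<Rightarrow> complex"
  assumes "\<sigma> \<in> borel_measurable borel" "\<And>x. norm (\<sigma> x) \<le> B"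
  shows "tempered_distribution (a_dist \<sigma> \<xi>)"
  unfolding a_dist_def
  by (rule tempered_inv_fourier_dist[OF _ norm_b_symbol_le[OF assms(2)]])
    (use borel_measurable_Pair_section(2)[OF borel_measurable_b_symbol[OF assms(1)]] in simp)

section \<open>The kernel as a tempered distribution\<close>

text \<open>After Fubini and the translation \<open>x = y + s\<close>, the character splits into a
  factor in \<open>x\<close> and one in \<open>y\<close>. Thus the transform of a diagonal integral
  is expressed by transforms of slices, for which bounds are available.\<close>

lemma inv_fourier_diagonal:
  fixes G :: "'a::euclidean_space \<times> 'a \<Rightarrow> complex"
  assumes G: "integrable lborel G"
  shows "inv_fourier (\<lambda>s. LBINT y. G (y + s, y)) r
    = (LBINT y. cis (- 2 * pi * (y \<bullet> r)) * inv_fourier (\<lambda>x. G (x, y)) r)"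
proof -
  have Gm: "G \<in> borel_measurable borel" using G by auto
  let ?H = "\<lambda>z :: 'a \<times> 'a. G (snd z + fst z, snd z) * cis (2 * pi * (r \<bullet> fst z))"
  have "(\<lambda>z :: 'a \<times> 'a. (fst z + snd z, snd z)) \<in> borel_measurable borel"
    by (intro borel_measurable_continuous_onI continuous_intros)
  then have M: "(\<lambda>z :: 'a \<times> 'a. (fst z + snd z, snd z)) \<in> measurable lborel borel"
    by simp
  have "integrable (distr lborel borel (\<lambda>z :: 'a \<times> 'a. (fst z + snd z, snd z))) G"
    using G lborel_distr_shear[of "\<lambda>x :: 'a. x"] by simp
  then have "integrable lborel (\<lambda>z. G (snd z + fst z, snd z))"
    using integrable_distr_eq[OF M Gm] by (simp add: add.commute)
  then have H: "integrable lborel ?H"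
    by (rule integrable_mult_cis) simp
  have "inv_fourier (\<lambda>s. LBINT y. G (y + s, y)) r = (LBINT s. LBINT y. ?H (s, y))"
    by (simp add: inv_fourier_def)
  also have "\<dots> = (LBINT y. LBINT s. ?H (s, y))"
    by (rule lborel_Fubini[OF H])
  also have "\<dots> = (LBINT y. cis (- 2 * pi * (y \<bullet> r)) * inv_fourier (\<lambda>x. G (x, y)) r)"
  proof (rule Bochner_Integration.integral_cong[OF refl])
    fix y :: 'a
    have [measurable]: "(\<lambda>x. G (x, y)) \<in> borel_measurable borel"
      by (rule borel_measurable_Pair_section[OF Gm])
    have "(LBINT s. ?H (s, y)) = (LBINT s. G (s + y, y) * cis (2 * pi * (r \<bullet> (s + y - y))))"
      by (simp add: add.commute)
    also have "\<dots> = (LBINT x. G (x, y) * cis (2 * pi * (r \<bullet> (x - y))))"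
      by (rule lborel_integral_translate(1)) measurable
    also have "\<dots> = (LBINT x. cis (- 2 * pi * (y \<bullet> r)) * (G (x, y) * cis (2 * pi * (r \<bullet> x))))"
    proof (rule Bochner_Integration.integral_cong[OF refl])
      fix x
      have "cis (2 * pi * (r \<bullet> (x - y))) = cis (- 2 * pi * (y \<bullet> r)) * cis (2 * pi * (r \<bullet> x))"
        by (simp add: cis_mult inner_diff_right inner_commute algebra_simps)
      then show "G (x, y) * cis (2 * pi * (r \<bullet> (x - y))) = cis (- 2 * pi * (y \<bullet> r)) * (G (x, y) * cis (2 * pi * (r \<bullet> x)))"
        by (simp only: mult_ac)
    qed
    finally show "(LBINT s. ?H (s, y)) = cis (- 2 * pi * (y \<bullet> r)) * inv_fourier (\<lambda>x. G (x, y)) r"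
      by (simp only: inv_fourier_def integral_mult_right_zero)
  qed
  finally show ?thesis .
qed

text \<open>On Schwartz functions the kernel is a single integral over \<open>(\<xi>, r)\<close> of
  the bounded symbol \<open>?b\<close> against \<open>Q \<Phi>\<close>. The diagonal formula and the
  slice bound dominate \<open>Q \<Phi>\<close> by a seminorm of \<open>\<Phi>\<close> times a
  product of two integrable weights.\<close>

lemma tempered_delta_kernel:
  fixes \<sigma> :: "'a::euclidean_space \<Rightarrow> complex"
  assumes \<sigma>: "\<sigma> \<in> borel_measurable borel" and B: "\<And>x. norm (\<sigma> x) \<le> B"
  shows "tempered_distribution (delta_kernel (a_dist \<sigma>))"
proof -
  let ?b = "\<lambda>p. b_symbol \<sigma> (fst p) (snd p)"
  let ?N = "2 * DIM(('a \<times> 'a) \<times> ('a \<times> 'a))"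
  define g where "g \<Phi> p s = (LBINT y. \<Phi> ((y + s, p), (y, p)))"
    for \<Phi> :: "('a \<times> 'a) \<times> ('a \<times> 'a) \<Rightarrow> complex" and p s :: 'a
  define Q where "Q \<Phi> p = inv_fourier (g \<Phi> (fst p)) (snd p)" for \<Phi> and p :: "'a \<times> 'a"
  note [measurable] = borel_measurable_b_symbol[OF \<sigma>]
  have B0: "0 \<le> B * B" by simp
  define J where "J = (LBINT x. decay (x :: 'a))"
  obtain K where K: "K > 0" "\<And>(A :: 'a \<Rightarrow> ('a \<times> 'a) \<times> ('a \<times> 'a)) c q f r.
      schwartz f \<Longrightarrow> linear A \<Longrightarrow> (\<And>b. b \<in> Basis \<Longrightarrow> A b \<in> Basis) \<Longrightarrow> (\<And>x. norm x \<le> norm (A x)) \<Longrightarrow>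
      DIM('a) \<le> DIM(('a \<times> 'a) \<times> ('a \<times> 'a)) \<Longrightarrow> (\<And>x. decay (A x + c) \<le> decay x * q) \<Longrightarrow>
      norm (inv_fourier (\<lambda>x. f (A x + c)) r) \<le> K * schwartz_norm ?N f * decay r * q"
    using inv_fourier_slice_bound[where 'a='a and 'b="('a \<times> 'a) \<times> ('a \<times> 'a)"] by blast
  \<comment> \<open>The frequency occupies two slots, so its weight appears twice; one copy is
    estimated by 1.\<close>
  have dec: "decay ((x, p), (y, p)) \<le> decay x * (decay p * decay y)" for x y p :: 'a
  proof -
    have "decay ((x, p), (y, p)) \<le> decay (x, p) * decay (y, p)" by (rule decay_Pair)
    also have "\<dots> \<le> (decay x * decay p) * (decay y * decay p)"
      by (intro mult_mono decay_Pair) auto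
    also have "\<dots> \<le> (decay x * decay p) * (decay y * 1)"
      by (intro mult_left_mono decay_le_1) auto
    finally show ?thesis by (simp add: mult_ac)
  qed
  have cont: "continuous_on S \<Phi>" if "schwartz \<Phi>" for S and \<Phi> :: "('a \<times> 'a) \<times> ('a \<times> 'a) \<Rightarrow> complex"
    by (intro smooth_continuous_on schwartz_smooth that)
  have Gint: "integrable lborel (\<lambda>z. \<Phi> ((fst z, p), (snd z, p)))"
    if "schwartz \<Phi>" for \<Phi> :: "('a \<times> 'a) \<times> ('a \<times> 'a) \<Rightarrow> complex" and p
  proof (rule lborel_integrable_prod_bound)
    show "(\<lambda>z :: 'a \<times> 'a. \<Phi> ((fst z, p), (snd z, p))) \<in> borel_measurable borel"
      by (intro borel_measurable_continuous_onI continuous_on_compose2[OF cont[OF that]] continuous_intros) auto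
    show "norm (\<Phi> ((fst (x, y), p), (snd (x, y), p))) \<le> decay x * (schwartz_norm ?N \<Phi> * decay y)" for x y
    proof -
      have "norm (\<Phi> ((x, p), (y, p))) \<le> schwartz_norm ?N \<Phi> * decay ((x, p), (y, p))"
        using schwartz_norm_decay[OF that, of "[]"] by simp
      also have "\<dots> \<le> schwartz_norm ?N \<Phi> * (decay x * (1 * decay y))"
        by (intro mult_left_mono order_trans[OF dec] mult_right_mono decay_le_1 schwartz_norm_nonneg that) auto
      finally show ?thesis by (simp add: mult_ac)
    qed
  qed (auto intro!: integrable_decay integrable_mult_right)
  have Qb: "norm (Q \<Phi> p) \<le> schwartz_norm ?N \<Phi> * (K * J) * (decay (fst p) * decay (snd p))"
    if \<Phi>: "schwartz \<Phi>" for \<Phi> p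
  proof -
    let ?f = "\<lambda>y x. \<Phi> ((x, fst p), (y, fst p))"
    have b: "norm (inv_fourier (?f y) (snd p)) \<le> K * schwartz_norm ?N \<Phi> * decay (snd p) * (decay (fst p) * decay y)" for y
    proof -
      have "norm (inv_fourier (\<lambda>x. \<Phi> ((\<lambda>x. ((x, 0), (0, 0))) x + ((0, fst p), (y, fst p)))) (snd p))
          \<le> K * schwartz_norm ?N \<Phi> * decay (snd p) * (decay (fst p) * decay y)"
      proof (rule K(2)[OF \<Phi>])
        show "((b, 0), 0, 0) \<in> (Basis :: (('a \<times> 'a) \<times> ('a \<times> 'a)) set)" if "b \<in> Basis" for b :: 'a
        proof -
          have "((b, 0 :: 'a), (0 :: 'a \<times> 'a)) \<in> Basis" by (intro mem_Basis_prod that)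
          then show ?thesis by (simp add: zero_prod_def)
        qed
        show "DIM('a) \<le> DIM(('a \<times> 'a) \<times> ('a \<times> 'a))" by simp
        show "decay (((x, 0), 0, 0) + ((0, fst p), y, fst p)) \<le> decay x * (decay (fst p) * decay y)" for x :: 'a
          using dec by simp
      qed (auto intro!: linearI simp: norm_Pair)
      then show ?thesis by simp
    qed
    have "Q \<Phi> p = (LBINT y. cis (- 2 * pi * (y \<bullet> snd p)) * inv_fourier (?f y) (snd p))"
      using inv_fourier_diagonal[OF Gint[OF \<Phi>, of "fst p"]] by (simp add: Q_def g_def[abs_def])
    also have "norm \<dots> \<le> (LBINT y. norm (cis (- 2 * pi * (y \<bullet> snd p)) * inv_fourier (?f y) (snd p)))"
      by (rule integral_norm_bound)
    also have "\<dots> \<le> (LBINT y. decay (y :: 'a) * (K * schwartz_norm ?N \<Phi> * decay (snd p) * decay (fst p)))"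
    proof (rule integral_mono')
      show "integrable lborel (\<lambda>y :: 'a. decay y * (K * schwartz_norm ?N \<Phi> * decay (snd p) * decay (fst p)))"
        by (intro integrable_mult_left integrable_decay)
      show "norm (cis (- 2 * pi * (y \<bullet> snd p)) * inv_fourier (?f y) (snd p))
          \<le> decay y * (K * schwartz_norm ?N \<Phi> * decay (snd p) * decay (fst p))" for y
        using b[of y] by (simp add: norm_mult mult_ac)
    qed (use K(1) schwartz_norm_nonneg[OF \<Phi>, of ?N] in \<open>auto intro!: mult_nonneg_nonneg\<close>)
    also have "\<dots> = schwartz_norm ?N \<Phi> * (K * J) * (decay (fst p) * decay (snd p))"
      unfolding J_def integral_mult_left_zero by (simp only: mult_ac)
    finally show ?thesis .
  qed
  have Qm: "Q \<Phi> \<in> borel_measurable borel" if \<Phi>: "schwartz \<Phi>" for \<Phi>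
  proof -
    have "(\<lambda>w :: (('a \<times> 'a) \<times> 'a) \<times> 'a.
        \<Phi> ((snd w + snd (fst w), fst (fst (fst w))), (snd w, fst (fst (fst w))))) \<in> borel_measurable borel"
      by (intro borel_measurable_continuous_onI continuous_on_compose2[OF cont[OF \<Phi>]] continuous_intros) auto
    from borel_measurable_LINT[OF this]
    have "(\<lambda>z :: ('a \<times> 'a) \<times> 'a. g \<Phi> (fst (fst z)) (snd z)) \<in> borel_measurable borel"
      by (simp add: g_def)
    then have "(\<lambda>z :: ('a \<times> 'a) \<times> 'a. g \<Phi> (fst (fst z)) (snd z) * cis (2 * pi * (snd (fst z) \<bullet> snd z))) \<in> borel_measurable borel"
      by (intro borel_measurable_times borel_measurable_continuous_onI[of "\<lambda>z. cis (c z)" for c]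
          continuous_on_cis continuous_intros)
    from borel_measurable_LINT[OF this] show ?thesis
      by (simp add: Q_def[abs_def] inv_fourier_def)
  qed
  have int: "integrable lborel (\<lambda>p. ?b p * Q \<Phi> p)" if \<Phi>: "schwartz \<Phi>" for \<Phi>
  proof (rule lborel_integrable_prod_bound)
    show "(\<lambda>p. ?b p * Q \<Phi> p) \<in> borel_measurable borel"
      using Qm[OF \<Phi>] by measurable
    show "norm (?b (x, y) * Q \<Phi> (x, y)) \<le> decay x * (B * B * (schwartz_norm ?N \<Phi> * (K * J)) * decay y)" for x y
    proof -
      have "norm (?b (x, y) * Q \<Phi> (x, y)) \<le> (B * B) * (schwartz_norm ?N \<Phi> * (K * J) * (decay x * decay y))"
        unfolding norm_mult using Qb[OF \<Phi>, of "(x, y)"] by (intro mult_mono norm_b_symbol_le B) auto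
      then show ?thesis by (simp only: mult_ac)
    qed
  qed (auto intro!: integrable_decay integrable_mult_right)
  have eq: "delta_kernel (a_dist \<sigma>) \<Phi> = (LBINT p. ?b p * Q \<Phi> p)" if "schwartz \<Phi>" for \<Phi>
    using lborel_integral_fst[OF int[OF that]]
    by (simp add: delta_kernel_def a_dist_def inv_fourier_dist_def reg_dist_def Q_def g_def[abs_def])
  \<comment> \<open>Fubini gives integrability of the section only for almost every
    \<open>s\<close>. Additivity of the inner integral therefore holds almost everywhere, which is
    enough under the outer integral.\<close>
  have gsec: "AE s in lborel. integrable lborel (\<lambda>y. \<Phi> ((y + s, p), (y, p)))"
    and gint: "integrable lborel (g \<Phi> p)" if \<Phi>: "schwartz \<Phi>" for \<Phi> p
  proof -
    note G = Gint[OF \<Phi>, of p]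
    then have Gm: "(\<lambda>z. \<Phi> ((fst z, p), (snd z, p))) \<in> borel_measurable borel" by auto
    have "(\<lambda>z :: 'a \<times> 'a. (fst z + snd z, snd z)) \<in> borel_measurable borel"
      by (intro borel_measurable_continuous_onI continuous_intros)
    then have M: "(\<lambda>z :: 'a \<times> 'a. (fst z + snd z, snd z)) \<in> measurable lborel borel" by simp
    have "integrable lborel (\<lambda>z. \<Phi> ((snd z + fst z, p), (snd z, p)))"
      using integrable_distr_eq[OF M Gm] lborel_distr_shear[of "\<lambda>x :: 'a. x"] G by (simp add: add.commute)
    from lborel_AE_integrable_fst[OF this] lborel_integrable_fst[OF this]
    show "AE s in lborel. integrable lborel (\<lambda>y. \<Phi> ((y + s, p), (y, p)))" "integrable lborel (g \<Phi> p)"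
      by (simp_all add: g_def[abs_def])
  qed
  show ?thesis
    unfolding tempered_distribution_def
  proof (intro conjI allI impI exI)
    fix \<Phi> \<Psi> :: "('a \<times> 'a) \<times> ('a \<times> 'a) \<Rightarrow> complex" assume \<Phi>: "schwartz \<Phi>" and \<Psi>: "schwartz \<Psi>"
    have "Q (\<lambda>x. \<Phi> x + \<Psi> x) p = Q \<Phi> p + Q \<Psi> p" for p
    proof -
      let ?e = "\<lambda>s. cis (2 * pi * (snd p \<bullet> s))"
      have "Q (\<lambda>x. \<Phi> x + \<Psi> x) p = (LBINT s. (g \<Phi> (fst p) s * ?e s + g \<Psi> (fst p) s * ?e s))"
        unfolding Q_def inv_fourier_def
      proof (rule integral_cong_AE)
        show "AE s in lborel. g (\<lambda>x. \<Phi> x + \<Psi> x) (fst p) s * ?e s = g \<Phi> (fst p) s * ?e s + g \<Psi> (fst p) s * ?e s"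
          using gsec[OF \<Phi>, of "fst p"] gsec[OF \<Psi>, of "fst p"]
          by eventually_elim (simp add: g_def distrib_right)
      qed (use gint[OF schwartz_add[OF \<Phi> \<Psi>], of "fst p"] gint[OF \<Phi>, of "fst p"] gint[OF \<Psi>, of "fst p"] in measurable)
      also have "\<dots> = Q \<Phi> p + Q \<Psi> p"
        unfolding Q_def inv_fourier_def
        by (intro Bochner_Integration.integral_add integrable_mult_cis gint \<Phi> \<Psi>) simp_all
      finally show ?thesis .
    qed
    then show "delta_kernel (a_dist \<sigma>) (\<lambda>x. \<Phi> x + \<Psi> x) = delta_kernel (a_dist \<sigma>) \<Phi> + delta_kernel (a_dist \<sigma>) \<Psi>"
      using int[OF \<Phi>] int[OF \<Psi>] by (simp add: eq \<Phi> \<Psi> schwartz_add distrib_left)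
  next
    fix c and \<Phi> :: "('a \<times> 'a) \<times> ('a \<times> 'a) \<Rightarrow> complex" assume \<Phi>: "schwartz \<Phi>"
    have "Q (\<lambda>x. c * \<Phi> x) p = c * Q \<Phi> p" for p
      by (simp add: Q_def g_def[abs_def] inv_fourier_cmult)
    then show "delta_kernel (a_dist \<sigma>) (\<lambda>x. c * \<Phi> x) = c * delta_kernel (a_dist \<sigma>) \<Phi>"
      by (simp add: eq \<Phi> schwartz_cmult mult.left_commute)
  next
    fix \<Phi> :: "('a \<times> 'a) \<times> ('a \<times> 'a) \<Rightarrow> complex" assume \<Phi>: "schwartz \<Phi>"
    let ?S = "schwartz_norm ?N \<Phi>"
    have "norm (delta_kernel (a_dist \<sigma>) \<Phi>) \<le> (LBINT p. norm (?b p * Q \<Phi> p))"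
      unfolding eq[OF \<Phi>] by (rule integral_norm_bound)
    also have "\<dots> \<le> (LBINT p. (decay (fst p :: 'a) * decay (snd p :: 'a)) * (B * B * (K * J) * ?S))"
    proof (rule integral_mono)
      fix p
      have "norm (?b p * Q \<Phi> p) \<le> (B * B) * (?S * (K * J) * (decay (fst p) * decay (snd p)))"
        unfolding norm_mult by (intro mult_mono norm_b_symbol_le B Qb \<Phi>) auto
      then show "norm (?b p * Q \<Phi> p) \<le> (decay (fst p) * decay (snd p)) * (B * B * (K * J) * ?S)"
        by (simp only: mult_ac)
    qed (intro integrable_norm int \<Phi> integrable_mult_left lborel_integrable_prod_mult integrable_decay)+
    also have "\<dots> = (LBINT p. decay (fst p :: 'a) * decay (snd p :: 'a)) * (B * B * (K * J)) * ?S"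
      unfolding integral_mult_left_zero by (simp only: mult_ac)
    finally show "norm (delta_kernel (a_dist \<sigma>) \<Phi>) \<le> (LBINT p. decay (fst p :: 'a) * decay (snd p :: 'a)) * (B * B * (K * J)) * ?S" .
  qed
qed

section \<open>The Wigner kernel identity\<close>

lemma cnj_inv_fourier: "cnj (inv_fourier (\<lambda>t. cnj (h t)) \<eta>) = inv_fourier h (- \<eta>)"
  unfolding inv_fourier_def Bochner_Integration.integral_cnj[symmetric] by (simp only: complex_cnj_mult complex_cnj_cnj cis_cnj inner_minus_left mult_minus_right)

text \<open>In the coordinates \<open>s = y + p/2\<close>, \<open>t = y - p/2\<close> the phase
  \<open>p \<bullet> \<xi> + y \<bullet> r\<close> equals
  \<open>s \<bullet> (\<xi> + r/2) - t \<bullet> (\<xi> - r/2)\<close>, so the double integral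
  becomes a product of two Fourier integrals.\<close>

lemma
  fixes f g :: "'a::euclidean_space \<Rightarrow> complex"
  assumes f: "schwartz f" and g: "schwartz g"
  shows integrable_wigner: "integrable lborel (\<lambda>y. wigner f g (y, \<xi>))"
    and fourier_wigner: "fourier (\<lambda>y. wigner f g (y, \<xi>)) r
      = fourier f (\<xi> + r /\<^sub>R 2) * cnj (fourier g (\<xi> - r /\<^sub>R 2))"
proof -
  let ?u = "\<lambda>r s. f s * cis (- 2 * pi * (s \<bullet> (\<xi> + r /\<^sub>R 2)))"
  let ?v = "\<lambda>r t. cnj (g t * cis (- 2 * pi * (t \<bullet> (\<xi> - r /\<^sub>R 2))))"
  let ?F = "\<lambda>r z. ?u r (fst z) * ?v r (snd z)"
  have u: "integrable lborel (?u r)" for r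
    by (rule integrable_mult_cis[OF schwartz_integrable[OF f]]) simp
  have v: "integrable lborel (?v r)" for r
    by (rule integrable_cnj[OF integrable_mult_cis[OF schwartz_integrable[OF g]]]) simp
  have F: "integrable lborel (?F r)" for r
    by (rule lborel_integrable_prod_mult[OF u v])
  then have Fm: "?F r \<in> borel_measurable borel" for r by auto
  have W: "?F r (y + p /\<^sub>R 2, y - p /\<^sub>R 2)
      = f (y + p /\<^sub>R 2) * cnj (g (y - p /\<^sub>R 2)) * cis (- 2 * pi * (p \<bullet> \<xi>)) * cis (- 2 * pi * (y \<bullet> r))" for r y p
  proof -
    have "cis (- 2 * pi * ((y + p /\<^sub>R 2) \<bullet> (\<xi> + r /\<^sub>R 2))) * cnj (cis (- 2 * pi * ((y - p /\<^sub>R 2) \<bullet> (\<xi> - r /\<^sub>R 2))))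
      = cis (- 2 * pi * (p \<bullet> \<xi>)) * cis (- 2 * pi * (y \<bullet> r))"
      unfolding cis_cnj cis_mult by (rule arg_cong[of _ _ cis]) (simp add: inner_simps field_simps)
    then show ?thesis by (simp add: mult.assoc mult.left_commute)
  qed
  have G: "integrable lborel (\<lambda>(y, p). ?F r (y + p /\<^sub>R 2, y - p /\<^sub>R 2))" for r
    using F[of r] lborel_integrable_wigner_map[OF Fm] by blast
  \<comment> \<open>At \<open>r = 0\<close> the additional character is 1 and the inner integral is
    the Wigner distribution itself.\<close>
  from lborel_integrable_fst[OF G[of 0]] show "integrable lborel (\<lambda>y. wigner f g (y, \<xi>))"
    unfolding case_prod_conv W by (simp add: wigner_def)
  have "fourier (\<lambda>y. wigner f g (y, \<xi>)) r
      = (LBINT y. LBINT p. (case (y, p) of (y, p) \<Rightarrow> ?F r (y + p /\<^sub>R 2, y - p /\<^sub>R 2)))"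
    unfolding case_prod_conv W by (simp add: fourier_def wigner_def)
  also have "\<dots> = (LBINT z. ?F r z)"
    unfolding lborel_integral_fst[OF G] by (rule lborel_integral_wigner_map[OF Fm])
  also have "\<dots> = (LBINT s. LBINT t. ?F r (s, t))"
    by (rule lborel_integral_fst[OF F, symmetric])
  also have "\<dots> = fourier f (\<xi> + r /\<^sub>R 2) * cnj (fourier g (\<xi> - r /\<^sub>R 2))"
    by (simp only: fst_conv snd_conv integral_mult_right_zero integral_mult_left_zero Bochner_Integration.integral_cnj fourier_def)
  finally show "fourier (\<lambda>y. wigner f g (y, \<xi>)) r = fourier f (\<xi> + r /\<^sub>R 2) * cnj (fourier g (\<xi> - r /\<^sub>R 2))" .
qed

lemma schwartz_Pair_section:
  fixes \<Phi> :: "'a::euclidean_space \<times> 'b::euclidean_space \<Rightarrow> complex"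
  assumes "schwartz \<Phi>"
  shows "schwartz (\<lambda>x. \<Phi> (x, y))" "schwartz (\<lambda>y. \<Phi> (x, y))"
proof -
  have "linear (\<lambda>x :: 'a. (x, 0 :: 'b))" "linear (\<lambda>y :: 'b. (0 :: 'a, y))"
    by (auto intro!: linearI)
  then show "schwartz (\<lambda>x. \<Phi> (x, y))" "schwartz (\<lambda>y. \<Phi> (x, y))"
    using schwartz_affine[OF assms, of "\<lambda>x. (x, 0)" "(0, y)"] schwartz_affine[OF assms, of "\<lambda>y. (0, y)" "(x, 0)"]
    by (auto simp: mem_Basis_prod)
qed

text \<open>For a tensor product the diagonal formula factors: \<open>\<Phi>\<close> contributes its
  inverse transform in \<open>x\<close>, and \<open>wigner f g\<close> its Fourier transform in
  \<open>y\<close>, which \<open>fourier_wigner\<close> evaluates.\<close>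

lemma delta_kernel_wigner:
  fixes f g :: "'a::euclidean_space \<Rightarrow> complex"
  assumes f: "schwartz f" and g: "schwartz g" and \<Phi>: "schwartz \<Phi>"
  shows "delta_kernel (a_dist \<sigma>) (\<lambda>(z, w). \<Phi> z * wigner f g w)
    = (LBINT \<xi>. LBINT r. b_symbol \<sigma> \<xi> r * (inv_fourier (\<lambda>x. \<Phi> (x, \<xi>)) r *
        (fourier f (\<xi> + r /\<^sub>R 2) * cnj (fourier g (\<xi> - r /\<^sub>R 2)))))"
proof -
  have "inv_fourier (\<lambda>s. LBINT y. \<Phi> (y + s, \<xi>) * wigner f g (y, \<xi>)) r
     = inv_fourier (\<lambda>x. \<Phi> (x, \<xi>)) r * (fourier f (\<xi> + r /\<^sub>R 2) * cnj (fourier g (\<xi> - r /\<^sub>R 2)))" for \<xi> r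
  proof -
    let ?G = "\<lambda>z. \<Phi> (fst z, \<xi>) * wigner f g (snd z, \<xi>)"
    have "integrable lborel ?G"
      by (rule lborel_integrable_prod_mult[OF schwartz_integrable[OF schwartz_Pair_section(1)[OF \<Phi>]] integrable_wigner[OF f g]])
    from inv_fourier_diagonal[OF this, of r]
    have "inv_fourier (\<lambda>s. LBINT y. \<Phi> (y + s, \<xi>) * wigner f g (y, \<xi>)) r
       = (LBINT y. cis (- 2 * pi * (y \<bullet> r)) * inv_fourier (\<lambda>x. wigner f g (y, \<xi>) * \<Phi> (x, \<xi>)) r)"
      by (simp add: mult.commute)
    also have "\<dots> = (LBINT y. inv_fourier (\<lambda>x. \<Phi> (x, \<xi>)) r * (wigner f g (y, \<xi>) * cis (- 2 * pi * (y \<bullet> r))))"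
      unfolding inv_fourier_cmult by (simp only: mult_ac)
    also have "\<dots> = inv_fourier (\<lambda>x. \<Phi> (x, \<xi>)) r * fourier (\<lambda>y. wigner f g (y, \<xi>)) r"
      by (simp only: integral_mult_right_zero fourier_def)
    finally show ?thesis by (simp only: fourier_wigner[OF f g])
  qed
  then show ?thesis
    by (simp add: delta_kernel_def a_dist_def inv_fourier_dist_def reg_dist_def)
qed

text \<open>Both multipliers act on the Fourier side, so the pairing is the integral of
  \<open>P \<zeta> * R \<eta>\<close> against the transform \<open>M\<close> of the transported test
  function. Centre and difference coordinates for \<open>(\<zeta>, \<eta>)\<close> then turn the two
  values of \<open>\<sigma>\<close> into \<open>b_symbol\<close>.\<close>

lemma wigner_dist_fourier_multiplier:
  fixes f g \<sigma> :: "'a::euclidean_space \<Rightarrow> complex"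
  assumes f: "schwartz f" and g: "schwartz g" and \<Phi>: "schwartz \<Phi>"
    and \<sigma>: "\<sigma> \<in> borel_measurable borel" and B: "\<And>x. norm (\<sigma> x) \<le> B"
  shows "wigner_dist (fourier_multiplier \<sigma> f) (fourier_multiplier \<sigma> g) \<Phi>
    = (LBINT \<xi>. LBINT r. b_symbol \<sigma> \<xi> r * (inv_fourier (\<lambda>x. \<Phi> (x, \<xi>)) r *
        (fourier f (\<xi> + r /\<^sub>R 2) * cnj (fourier g (\<xi> - r /\<^sub>R 2)))))"
proof -
  define P where "P \<zeta> = \<sigma> \<zeta> * fourier f \<zeta>" for \<zeta>
  define R where "R \<eta> = cnj (\<sigma> \<eta> * fourier g \<eta>)" for \<eta>
  have mult_int: "integrable lborel (\<lambda>\<zeta>. \<sigma> \<zeta> * fourier h \<zeta>)" if "schwartz h" for h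
  proof (rule Bochner_Integration.integrable_bound)
    show "integrable lborel (\<lambda>\<zeta>. B * norm (fourier h \<zeta>))"
      by (intro integrable_mult_right integrable_norm schwartz_fourier_integrable that)
    show "(\<lambda>\<zeta>. \<sigma> \<zeta> * fourier h \<zeta>) \<in> borel_measurable lborel"
      using \<sigma> borel_measurable_fourier[OF borel_measurable_schwartz[OF that]] by simp
    have "0 \<le> B" using norm_ge_zero order_trans B by blast
    then show "AE \<zeta> in lborel. norm (\<sigma> \<zeta> * fourier h \<zeta>) \<le> norm (B * norm (fourier h \<zeta>))"
      by (auto simp: norm_mult intro!: AE_I2 mult_right_mono B)
  qed
  have P: "integrable lborel P" using mult_int[OF f] by (simp add: P_def[abs_def])
  have R: "integrable lborel R" using mult_int[OF g] by (simp add: R_def[abs_def] del: complex_cnj_mult)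
  have Pm: "P \<in> borel_measurable borel" and Rm: "R \<in> borel_measurable borel" using P R by auto
  have \<Phi>c: "continuous_on S \<Phi>" for S by (intro smooth_continuous_on schwartz_smooth \<Phi>)
  \<comment> \<open>\<open>\<Theta>\<close> is \<open>\<Psi>\<close> in centre and difference
    coordinates. There it is a partial Fourier transform of \<open>\<Phi>\<close>, to which the
    slice bound applies; the measure preserving map carries integrability back to
    \<open>\<Psi>\<close>.\<close>
  define \<Theta> where "\<Theta> z = fourier (\<lambda>\<xi>. \<Phi> (fst z, \<xi>)) (snd z)" for z :: "'a \<times> 'a"
  define \<Psi> where "\<Psi> z = (LBINT \<xi>. \<Phi> ((fst z + snd z) /\<^sub>R 2, \<xi>) * cis (- 2 * pi * ((fst z - snd z) \<bullet> \<xi>)))" for z :: "'a \<times> 'a"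
  have \<Theta>m: "\<Theta> \<in> borel_measurable borel"
  proof -
    have "(\<lambda>w :: ('a \<times> 'a) \<times> 'a. \<Phi> (fst (fst w), snd w) * cis (- 2 * pi * (snd w \<bullet> snd (fst w)))) \<in> borel_measurable borel"
      by (intro borel_measurable_continuous_onI continuous_intros continuous_on_compose2[OF \<Phi>c] continuous_on_cis) auto
    from borel_measurable_LINT[OF this] show ?thesis by (simp add: \<Theta>_def[abs_def] fourier_def)
  qed
  have \<Psi>m: "\<Psi> \<in> borel_measurable borel"
  proof -
    have "(\<lambda>w :: ('a \<times> 'a) \<times> 'a. \<Phi> ((fst (fst w) + snd (fst w)) /\<^sub>R 2, snd w) *
        cis (- 2 * pi * ((fst (fst w) - snd (fst w)) \<bullet> snd w))) \<in> borel_measurable borel"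
      by (intro borel_measurable_continuous_onI continuous_intros continuous_on_compose2[OF \<Phi>c] continuous_on_cis) auto
    from borel_measurable_LINT[OF this] show ?thesis by (simp add: \<Psi>_def[abs_def])
  qed
  obtain K where K: "K > 0" "\<And>(A :: 'a \<Rightarrow> 'a \<times> 'a) c q f r.
      schwartz f \<Longrightarrow> linear A \<Longrightarrow> (\<And>b. b \<in> Basis \<Longrightarrow> A b \<in> Basis) \<Longrightarrow> (\<And>x. norm x \<le> norm (A x)) \<Longrightarrow>
      DIM('a) \<le> DIM('a \<times> 'a) \<Longrightarrow> (\<And>x. decay (A x + c) \<le> decay x * q) \<Longrightarrow>
      norm (inv_fourier (\<lambda>x. f (A x + c)) r) \<le> K * schwartz_norm (2 * DIM('a \<times> 'a)) f * decay r * q"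
    using inv_fourier_slice_bound[where 'a='a and 'b="'a \<times> 'a"] by blast
  have \<Theta>: "integrable lborel \<Theta>"
  proof (rule lborel_integrable_prod_bound[OF \<Theta>m])
    show "norm (\<Theta> (u, v)) \<le> decay u * (K * schwartz_norm (2 * DIM('a \<times> 'a)) \<Phi> * decay v)" for u v
    proof -
      have "norm (inv_fourier (\<lambda>\<xi>. \<Phi> ((\<lambda>\<xi>. (0, \<xi>)) \<xi> + (u, 0))) (- v)) \<le> K * schwartz_norm (2 * DIM('a \<times> 'a)) \<Phi> * decay (- v) * decay u"
        by (rule K(2)[OF \<Phi>]) (auto intro!: linearI order_trans[OF decay_Pair] simp: mem_Basis_prod mult.commute)
      then show ?thesis by (simp add: \<Theta>_def fourier_eq_inv_fourier decay_def mult_ac)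
    qed
  qed (auto intro!: integrable_decay integrable_mult_right)
  have \<Psi>\<Theta>: "\<Psi> (u + v /\<^sub>R 2, u - v /\<^sub>R 2) = \<Theta> (u, v)" for u v
  proof -
    have "(u + v /\<^sub>R 2 + (u - v /\<^sub>R 2)) /\<^sub>R 2 = u" "u + v /\<^sub>R 2 - (u - v /\<^sub>R 2) = v"
      by (simp_all flip: scaleR_2 scaleR_add_left)
    then show ?thesis unfolding \<Psi>_def \<Theta>_def fourier_def by (simp only: fst_conv snd_conv inner_commute)
  qed
  have \<Psi>: "integrable lborel \<Psi>"
    using \<Theta> lborel_integrable_wigner_map[OF \<Psi>m] by (simp only: \<Psi>\<Theta> case_prod_eta)
  define M where "M z = inv_fourier (\<lambda>u. \<Phi> (u, (fst z + snd z) /\<^sub>R 2)) (fst z - snd z)" for z :: "'a \<times> 'a"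
  \<comment> \<open>The mean frequency \<open>(\<zeta> + \<eta>)/2\<close> is dual to the difference
    variable, where Fourier inversion removes the transform already contained in
    \<open>\<Theta>\<close>. The difference \<open>\<zeta> - \<eta>\<close> is dual to the centre
    and leaves an inverse transform in the first variable of \<open>\<Phi>\<close>.\<close>
  have \<Psi>M: "inv_fourier (\<lambda>s. inv_fourier (\<lambda>t. \<Psi> (s, t)) (- \<eta>)) \<zeta> = M (\<zeta>, \<eta>)" for \<zeta> \<eta>
  proof -
    let ?G = "\<lambda>z. \<Psi> z * cis (2 * pi * (\<zeta> \<bullet> fst z - \<eta> \<bullet> snd z))"
    have G: "integrable lborel ?G" by (rule integrable_mult_cis[OF \<Psi>]) simp
    then have Gm: "?G \<in> borel_measurable borel" by auto
    have e: "cis (2 * pi * (\<zeta> \<bullet> s - \<eta> \<bullet> t)) = cis (2 * pi * (- \<eta> \<bullet> t)) * cis (2 * pi * (\<zeta> \<bullet> s))" for s t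
      unfolding cis_mult by (rule arg_cong[of _ _ cis]) (simp add: algebra_simps)
    have "inv_fourier (\<lambda>s. inv_fourier (\<lambda>t. \<Psi> (s, t)) (- \<eta>)) \<zeta> = (LBINT s. LBINT t. ?G (s, t))"
      unfolding fst_conv snd_conv e mult.assoc[symmetric] integral_mult_left_zero inv_fourier_def ..
    also have "\<dots> = (LBINT z. ?G z)"
      by (rule lborel_integral_fst[OF G])
    also have "\<dots> = (LBINT z. (case z of (u, v) \<Rightarrow> ?G (u + v /\<^sub>R 2, u - v /\<^sub>R 2)))"
      by (rule lborel_integral_wigner_map[OF Gm, symmetric])
    also have "\<dots> = (LBINT u. LBINT v. (case (u, v) of (u, v) \<Rightarrow> ?G (u + v /\<^sub>R 2, u - v /\<^sub>R 2)))"
      by (rule lborel_integral_fst[symmetric]) (use G lborel_integrable_wigner_map[OF Gm] in blast)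
    also have "\<dots> = (LBINT u. inv_fourier (fourier (\<lambda>\<xi>. \<Phi> (u, \<xi>))) ((\<zeta> + \<eta>) /\<^sub>R 2) * cis (2 * pi * ((\<zeta> - \<eta>) \<bullet> u)))"
    proof (rule Bochner_Integration.integral_cong[OF refl])
      fix u
      have "cis (2 * pi * (\<zeta> \<bullet> (u + v /\<^sub>R 2) - \<eta> \<bullet> (u - v /\<^sub>R 2)))
          = cis (2 * pi * (((\<zeta> + \<eta>) /\<^sub>R 2) \<bullet> v)) * cis (2 * pi * ((\<zeta> - \<eta>) \<bullet> u))" for v
        unfolding cis_mult by (rule arg_cong[of _ _ cis]) (simp add: inner_simps field_simps)
      then show "(LBINT v. (case (u, v) of (u, v) \<Rightarrow> ?G (u + v /\<^sub>R 2, u - v /\<^sub>R 2)))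
        = inv_fourier (fourier (\<lambda>\<xi>. \<Phi> (u, \<xi>))) ((\<zeta> + \<eta>) /\<^sub>R 2) * cis (2 * pi * ((\<zeta> - \<eta>) \<bullet> u))"
        unfolding case_prod_conv fst_conv snd_conv \<Psi>\<Theta>
        by (simp only: mult.assoc[symmetric] integral_mult_left_zero inv_fourier_def \<Theta>_def fst_conv snd_conv)
    qed
    also have "\<dots> = M (\<zeta>, \<eta>)"
      by (simp only: fourier_inversion[OF schwartz_Pair_section(2)[OF \<Phi>]] M_def fst_conv snd_conv inv_fourier_def[of "\<lambda>u. \<Phi> (u, _)"])
    finally show ?thesis .
  qed
  have Mm: "M \<in> borel_measurable borel"
  proof -
    have "(\<lambda>w :: ('a \<times> 'a) \<times> 'a. \<Phi> (snd w, (fst (fst w) + snd (fst w)) /\<^sub>R 2) *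
        cis (2 * pi * ((fst (fst w) - snd (fst w)) \<bullet> snd w))) \<in> borel_measurable borel"
      by (intro borel_measurable_continuous_onI continuous_intros continuous_on_compose2[OF \<Phi>c] continuous_on_cis) auto
    from borel_measurable_LINT[OF this] show ?thesis by (simp add: M_def[abs_def] inv_fourier_def)
  qed
  \<comment> \<open>The L1 norm of \<open>\<Psi>\<close> bounds \<open>M\<close> uniformly, so
    \<open>P \<zeta> * R \<eta> * M (\<zeta>, \<eta>)\<close> is integrable because \<open>P\<close>
    and \<open>R\<close> are.\<close>
  define I where "I = (LBINT s. LBINT t. norm (\<Psi> (s, t)))"
  have n\<Psi>: "integrable lborel (\<lambda>s. LBINT t. norm (\<Psi> (s, t)))"
    using lborel_integrable_fst[OF integrable_norm[OF \<Psi>]] by simp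
  have Mb: "norm (M z) \<le> I" for z
  proof -
    obtain \<zeta> \<eta> where z: "z = (\<zeta>, \<eta>)" by force
    have "norm (M z) \<le> (LBINT s. norm (inv_fourier (\<lambda>t. \<Psi> (s, t)) (- \<eta>)))"
      unfolding z \<Psi>M[symmetric] by (rule norm_inv_fourier_le)
    also have "\<dots> \<le> I"
      unfolding I_def by (rule integral_mono'[OF n\<Psi>]) (simp_all add: norm_inv_fourier_le)
    finally show ?thesis .
  qed
  \<comment> \<open>Conjugation in \<open>dist_cnj\<close> flips the sign of the frequency
    \<open>\<eta>\<close>; Fubini then moves the transform in \<open>s\<close> inside, where it
    completes \<open>M\<close>.\<close>
  have inner: "inv_fourier (\<lambda>s. dist_cnj (fourier_multiplier \<sigma> g) (\<lambda>t. \<Psi> (s, t))) \<zeta>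
      = (LBINT \<eta>. R \<eta> * M (\<zeta>, \<eta>))" for \<zeta>
  proof -
    let ?H = "\<lambda>z. R (snd z) * inv_fourier (\<lambda>t. \<Psi> (fst z, t)) (- snd z) * cis (2 * pi * (\<zeta> \<bullet> fst z))"
    have H: "integrable lborel ?H"
    proof (rule lborel_integrable_prod_bound[OF _ n\<Psi> integrable_norm[OF R]])
      have "(\<lambda>w :: ('a \<times> 'a) \<times> 'a. \<Psi> (fst (fst w), snd w) * cis (2 * pi * (- snd (fst w) \<bullet> snd w))) \<in> borel_measurable borel"
        by (intro borel_measurable_times borel_measurable_compose_continuous[OF \<Psi>m]
            borel_measurable_continuous_onI[of "\<lambda>w. cis (c w)" for c] continuous_on_cis continuous_intros)
      from borel_measurable_LINT[OF this]
      have "(\<lambda>z :: 'a \<times> 'a. inv_fourier (\<lambda>t. \<Psi> (fst z, t)) (- snd z)) \<in> borel_measurable borel"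
        by (simp add: inv_fourier_def)
      then show "?H \<in> borel_measurable borel"
        by (intro borel_measurable_times borel_measurable_compose_continuous[OF Rm]
            borel_measurable_continuous_onI[of "\<lambda>w. cis (c w)" for c] continuous_on_cis continuous_intros)
      show "norm (?H (s, t)) \<le> (LBINT t. norm (\<Psi> (s, t))) * norm (R t)" for s t
        using norm_inv_fourier_le[of "\<lambda>t. \<Psi> (s, t)" "- t"]
        by (simp add: norm_mult mult.commute mult_left_mono)
    qed
    have "inv_fourier (\<lambda>s. dist_cnj (fourier_multiplier \<sigma> g) (\<lambda>t. \<Psi> (s, t))) \<zeta>
        = (LBINT s. LBINT \<eta>. ?H (s, \<eta>))"
      unfolding dist_cnj_def fourier_multiplier_def inv_fourier_dist_def reg_dist_def Bochner_Integration.integral_cnj[symmetric]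
        complex_cnj_mult[of "_ * _" "inv_fourier _ _"] cnj_inv_fourier R_def[symmetric]
      by (simp only: inv_fourier_def[of _ \<zeta>] integral_mult_left_zero fst_conv snd_conv)
    also have "\<dots> = (LBINT \<eta>. LBINT s. ?H (s, \<eta>))"
      by (rule lborel_Fubini[OF H])
    also have "\<dots> = (LBINT \<eta>. R \<eta> * M (\<zeta>, \<eta>))"
      by (simp only: fst_conv snd_conv \<Psi>M[symmetric] mult.assoc integral_mult_right_zero inv_fourier_def[of _ \<zeta>])
    finally show ?thesis .
  qed
  let ?L = "\<lambda>z. P (fst z) * R (snd z) * M z"
  have L: "integrable lborel ?L"
  proof (rule lborel_integrable_prod_bound[OF _ integrable_norm[OF P] integrable_mult_right[OF integrable_norm[OF R], of I]])
    show "?L \<in> borel_measurable borel"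
      by (intro borel_measurable_times borel_measurable_compose_continuous[OF Pm]
          borel_measurable_compose_continuous[OF Rm] Mm continuous_intros)
    show "norm (?L (x, y)) \<le> norm (P x) * (I * norm (R y))" for x y
      using mult_left_mono[OF Mb[of "(x, y)"], of "norm (P x) * norm (R y)"]
      by (simp add: norm_mult mult_ac)
  qed
  then have Lm: "?L \<in> borel_measurable borel" by auto
  have "wigner_dist (fourier_multiplier \<sigma> f) (fourier_multiplier \<sigma> g) \<Phi>
      = (LBINT \<zeta>. P \<zeta> * (LBINT \<eta>. R \<eta> * M (\<zeta>, \<eta>)))"
    unfolding wigner_dist_def dist_tensor_def inner[symmetric] \<Psi>_def P_def fourier_multiplier_def[of _ f]
      inv_fourier_dist_def[of "reg_dist _"] reg_dist_def[of "\<lambda>\<xi>. \<sigma> \<xi> * fourier f \<xi>"] case_prod_conv fst_conv snd_conv ..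
  also have "\<dots> = (LBINT \<zeta>. LBINT \<eta>. ?L (\<zeta>, \<eta>))"
    by (simp only: fst_conv snd_conv mult.assoc integral_mult_right_zero)
  also have "\<dots> = (LBINT z. ?L z)"
    by (rule lborel_integral_fst[OF L])
  also have "\<dots> = (LBINT z. (case z of (\<xi>, r) \<Rightarrow> ?L (\<xi> + r /\<^sub>R 2, \<xi> - r /\<^sub>R 2)))"
    by (rule lborel_integral_wigner_map[OF Lm, symmetric])
  also have "\<dots> = (LBINT \<xi>. LBINT r. (case (\<xi>, r) of (\<xi>, r) \<Rightarrow> ?L (\<xi> + r /\<^sub>R 2, \<xi> - r /\<^sub>R 2)))"
    by (rule lborel_integral_fst[symmetric]) (use L lborel_integrable_wigner_map[OF Lm] in blast)
  also have "\<dots> = (LBINT \<xi>. LBINT r. b_symbol \<sigma> \<xi> r * (inv_fourier (\<lambda>x. \<Phi> (x, \<xi>)) r *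
        (fourier f (\<xi> + r /\<^sub>R 2) * cnj (fourier g (\<xi> - r /\<^sub>R 2)))))"
  proof -
    have "?L (\<xi> + r /\<^sub>R 2, \<xi> - r /\<^sub>R 2) = b_symbol \<sigma> \<xi> r * (inv_fourier (\<lambda>x. \<Phi> (x, \<xi>)) r *
        (fourier f (\<xi> + r /\<^sub>R 2) * cnj (fourier g (\<xi> - r /\<^sub>R 2))))" for \<xi> r
    proof -
      have "(\<xi> + r /\<^sub>R 2 + (\<xi> - r /\<^sub>R 2)) /\<^sub>R 2 = \<xi>" "\<xi> + r /\<^sub>R 2 - (\<xi> - r /\<^sub>R 2) = r"
        by (simp_all flip: scaleR_2 scaleR_add_left)
      then show ?thesis
        by (simp only: M_def P_def R_def b_symbol_def fst_conv snd_conv complex_cnj_mult mult_ac)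
    qed
    then show ?thesis by (simp only: case_prod_conv)
  qed
  finally show ?thesis .
qed

lemma wigner_kernel_identity_delta_kernel:
  fixes \<sigma> :: "'a::euclidean_space \<Rightarrow> complex"
  assumes "\<sigma> \<in> borel_measurable borel" "\<And>x. norm (\<sigma> x) \<le> B"
  shows "wigner_kernel_identity (fourier_multiplier \<sigma>) (delta_kernel (a_dist \<sigma>))"
  unfolding wigner_kernel_identity_def
  by (simp add: wigner_dist_fourier_multiplier[OF _ _ _ assms] delta_kernel_wigner)

section \<open>Superpositions and tempered distributions\<close>

lemma
  assumes u: "tempered_distribution u"
  shows tempered_add: "schwartz f \<Longrightarrow> schwartz g \<Longrightarrow> u (\<lambda>x. f x + g x) = u f + u g"
    and tempered_cmult: "schwartz f \<Longrightarrow> u (\<lambda>x. c * f x) = c * u f"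
  using u by (simp_all add: tempered_distribution_def)

lemma tempered_diff:
  assumes "tempered_distribution u" "schwartz f" "schwartz g"
  shows "u (\<lambda>x. f x - g x) = u f - u g"
  using tempered_add[OF assms(1,2) schwartz_cmult[OF assms(3), of "-1"]] tempered_cmult[OF assms(1,3), of "-1"]
  by simp

lemma tempered_sum_eq_0:
  assumes "tempered_distribution u" "finite I" "\<And>i. i \<in> I \<Longrightarrow> schwartz (f i)" "\<And>i. i \<in> I \<Longrightarrow> u (f i) = 0"
  shows "u (\<lambda>x. \<Sum>i\<in>I. c i * f i x) = 0"
  using assms(2-)
proof (induction rule: finite_induct)
  case empty
  then show ?case using tempered_cmult[OF assms(1) schwartz_zero, of 0] by simp
next
  case (insert i I)
  then show ?case
    using tempered_add[OF assms(1), of "\<lambda>x. c i * f i x" "\<lambda>x. \<Sum>i\<in>I. c i * f i x"]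
    by (auto simp: schwartz_cmult schwartz_sum tempered_cmult[OF assms(1)])
qed

lemma tempered_distribution_diff:
  fixes u v :: "('a::euclidean_space \<Rightarrow> complex) \<Rightarrow> complex"
  assumes u: "tempered_distribution u" and v: "tempered_distribution v"
  shows "tempered_distribution (\<lambda>\<phi>. u \<phi> - v \<phi>)"
proof -
  obtain A M where A: "\<And>\<phi>. schwartz \<phi> \<Longrightarrow> norm (u \<phi>) \<le> A * schwartz_norm M \<phi>"
    using u unfolding tempered_distribution_def by blast
  obtain B N where B: "\<And>\<phi>. schwartz \<phi> \<Longrightarrow> norm (v \<phi>) \<le> B * schwartz_norm N \<phi>"
    using v unfolding tempered_distribution_def by blast
  have "norm (u \<phi> - v \<phi>) \<le> (\<bar>A\<bar> + \<bar>B\<bar>) * schwartz_norm (max M N) \<phi>" if \<phi>: "schwartz \<phi>" for \<phi>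
  proof -
    have "norm (u \<phi>) \<le> \<bar>A\<bar> * schwartz_norm (max M N) \<phi>"
      by (rule order_trans[OF A[OF \<phi>]]) (intro mult_mono schwartz_norm_mono schwartz_norm_nonneg \<phi>; simp)
    moreover have "norm (v \<phi>) \<le> \<bar>B\<bar> * schwartz_norm (max M N) \<phi>"
      by (rule order_trans[OF B[OF \<phi>]]) (intro mult_mono schwartz_norm_mono schwartz_norm_nonneg \<phi>; simp)
    ultimately show ?thesis
      using norm_triangle_ineq4[of "u \<phi>" "v \<phi>"] by (simp add: distrib_right)
  qed
  then have "\<exists>A N. \<forall>\<phi>. schwartz \<phi> \<longrightarrow> norm (u \<phi> - v \<phi>) \<le> A * schwartz_norm N \<phi>"
    by blast
  then show ?thesis
    unfolding tempered_distribution_def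
    by (simp add: tempered_add[OF u] tempered_add[OF v] tempered_cmult[OF u] tempered_cmult[OF v] right_diff_distrib)
qed

text \<open>A superposition is approximated in the Schwartz seminorms by the Riemann sums that belong to
  simple functions approximating the identity of the parameter space.\<close>

lemma tempered_superposition_eq_0:
  fixes F :: "'p::euclidean_space \<Rightarrow> 'a::euclidean_space \<Rightarrow> complex"
  assumes u: "tempered_distribution u"
    and F: "\<And>p. schwartz (F p)" "\<And>p. u (F p) = 0" and \<Phi>: "schwartz \<Phi>"
    and rep: "\<And>bs x. set bs \<subseteq> Basis \<Longrightarrow>
      has_bochner_integral lborel (\<lambda>p. c p * iter_partial bs (F p) x) (iter_partial bs \<Phi> x)"
    and c: "c \<in> borel_measurable borel"
    and lip: "\<And>bs N. set bs \<subseteq> Basis \<Longrightarrow> \<exists>K M. integrable lborel (\<lambda>p. (1 + norm p) ^ Suc M * norm (c p)) \<and>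
      (\<forall>p q x. (1 + norm x) ^ N * norm (iter_partial bs (F p) x - iter_partial bs (F q) x)
        \<le> K * (1 + norm p + norm q) ^ M * norm (p - q))"
  shows "u \<Phi> = 0"
proof -
  obtain A N where A: "\<And>\<phi>. schwartz \<phi> \<Longrightarrow> norm (u \<phi>) \<le> A * schwartz_norm N \<phi>"
    using u unfolding tempered_distribution_def by blast
  \<comment> \<open>Continuity of \<open>u\<close> involves a single seminorm, hence finitely many
    lists of derivatives, and one index \<open>i\<close> can serve them all.\<close>
  let ?L = "{bs. set bs \<subseteq> (Basis :: 'a set) \<and> length bs \<le> N}"
  have finL: "finite ?L" by (rule finite_lists_length_le) simp
  define good where "good bs K M \<longleftrightarrow> integrable lborel (\<lambda>p. (1 + norm p) ^ Suc M * norm (c p)) \<and>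
      (\<forall>p q x. (1 + norm x) ^ N * norm (iter_partial bs (F p) x - iter_partial bs (F q) x)
        \<le> K * (1 + norm p + norm q) ^ M * norm (p - q))" for bs K M
  have "\<forall>bs\<in>?L. \<exists>K M. good bs K M"
    unfolding good_def using lip by blast
  then obtain K M where good: "\<And>bs. bs \<in> ?L \<Longrightarrow> good bs (K bs) (M bs)"
    by metis
  have KM: "\<And>bs. bs \<in> ?L \<Longrightarrow> integrable lborel (\<lambda>p. (1 + norm p) ^ Suc (M bs) * norm (c p))"
    "\<And>bs p q x. bs \<in> ?L \<Longrightarrow> (1 + norm x) ^ N * norm (iter_partial bs (F p) x - iter_partial bs (F q) x)
        \<le> K bs * (1 + norm p + norm q) ^ M bs * norm (p - q)"
    using good unfolding good_def by blast+
  have one: "1 \<le> (1 + norm p) ^ n" for p :: 'p and n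
    by (rule one_le_power) simp
  have cint: "integrable lborel c"
  proof (rule Bochner_Integration.integrable_bound[OF KM(1)[of "[]"]])
    show "AE p in lborel. norm (c p) \<le> norm ((1 + norm p) ^ Suc (M []) * norm (c p))"
    proof (rule AE_I2)
      fix p
      show "norm (c p) \<le> norm ((1 + norm p) ^ Suc (M []) * norm (c p))"
        using mult_right_mono[OF one[of p "Suc (M [])"], of "norm (c p)"] by (simp add: abs_mult)
    qed
  qed (use c in auto)
  \<comment> \<open>The nodes of the Riemann sums. The bound by \<open>2 * norm p\<close> keeps the
    polynomial growth of the Lipschitz constants at \<open>q i p\<close> comparable to that at
    \<open>p\<close>.\<close>
  obtain q where q: "\<And>i. simple_function lborel (q i)" "\<And>p :: 'p. (\<lambda>i. q i p) \<longlonglongrightarrow> p"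
      "\<And>i p. norm (q i p) \<le> 2 * norm p"
    using borel_measurable_implies_sequence_metric[of "\<lambda>p :: 'p. p" lborel 0] by auto
  have [measurable]: "q i \<in> borel_measurable borel" for i
    using borel_measurable_simple_function[OF q(1)[of i]] by simp
  note [measurable] = c
  \<comment> \<open>\<open>?D bs i\<close> dominates the weighted error integrand for all
    \<open>x\<close> at once. This uniformity makes the sums converge in a seminorm rather than
    pointwise.\<close>
  let ?D = "\<lambda>bs i p. norm (c p) * (\<bar>K bs\<bar> * (1 + norm p + norm (q i p)) ^ M bs * norm (p - q i p))"
  \<comment> \<open>The distance to the node is itself of order \<open>1 + norm p\<close>, which
    explains the exponent \<open>Suc M\<close> in the moment assumed of \<open>c\<close>.\<close>
  have dom: "?D bs i p \<le> \<bar>K bs\<bar> * 3 ^ Suc (M bs) * ((1 + norm p) ^ Suc (M bs) * norm (c p))" for bs i p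
  proof -
    have "norm (p - q i p) \<le> norm p + norm (q i p)" by (rule norm_triangle_ineq4)
    also have "\<dots> \<le> 3 * (1 + norm p)" using q(3)[of i p] by simp
    finally have "norm (p - q i p) \<le> 3 * (1 + norm p)" .
    moreover have "(1 + norm p + norm (q i p)) ^ M bs \<le> (3 * (1 + norm p)) ^ M bs"
      using q(3)[of i p] by (intro power_mono) auto
    ultimately have "(1 + norm p + norm (q i p)) ^ M bs * norm (p - q i p) \<le> (3 * (1 + norm p)) ^ M bs * (3 * (1 + norm p))"
      by (intro mult_mono) auto
    then have "norm (c p) * (\<bar>K bs\<bar> * ((1 + norm p + norm (q i p)) ^ M bs * norm (p - q i p)))
      \<le> norm (c p) * (\<bar>K bs\<bar> * ((3 * (1 + norm p)) ^ M bs * (3 * (1 + norm p))))"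
      by (intro mult_left_mono) auto
    also have "\<dots> = \<bar>K bs\<bar> * 3 ^ Suc (M bs) * ((1 + norm p) ^ Suc (M bs) * norm (c p))"
      by (simp only: power_mult_distrib power_Suc mult_ac)
    finally show ?thesis by (simp add: mult.assoc)
  qed
  have domint: "integrable lborel (\<lambda>p. \<bar>K bs\<bar> * 3 ^ Suc (M bs) * ((1 + norm p) ^ Suc (M bs) * norm (c p)))"
    if "bs \<in> ?L" for bs
    by (intro integrable_mult_right KM that)
  have Dint: "integrable lborel (?D bs i)" if "bs \<in> ?L" for bs i
    by (rule Bochner_Integration.integrable_bound[OF domint[OF that]])
      (use dom[of _ bs i] in \<open>auto intro!: AE_I2 order_trans[OF _ abs_ge_self] simp: abs_mult\<close>)
  have lim: "(\<lambda>i. LBINT p. ?D bs i p) \<longlonglongrightarrow> integral\<^sup>L lborel (\<lambda>p :: 'p. 0 :: real)" if "bs \<in> ?L" for bs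
  proof (rule integral_dominated_convergence[OF _ _ domint[OF that]])
    show "AE p in lborel. (\<lambda>i. ?D bs i p) \<longlonglongrightarrow> 0"
    proof (rule AE_I2)
      fix p
      have "(\<lambda>i. ?D bs i p) \<longlonglongrightarrow> norm (c p) * (\<bar>K bs\<bar> * (1 + norm p + norm p) ^ M bs * norm (p - p))"
        by (intro tendsto_intros q)
      then show "(\<lambda>i. ?D bs i p) \<longlonglongrightarrow> 0" by simp
    qed
    show "AE p in lborel. norm (?D bs i p) \<le> \<bar>K bs\<bar> * 3 ^ Suc (M bs) * ((1 + norm p) ^ Suc (M bs) * norm (c p))" for i
      using dom[of _ bs i] by (auto simp: abs_mult)
  qed measurable
  have le: "norm (u \<Phi>) \<le> \<bar>A\<bar> * e" if e: "e > 0" for e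
  proof -
    have "\<forall>\<^sub>F i in sequentially. (LBINT p. ?D bs i p) < e" if "bs \<in> ?L" for bs
      using order_tendstoD(2)[OF lim[OF that]] e by simp
    then have "\<forall>\<^sub>F i in sequentially. \<forall>bs\<in>?L. (LBINT p. ?D bs i p) < e"
      using finL by (intro eventually_ball_finite) auto
    then obtain i where i: "\<And>bs. bs \<in> ?L \<Longrightarrow> (LBINT p. ?D bs i p) < e"
      unfolding eventually_sequentially by blast
    let ?V = "range (q i)"
    have finV: "finite ?V" using simple_functionD(1)[OF q(1)[of i]] by simp
    \<comment> \<open>The weight of a node is the integral of \<open>c\<close> over its cell, so the
      Riemann sum is exactly the superposition with the family frozen at
      \<open>q i p\<close>.\<close>
    define a where "a v = (LBINT p. indicator (q i -` {v}) p *\<^sub>R c p)" for v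
    define \<psi> where "\<psi> x = (\<Sum>v\<in>?V. a v * F v x)" for x
    have \<psi>: "schwartz \<psi>" "u \<psi> = 0"
      unfolding \<psi>_def using finV F by (auto intro!: schwartz_sum schwartz_cmult tempered_sum_eq_0[OF u])
    have ms: "q i -` {v} \<in> sets borel" for v
      using measurable_sets[of "q i" borel borel "{v}"] by simp
    have ai: "integrable lborel (\<lambda>p. indicator (q i -` {v}) p *\<^sub>R c p)" for v
      by (rule integrable_mult_indicator[OF _ cint]) (simp add: ms)
    have step: "has_bochner_integral lborel (\<lambda>p. c p * G (q i p)) (\<Sum>v\<in>?V. a v * G v)" for G :: "'p \<Rightarrow> complex"
    proof -
      have "has_bochner_integral lborel (\<lambda>p. \<Sum>v\<in>?V. (indicator (q i -` {v}) p *\<^sub>R c p) * G v) (\<Sum>v\<in>?V. a v * G v)"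
        unfolding a_def
        by (intro has_bochner_integral_sum has_bochner_integral_mult_left has_bochner_integral_integrable ai)
      moreover have "(\<Sum>v\<in>?V. (indicator (q i -` {v}) p *\<^sub>R c p) * G v) = c p * G (q i p)" for p
      proof -
        have "(\<Sum>v\<in>?V. (indicator (q i -` {v}) p *\<^sub>R c p) * G v) = (\<Sum>v\<in>{q i p}. c p * G v)"
          by (rule sum.mono_neutral_cong_right[OF finV]) (auto simp: indicator_def)
        then show ?thesis by simp
      qed
      ultimately show ?thesis by simp
    qed
    have "schwartz_norm N (\<lambda>x. \<Phi> x - \<psi> x) \<le> e"
    proof (rule schwartz_norm_le)
      fix bs :: "'a list" and x
      assume bs: "set bs \<subseteq> Basis" "length bs \<le> N"
      then have bsL: "bs \<in> ?L" by simp
      have "has_bochner_integral lborel (\<lambda>p. c p * iter_partial bs (F p) x - c p * iter_partial bs (F (q i p)) x)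
          (iter_partial bs \<Phi> x - (\<Sum>v\<in>?V. a v * iter_partial bs (F v) x))"
        by (intro has_bochner_integral_diff rep bs step)
      also have "(\<Sum>v\<in>?V. a v * iter_partial bs (F v) x) = iter_partial bs \<psi> x"
        unfolding \<psi>_def using iter_partial_sum[OF finV _ bs(1), of F a] F by simp
      also have "iter_partial bs \<Phi> x - iter_partial bs \<psi> x = iter_partial bs (\<lambda>x. \<Phi> x - \<psi> x) x"
        using iter_partial_diff[OF schwartz_smooth[OF \<Phi>] schwartz_smooth[OF \<psi>(1)] bs(1)] by simp
      finally have eq: "iter_partial bs (\<lambda>x. \<Phi> x - \<psi> x) x
          = (LBINT p. c p * iter_partial bs (F p) x - c p * iter_partial bs (F (q i p)) x)"
        by (simp add: has_bochner_integral_iff)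
      have "(1 + norm x) ^ N * norm (iter_partial bs (\<lambda>x. \<Phi> x - \<psi> x) x)
          \<le> (1 + norm x) ^ N * (LBINT p. norm (c p * iter_partial bs (F p) x - c p * iter_partial bs (F (q i p)) x))"
        unfolding eq by (intro mult_left_mono integral_norm_bound) simp
      also have "\<dots> = (LBINT p. (1 + norm x) ^ N * norm (c p * iter_partial bs (F p) x - c p * iter_partial bs (F (q i p)) x))"
        by (simp only: integral_mult_right_zero)
      also have "\<dots> \<le> (LBINT p. ?D bs i p)"
      proof (rule integral_mono'[OF Dint[OF bsL]])
        fix p
        have "(1 + norm x) ^ N * norm (c p * iter_partial bs (F p) x - c p * iter_partial bs (F (q i p)) x)
            = norm (c p) * ((1 + norm x) ^ N * norm (iter_partial bs (F p) x - iter_partial bs (F (q i p)) x))"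
          by (simp add: norm_mult flip: right_diff_distrib)
        also have "\<dots> \<le> norm (c p) * (K bs * (1 + norm p + norm (q i p)) ^ M bs * norm (p - q i p))"
          by (intro mult_left_mono KM bsL) simp
        also have "\<dots> \<le> ?D bs i p"
          by (intro mult_left_mono mult_right_mono) auto
        finally show "(1 + norm x) ^ N * norm (c p * iter_partial bs (F p) x - c p * iter_partial bs (F (q i p)) x) \<le> ?D bs i p" .
      qed auto
      also have "\<dots> \<le> e" using i[OF bsL] by simp
      finally show "(1 + norm x) ^ N * norm (iter_partial bs (\<lambda>x. \<Phi> x - \<psi> x) x) \<le> e" .
    qed
    then have "\<bar>A\<bar> * schwartz_norm N (\<lambda>x. \<Phi> x - \<psi> x) \<le> \<bar>A\<bar> * e"
      by (intro mult_left_mono) auto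
    moreover have "A * schwartz_norm N (\<lambda>x. \<Phi> x - \<psi> x) \<le> \<bar>A\<bar> * schwartz_norm N (\<lambda>x. \<Phi> x - \<psi> x)"
      by (intro mult_right_mono schwartz_norm_nonneg schwartz_minus \<Phi> \<psi>) auto
    moreover have "norm (u \<Phi>) \<le> A * schwartz_norm N (\<lambda>x. \<Phi> x - \<psi> x)"
      using A[OF schwartz_minus[OF \<Phi> \<psi>(1)]] tempered_diff[OF u \<Phi> \<psi>(1)] \<psi>(2) by simp
    ultimately show ?thesis by linarith
  qed
  have "norm (u \<Phi>) \<le> 0 + e" if "e > 0" for e
  proof -
    \<comment> \<open>The denominator is \<open>\<bar>A\<bar> + 1\<close> because \<open>A\<close>
      may be 0.\<close>
    have "\<bar>A\<bar> * (e / (\<bar>A\<bar> + 1)) \<le> e" using that by (simp add: field_simps)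
    then show ?thesis using le[of "e / (\<bar>A\<bar> + 1)"] that by simp
  qed
  then have "norm (u \<Phi>) \<le> 0" by (rule field_le_epsilon)
  then show ?thesis by simp
qed

section \<open>Modulations\<close>

abbreviation modulate :: "('a::euclidean_space \<Rightarrow> complex) \<Rightarrow> 'a \<Rightarrow> 'a \<Rightarrow> complex" where
  "modulate \<psi> v \<equiv> \<lambda>x. \<psi> x * cis (v \<bullet> x)"

lemma schwartz_mult_cis: "schwartz \<psi> \<Longrightarrow> schwartz (modulate \<psi> v)"
  by (intro schwartz_mult_moderate moderate_cis)

text \<open>Peeling off the innermost derivative applies the product rule to the function itself.
  Inductions over \<open>bs\<close> then merely change \<open>\<psi>\<close>, and no iterated
  Leibniz formula is needed.\<close>

lemma iter_partial_snoc_mult_cis: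
  assumes \<psi>: "schwartz \<psi>" and b: "b \<in> Basis" and bs: "set bs \<subseteq> Basis"
  shows "iter_partial (bs @ [b]) (modulate \<psi> v) x =
    iter_partial bs (modulate (partial b \<psi>) v) x + (\<i> * (v \<bullet> b)) * iter_partial bs (modulate \<psi> v) x"
proof -
  have "partial b (modulate \<psi> v) =
      (\<lambda>x. partial b \<psi> x * cis (v \<bullet> x) + (\<i> * (v \<bullet> b)) * (\<psi> x * cis (v \<bullet> x)))"
    by (rule ext, subst partial_mult[OF smooth_differentiable[OF schwartz_smooth[OF \<psi>]]
          smooth_differentiable[OF moderate_smooth[OF moderate_cis]]], subst partial_cis)
      (simp add: algebra_simps)
  then show ?thesis
    unfolding iter_partial_snoc
    using schwartz_smooth[OF schwartz_mult_cis[OF schwartz_partial[OF \<psi> b]]] schwartz_smooth[OF schwartz_mult_cis[OF \<psi>]]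
    by (simp add: iter_partial_add[OF _ _ bs] iter_partial_cmult[OF _ bs] smooth_cmult)
qed

lemma norm_cis_diff_le: "norm (cis a - cis b) \<le> \<bar>a - b\<bar>"
proof -
  have "(cis has_derivative (\<lambda>h. (\<i> * h) * cis t)) (at t)" for t
    using has_derivative_cis_inner[of 1 t] by simp
  then have "norm (cis a - cis b) \<le> 1 * norm (a - b)"
    by (intro differentiable_bound[of UNIV cis "\<lambda>t h. (\<i> * h) * cis t"])
      (auto simp: norm_mult intro!: onorm_le)
  then show ?thesis by simp
qed

text \<open>Each derivative of the character brings down a factor \<open>v \<bullet> b\<close>, so
  the constant grows polynomially in the frequencies. The coefficients of the superposition decay
  rapidly and can afford this.\<close>

lemma modulation_lipschitz:
  assumes "set bs \<subseteq> Basis" "schwartz \<psi>"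
  shows "\<exists>K M. 0 \<le> K \<and> (\<forall>v w x. (1 + norm x) ^ N *
    norm (iter_partial bs (modulate \<psi> v) x - iter_partial bs (modulate \<psi> w) x)
      \<le> K * (1 + norm v + norm w) ^ M * norm (v - w))"
  using assms
proof (induction bs arbitrary: \<psi> rule: rev_induct)
  case Nil
  \<comment> \<open>One extra power of the weight pays for the factor \<open>norm x\<close> in the
    difference of the characters.\<close>
  then obtain K where K: "K > 0" "\<And>x. (1 + norm x) ^ Suc N * norm (iter_partial [] \<psi> x) \<le> K"
    using schwartz_bound[of \<psi> "[]" "Suc N"] by auto
  have "(1 + norm x) ^ N * norm (\<psi> x * cis (v \<bullet> x) - \<psi> x * cis (w \<bullet> x)) \<le> K * norm (v - w)" for v w x
  proof -
    have "norm (cis (v \<bullet> x) - cis (w \<bullet> x)) \<le> \<bar>(v - w) \<bullet> x\<bar>"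
      using norm_cis_diff_le[of "v \<bullet> x" "w \<bullet> x"] by (simp add: inner_diff_left)
    also have "\<dots> \<le> norm (v - w) * (1 + norm x)"
      unfolding distrib_left mult_1_right
      using Cauchy_Schwarz_ineq2[of "v - w" x] norm_ge_zero[of "v - w"] by linarith
    finally have "(1 + norm x) ^ N * (norm (\<psi> x) * norm (cis (v \<bullet> x) - cis (w \<bullet> x)))
        \<le> (1 + norm x) ^ N * (norm (\<psi> x) * (norm (v - w) * (1 + norm x)))"
      by (intro mult_left_mono) auto
    also have "\<dots> = (1 + norm x) ^ Suc N * norm (\<psi> x) * norm (v - w)" by (simp add: mult_ac)
    also have "\<dots> \<le> K * norm (v - w)" using K(2)[of x] by (intro mult_right_mono) auto
    finally show ?thesis by (simp add: norm_mult flip: right_diff_distrib)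
  qed
  then show ?case
    by (intro exI[of _ K] exI[of _ 0]) (use K in auto)
next
  case (snoc b bs)
  then have b: "b \<in> Basis" and bs: "set bs \<subseteq> Basis" by auto
  let ?P = "\<lambda>v. iter_partial bs (modulate (partial b \<psi>) v)" and ?Q = "\<lambda>v. iter_partial bs (modulate \<psi> v)"
  obtain K1 M1 where 1: "0 \<le> K1" "\<And>v w x. (1 + norm x) ^ N * norm (?P v x - ?P w x) \<le> K1 * (1 + norm v + norm w) ^ M1 * norm (v - w)"
    using snoc.IH[OF bs schwartz_partial[OF snoc.prems(2) b]] by blast
  obtain K2 M2 where 2: "0 \<le> K2" "\<And>v w x. (1 + norm x) ^ N * norm (?Q v x - ?Q w x) \<le> K2 * (1 + norm v + norm w) ^ M2 * norm (v - w)"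
    using snoc.IH[OF bs snoc.prems(2)] by blast
  obtain K0 where K0: "K0 > 0" "\<And>x. (1 + norm x) ^ N * norm (iter_partial bs \<psi> x) \<le> K0"
    using schwartz_bound[OF snoc.prems(2) bs, of N] by blast
  define K3 where "K3 = K0 + K2"
  have 3: "0 \<le> K3" using K0(1) 2(1) by (simp add: K3_def)
  \<comment> \<open>Growth in \<open>w\<close> is read off from the Lipschitz bound itself by
    comparison with \<open>w = 0\<close>, where the modulation is trivial.\<close>
  have Q: "(1 + norm x) ^ N * norm (?Q w x) \<le> K3 * (1 + norm w) ^ Suc M2" for w x
  proof -
    have "(1 + norm x) ^ N * norm (?Q w x) \<le> (1 + norm x) ^ N * (norm (?Q 0 x) + norm (?Q w x - ?Q 0 x))"
      using norm_triangle_ineq[of "?Q 0 x" "?Q w x - ?Q 0 x"] by (intro mult_left_mono) auto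
    also have "\<dots> \<le> K0 * 1 + K2 * (1 + norm w) ^ M2 * norm w"
      using K0(2)[of x] 2(2)[of x w 0] by (simp add: distrib_left add_mono)
    also have "\<dots> \<le> K0 * (1 + norm w) ^ Suc M2 + K2 * (1 + norm w) ^ M2 * (1 + norm w)"
      using K0(1) 2(1) by (intro add_mono mult_left_mono one_le_power mult_nonneg_nonneg) auto
    also have "\<dots> = K3 * (1 + norm w) ^ Suc M2" by (simp add: K3_def algebra_simps)
    finally show ?thesis .
  qed
  let ?M = "M1 + Suc M2"
  have "(1 + norm x) ^ N * norm (iter_partial (bs @ [b]) (modulate \<psi> v) x - iter_partial (bs @ [b]) (modulate \<psi> w) x)
      \<le> (K1 + K2 + K3) * (1 + norm v + norm w) ^ ?M * norm (v - w)" for v w x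
  proof -
    let ?W = "(1 + norm v + norm w) ^ ?M * norm (v - w)"
    have a: "(1 + norm x) ^ N * norm (?P v x - ?P w x) \<le> K1 * ?W"
      unfolding mult.assoc[symmetric]
      by (rule order_trans[OF 1(2)]) (use 1(1) in \<open>intro mult_left_mono mult_right_mono power_increasing; simp\<close>)
    have b': "(1 + norm x) ^ N * norm ((\<i> * (v \<bullet> b)) * (?Q v x - ?Q w x)) \<le> K2 * ?W"
    proof -
      have "(1 + norm x) ^ N * norm ((\<i> * (v \<bullet> b)) * (?Q v x - ?Q w x)) = \<bar>v \<bullet> b\<bar> * ((1 + norm x) ^ N * norm (?Q v x - ?Q w x))"
        by (simp add: norm_mult)
      also have "\<dots> \<le> (1 + norm v + norm w) * (K2 * (1 + norm v + norm w) ^ M2 * norm (v - w))"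
        using Basis_le_norm[OF b, of v] by (intro mult_mono 2) (auto intro: order_trans)
      also have "\<dots> = K2 * (1 + norm v + norm w) ^ Suc M2 * norm (v - w)" by simp
      also have "\<dots> \<le> K2 * (1 + norm v + norm w) ^ ?M * norm (v - w)"
        using 2(1) by (intro mult_left_mono mult_right_mono power_increasing) auto
      finally show ?thesis by (simp only: mult.assoc)
    qed
    have c: "(1 + norm x) ^ N * norm ((\<i> * ((v - w) \<bullet> b)) * ?Q w x) \<le> K3 * ?W"
    proof -
      have "(1 + norm x) ^ N * norm ((\<i> * ((v - w) \<bullet> b)) * ?Q w x) = \<bar>(v - w) \<bullet> b\<bar> * ((1 + norm x) ^ N * norm (?Q w x))"
        by (simp add: norm_mult)
      also have "\<dots> \<le> norm (v - w) * (K3 * (1 + norm v + norm w) ^ ?M)"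
      proof (rule mult_mono)
        have "(1 + norm w) ^ Suc M2 \<le> (1 + norm v + norm w) ^ Suc M2" by (intro power_mono) auto
        also have "\<dots> \<le> (1 + norm v + norm w) ^ ?M" by (intro power_increasing) auto
        finally show "(1 + norm x) ^ N * norm (?Q w x) \<le> K3 * (1 + norm v + norm w) ^ ?M"
          by (intro order_trans[OF Q] mult_left_mono 3)
      qed (auto intro: Basis_le_norm[OF b])
      finally show ?thesis by (simp only: mult_ac)
    qed
    \<comment> \<open>Discrete product rule for \<open>v \<bullet> b\<close> times
      \<open>?Q v x\<close>.\<close>
    have eq: "iter_partial (bs @ [b]) (modulate \<psi> v) x - iter_partial (bs @ [b]) (modulate \<psi> w) x
      = (?P v x - ?P w x) + (\<i> * (v \<bullet> b)) * (?Q v x - ?Q w x) + (\<i> * ((v - w) \<bullet> b)) * ?Q w x"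
      unfolding iter_partial_snoc_mult_cis[OF snoc.prems(2) b bs] by (simp add: inner_diff_left algebra_simps)
    have "(1 + norm x) ^ N * norm (iter_partial (bs @ [b]) (modulate \<psi> v) x - iter_partial (bs @ [b]) (modulate \<psi> w) x)
      \<le> (1 + norm x) ^ N * (norm (?P v x - ?P w x) + norm ((\<i> * (v \<bullet> b)) * (?Q v x - ?Q w x)) + norm ((\<i> * ((v - w) \<bullet> b)) * ?Q w x))"
      unfolding eq by (intro mult_left_mono order_trans[OF norm_triangle_ineq add_right_mono[OF norm_triangle_ineq]]) simp
    also have "\<dots> \<le> K1 * ?W + K2 * ?W + K3 * ?W"
      unfolding distrib_left by (intro add_mono a b' c)
    also have "\<dots> = (K1 + K2 + K3) * (1 + norm v + norm w) ^ ?M * norm (v - w)"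
      by (simp only: distrib_right mult.assoc)
    finally show ?thesis .
  qed
  then show ?case using 1(1) 2(1) 3 by (intro exI[of _ "K1 + K2 + K3"] exI[of _ ?M]) auto
qed

text \<open>Differentiation under the integral is avoided: the factor that a derivative of the
  character produces is the one by which \<open>fourier (partial b \<phi>)\<close> differs from
  \<open>fourier \<phi>\<close>, so the product rule on both sides matches term by term.\<close>

lemma modulation_superposition:
  assumes "set bs \<subseteq> Basis" "schwartz \<phi>" "schwartz \<psi>"
  shows "has_bochner_integral lborel
    (\<lambda>y. fourier \<phi> y * iter_partial bs (modulate \<psi> ((2 * pi) *\<^sub>R y)) x)
    (iter_partial bs (\<lambda>x. \<phi> x * \<psi> x) x)"
  using assms
proof (induction bs arbitrary: \<phi> \<psi> rule: rev_induct)
  case Nil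
  have "integrable lborel (\<lambda>y. fourier \<phi> y * cis (2 * pi * (x \<bullet> y)))"
    by (rule integrable_mult_cis[OF schwartz_fourier_integrable[OF Nil(2)]]) simp
  then have "has_bochner_integral lborel (\<lambda>y. fourier \<phi> y * cis (2 * pi * (x \<bullet> y))) (\<phi> x)"
    using fourier_inversion[OF Nil(2), of x] by (simp add: has_bochner_integral_iff inv_fourier_def)
  from has_bochner_integral_mult_left[OF this, of "\<psi> x"] show ?case
    by (simp add: mult_ac inner_commute)
next
  case (snoc b bs)
  then have b: "b \<in> Basis" and bs: "set bs \<subseteq> Basis" by auto
  note \<phi> = snoc.prems(2) and \<psi> = snoc.prems(3)
  have f: "fourier (partial b \<phi>) y = fourier \<phi> y * (\<i> * ((2 * pi) *\<^sub>R y \<bullet> b))" for y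
    by (simp add: fourier_eq_inv_fourier inv_fourier_partial[OF \<phi> b])
  have "partial b (\<lambda>x. \<phi> x * \<psi> x) = (\<lambda>x. partial b \<phi> x * \<psi> x + \<phi> x * partial b \<psi> x)"
    using \<phi> \<psi> by (auto intro!: partial_mult smooth_differentiable schwartz_smooth)
  then have "iter_partial (bs @ [b]) (\<lambda>x. \<phi> x * \<psi> x) x =
      iter_partial bs (\<lambda>x. \<phi> x * partial b \<psi> x) x + iter_partial bs (\<lambda>x. partial b \<phi> x * \<psi> x) x"
    using \<phi> \<psi> b by (simp add: iter_partial_snoc iter_partial_add[OF _ _ bs] schwartz_smooth schwartz_mult schwartz_partial)
  moreover have "has_bochner_integral lborel
     (\<lambda>y. fourier \<phi> y * iter_partial bs (modulate (partial b \<psi>) ((2 * pi) *\<^sub>R y)) x +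
        fourier (partial b \<phi>) y * iter_partial bs (modulate \<psi> ((2 * pi) *\<^sub>R y)) x)
     (iter_partial bs (\<lambda>x. \<phi> x * partial b \<psi> x) x + iter_partial bs (\<lambda>x. partial b \<phi> x * \<psi> x) x)"
    by (intro has_bochner_integral_add snoc.IH bs \<phi> \<psi> schwartz_partial b)
  ultimately show ?case
    by (simp only: iter_partial_snoc_mult_cis[OF \<psi> b bs] f distrib_left mult.assoc)
qed

text \<open>The superposition principle with \<open>fourier \<phi>\<close> as coefficient. Its
  moments of every order are finite, and the dilation of frequencies by \<open>2 * pi\<close> costs
  only a constant.\<close>

lemma tempered_eq_0_modulations:
  fixes u :: "('a::euclidean_space \<Rightarrow> complex) \<Rightarrow> complex"
  assumes u: "tempered_distribution u" and \<psi>: "schwartz \<psi>" and \<phi>: "schwartz \<phi>"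
    and z: "\<And>y. u (modulate \<psi> ((2 * pi) *\<^sub>R y)) = 0"
  shows "u (\<lambda>x. \<phi> x * \<psi> x) = 0"
proof (rule tempered_superposition_eq_0[OF u schwartz_mult_cis[OF \<psi>] z schwartz_mult[OF \<phi> \<psi>]])
  show "has_bochner_integral lborel (\<lambda>y. fourier \<phi> y * iter_partial bs (modulate \<psi> ((2 * pi) *\<^sub>R y)) x)
      (iter_partial bs (\<lambda>x. \<phi> x * \<psi> x) x)" if "set bs \<subseteq> Basis" for bs x
    by (rule modulation_superposition[OF that \<phi> \<psi>])
  show "fourier \<phi> \<in> borel_measurable borel"
    by (intro borel_measurable_fourier borel_measurable_schwartz \<phi>)
  fix bs :: "'a list" and N assume bs: "set bs \<subseteq> Basis"
  obtain K M where K: "0 \<le> K" "\<And>v w x. (1 + norm x) ^ N *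
    norm (iter_partial bs (modulate \<psi> v) x - iter_partial bs (modulate \<psi> w) x)
      \<le> K * (1 + norm v + norm w) ^ M * norm (v - w)"
    using modulation_lipschitz[OF bs \<psi>, of N] by blast
  have "(1 + norm x) ^ N * norm (iter_partial bs (modulate \<psi> ((2 * pi) *\<^sub>R p)) x -
        iter_partial bs (modulate \<psi> ((2 * pi) *\<^sub>R q)) x)
      \<le> (K * (2 * pi) ^ Suc M) * (1 + norm p + norm q) ^ M * norm (p - q)" for p q x
  proof -
    have "norm ((2 * pi) *\<^sub>R p - (2 * pi) *\<^sub>R q) = 2 * pi * norm (p - q)"
      by (simp flip: scaleR_diff_right)
    moreover have "(1 + norm ((2 * pi) *\<^sub>R p) + norm ((2 * pi) *\<^sub>R q)) ^ M \<le> (2 * pi * (1 + norm p + norm q)) ^ M"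
      using pi_gt3 by (intro power_mono) (auto simp: algebra_simps)
    ultimately have "K * (1 + norm ((2 * pi) *\<^sub>R p) + norm ((2 * pi) *\<^sub>R q)) ^ M * norm ((2 * pi) *\<^sub>R p - (2 * pi) *\<^sub>R q)
      \<le> K * (2 * pi * (1 + norm p + norm q)) ^ M * (2 * pi * norm (p - q))"
      using K(1) by (simp only:) (intro mult_right_mono mult_left_mono; simp)
    also have "\<dots> = (K * (2 * pi) ^ Suc M) * (1 + norm p + norm q) ^ M * norm (p - q)"
      by (simp only: power_mult_distrib power_Suc mult_ac)
    finally show ?thesis by (rule order_trans[OF K(2)])
  qed
  moreover have "integrable lborel (\<lambda>p :: 'a. (1 + norm p) ^ Suc M * norm (fourier \<phi> p))"
    using lborel_integrable_affine[OF _ integrable_inv_fourier_moment[OF \<phi>, of "Suc M"], of "-1" 0]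
    by (simp add: fourier_eq_inv_fourier)
  ultimately show "\<exists>K M. integrable lborel (\<lambda>p. (1 + norm p) ^ Suc M * norm (fourier \<phi> p)) \<and>
      (\<forall>p q x. (1 + norm x) ^ N * norm (iter_partial bs (modulate \<psi> ((2 * pi) *\<^sub>R p)) x -
        iter_partial bs (modulate \<psi> ((2 * pi) *\<^sub>R q)) x) \<le> K * (1 + norm p + norm q) ^ M * norm (p - q))"
    by blast
qed

section \<open>Translations\<close>

lemma schwartz_translate: "schwartz g \<Longrightarrow> schwartz (\<lambda>x. g (x - t))"
  using schwartz_affine[of g "\<lambda>x. x" "- t"] by (simp add: linear_id[unfolded id_def])

lemma partial_translate: "partial b (\<lambda>x. g (x - t)) x = partial b g (x - t)"
  using partial_affine[of "\<lambda>x. x" b g "- t" x] by (simp add: linear_id[unfolded id_def])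

abbreviation mult_translate :: "('a::euclidean_space \<Rightarrow> complex) \<Rightarrow> ('a \<Rightarrow> complex) \<Rightarrow> 'a \<Rightarrow> 'a \<Rightarrow> complex" where
  "mult_translate f g t \<equiv> \<lambda>x. f x * g (x - t)"

lemma iter_partial_snoc_mult_translate:
  assumes f: "schwartz f" and g: "schwartz g" and b: "b \<in> Basis" and bs: "set bs \<subseteq> Basis"
  shows "iter_partial (bs @ [b]) (mult_translate f g t) x =
    iter_partial bs (mult_translate (partial b f) g t) x + iter_partial bs (mult_translate f (partial b g) t) x"
proof -
  have "partial b (mult_translate f g t) = (\<lambda>x. partial b f x * g (x - t) + f x * partial b g (x - t))"
    by (rule ext, subst partial_mult[OF smooth_differentiable[OF schwartz_smooth[OF f]]
          smooth_differentiable[OF schwartz_smooth[OF schwartz_translate[OF g]]]]) (simp add: partial_translate)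
  then show ?thesis
    unfolding iter_partial_snoc
    by (simp add: iter_partial_add[OF _ _ bs] schwartz_smooth schwartz_mult schwartz_translate schwartz_partial f g b)
qed

text \<open>The growth of \<open>w\<close> at \<open>t\<close> is shared between the decay of
  \<open>g\<close> at \<open>x - t\<close> and that of \<open>f\<close> at \<open>x\<close>, so the
  constant does not depend on \<open>t\<close> and \<open>s\<close>. The innermost derivative falls
  on \<open>f\<close> or on \<open>g\<close>, never on \<open>w\<close>.\<close>

lemma translation_lipschitz:
  fixes f g :: "'a::euclidean_space \<Rightarrow> complex"
  assumes "set bs \<subseteq> Basis" "schwartz f" "schwartz g" and w: "moderate w"
  shows "\<exists>K. \<forall>t s x. (1 + norm x) ^ N *
    norm (w t * iter_partial bs (mult_translate f g t) x - w s * iter_partial bs (mult_translate f g s) x)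
      \<le> K * norm (t - s)"
  using assms(1-3)
proof (induction bs arbitrary: f g rule: rev_induct)
  case Nil
  note f = Nil(2) and g = Nil(3)
  obtain K1 M1 where w1: "K1 > 0" "\<And>t. norm (w t) \<le> K1 * (1 + norm t) ^ M1"
    using moderate_bound[OF w] by blast
  have "\<forall>b\<in>Basis. \<exists>K M. 0 < K \<and> (\<forall>t. norm (partial b w t) \<le> K * (1 + norm t) ^ M)"
    using moderate_bound[OF moderate_partial[OF w]] by metis
  then obtain k m where w2: "\<And>b. b \<in> Basis \<Longrightarrow> k b > 0" "\<And>b t. b \<in> Basis \<Longrightarrow> norm (partial b w t) \<le> k b * (1 + norm t) ^ m b"
    by metis
  define M where "M = M1 + (\<Sum>b\<in>Basis. m b)"
  define K where "K = K1 + (\<Sum>b\<in>Basis. k b)"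
  have S0: "0 \<le> (\<Sum>b\<in>Basis. k b)" by (intro sum_nonneg less_imp_le w2)
  then have K0: "K > 0" and K1: "K1 \<le> K" using w1(1) by (simp_all add: K_def)
  have wK: "norm (w t) \<le> K * (1 + norm t) ^ M" for t
    by (rule order_trans[OF w1(2)])
      (use K0 K1 in \<open>auto simp: M_def intro!: mult_mono power_increasing\<close>)
  have w'K: "norm (partial b w t) \<le> K * (1 + norm t) ^ M" if b: "b \<in> Basis" for b t
  proof -
    have "k b \<le> (\<Sum>b\<in>Basis. k b)" "m b \<le> (\<Sum>b\<in>Basis. m b)"
      using w2(1) by (auto intro!: member_le_sum[OF b] intro: less_imp_le)
    then have "k b \<le> K" "m b \<le> M" using w1(1) by (auto simp: K_def M_def)
    then have "k b * (1 + norm t) ^ m b \<le> K * (1 + norm t) ^ M"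
      using K0 by (intro mult_mono power_increasing) auto
    then show ?thesis using w2(2)[OF b, of t] by simp
  qed
  obtain L where L: "L > 0" "\<And>y. (1 + norm y) ^ M * norm (iter_partial [] g y) \<le> L"
    using schwartz_bound[OF g, of "[]" M] by auto
  have "\<forall>b\<in>Basis. \<exists>L. 0 < L \<and> (\<forall>y. (1 + norm y) ^ M * norm (iter_partial [b] g y) \<le> L)"
    using schwartz_bound[OF g, of "[_]" M] by (metis empty_subsetI empty_set insert_subset list.simps(15))
  then obtain l where l: "\<And>b. b \<in> Basis \<Longrightarrow> l b > 0" "\<And>b y. b \<in> Basis \<Longrightarrow> (1 + norm y) ^ M * norm (iter_partial [b] g y) \<le> l b"
    by metis
  define L' where "L' = L + (\<Sum>b\<in>Basis. l b)"
  have "0 \<le> (\<Sum>b\<in>Basis. l b)" by (intro sum_nonneg less_imp_le l)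
  then have L'0: "L' > 0" using L(1) by (simp add: L'_def)
  have gL: "(1 + norm y) ^ M * norm (g y) \<le> L'" for y
  proof -
    have "0 \<le> (\<Sum>b\<in>Basis. l b)" by (intro sum_nonneg less_imp_le l)
    then show ?thesis using L(2)[of y] by (simp add: L'_def)
  qed
  have g'L: "(1 + norm y) ^ M * norm (partial b g y) \<le> L'" if b: "b \<in> Basis" for b y
  proof -
    have "l b \<le> (\<Sum>b\<in>Basis. l b)" using l(1) by (auto intro!: member_le_sum[OF b] intro: less_imp_le)
    then show ?thesis using l(2)[OF b, of y] L(1) by (simp add: L'_def iter_partial_Cons)
  qed
  \<comment> \<open>Peetre's inequality in its elementary form.\<close>
  have tr: "(1 + norm t) ^ M \<le> (1 + norm x) ^ M * (1 + norm (x - t)) ^ M" for x t :: 'a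
  proof -
    have "norm t \<le> norm x + norm (x - t)" using norm_triangle_ineq4[of x "x - t"] by simp
    also have "\<dots> \<le> (1 + norm x) * (1 + norm (x - t)) - 1" by (simp add: algebra_simps)
    finally show ?thesis unfolding power_mult_distrib[symmetric] by (intro power_mono) auto
  qed
  have prod: "norm c * norm d \<le> K * L' * (1 + norm x) ^ M"
    if "norm c \<le> K * (1 + norm t) ^ M" "(1 + norm (x - t)) ^ M * norm d \<le> L'" for c d :: complex and x t :: 'a
  proof -
    have "norm c * norm d \<le> K * (1 + norm t) ^ M * norm d" by (rule mult_right_mono[OF that(1)]) simp
    also have "\<dots> \<le> K * ((1 + norm x) ^ M * (1 + norm (x - t)) ^ M) * norm d"
      using K0 by (intro mult_right_mono mult_left_mono tr) auto
    also have "\<dots> = K * (1 + norm x) ^ M * ((1 + norm (x - t)) ^ M * norm d)" by (simp only: mult_ac)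
    also have "\<dots> \<le> K * (1 + norm x) ^ M * L'"
      using K0 that(2) by (intro mult_left_mono) auto
    finally show ?thesis by (simp only: mult_ac)
  qed
  obtain B where B: "B > 0" "\<And>x. (1 + norm x) ^ (N + M) * norm (iter_partial [] f x) \<le> B"
    using schwartz_bound[OF f, of "[]" "N + M"] by auto
  let ?C = "DIM('a) * (2 * (K * L'))"
  have "(1 + norm x) ^ N * norm (w t * (f x * g (x - t)) - w s * (f x * g (x - s))) \<le> B * ?C * norm (t - s)" for t s x
  proof -
    let ?h = "\<lambda>t. w t * g (x - t)"
    have gr: "smooth (\<lambda>t. g (x - t))"
    proof -
      have "smooth (\<lambda>t. g (- t + x))"
        by (rule smooth_affine[where s="-1"]) (auto simp: schwartz_smooth g intro!: linearI)
      then show ?thesis by simp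
    qed
    have dg: "partial b (\<lambda>t. g (x - t)) t = - partial b g (x - t)" for b t
    proof -
      have "linear (\<lambda>t :: 'a. - t)" by (auto intro!: linearI)
      from partial_affine[OF this, of b g x t] show ?thesis
        using partial_scaleR_dir[of g "x - t" "-1" b] smooth_differentiable[OF schwartz_smooth[OF g]] by simp
    qed
    have "norm (?h t - ?h s) \<le> DIM('a) * (2 * (K * L') * (1 + norm x) ^ M) * norm (t - s)"
    proof (rule norm_diff_le_partial)
      fix t show "?h differentiable at t"
        by (intro differentiable_mult smooth_differentiable gr moderate_smooth w)
      fix b :: 'a assume b: "b \<in> Basis"
      have "partial b ?h t = partial b w t * g (x - t) + w t * (- partial b g (x - t))"
        unfolding dg[symmetric] by (intro partial_mult smooth_differentiable gr moderate_smooth w)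
      then have "norm (partial b ?h t) \<le> norm (partial b w t) * norm (g (x - t)) + norm (w t) * norm (partial b g (x - t))"
        using norm_triangle_ineq[of "partial b w t * g (x - t)" "w t * (- partial b g (x - t))"] by (simp add: norm_mult)
      also have "\<dots> \<le> K * L' * (1 + norm x) ^ M + K * L' * (1 + norm x) ^ M"
        by (intro add_mono prod[of _ t] w'K wK b gL g'L)
      finally show "norm (partial b ?h t) \<le> 2 * (K * L') * (1 + norm x) ^ M" by simp
    qed
    then have "(1 + norm x) ^ N * (norm (f x) * norm (?h t - ?h s))
        \<le> (1 + norm x) ^ N * (norm (f x) * (DIM('a) * (2 * (K * L') * (1 + norm x) ^ M) * norm (t - s)))"
      by (intro mult_left_mono) auto
    also have "\<dots> = ((1 + norm x) ^ (N + M) * norm (f x)) * (?C * norm (t - s))"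
      by (simp only: power_add mult_ac)
    also have "\<dots> \<le> B * (?C * norm (t - s))"
      using B(2)[of x] K0 L'0 by (intro mult_right_mono) auto
    finally show ?thesis
      by (simp add: norm_mult[symmetric] right_diff_distrib mult_ac)
  qed
  then show ?case by (intro exI[of _ "B * ?C"]) auto
next
  case (snoc b bs)
  then have b: "b \<in> Basis" and bs: "set bs \<subseteq> Basis" by auto
  note f = snoc.prems(2) and g = snoc.prems(3)
  let ?P = "\<lambda>t. iter_partial bs (mult_translate (partial b f) g t)" and ?Q = "\<lambda>t. iter_partial bs (mult_translate f (partial b g) t)"
  obtain K1 where 1: "\<And>t s x. (1 + norm x) ^ N * norm (w t * ?P t x - w s * ?P s x) \<le> K1 * norm (t - s)"
    using snoc.IH[OF bs schwartz_partial[OF f b] g] by blast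
  obtain K2 where 2: "\<And>t s x. (1 + norm x) ^ N * norm (w t * ?Q t x - w s * ?Q s x) \<le> K2 * norm (t - s)"
    using snoc.IH[OF bs f schwartz_partial[OF g b]] by blast
  have "(1 + norm x) ^ N * norm (w t * (?P t x + ?Q t x) - w s * (?P s x + ?Q s x)) \<le> (K1 + K2) * norm (t - s)" for t s x
  proof -
    have "w t * (?P t x + ?Q t x) - w s * (?P s x + ?Q s x) = (w t * ?P t x - w s * ?P s x) + (w t * ?Q t x - w s * ?Q s x)"
      by (simp add: algebra_simps)
    then have "(1 + norm x) ^ N * norm (w t * (?P t x + ?Q t x) - w s * (?P s x + ?Q s x))
        \<le> (1 + norm x) ^ N * (norm (w t * ?P t x - w s * ?P s x) + norm (w t * ?Q t x - w s * ?Q s x))"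
      using norm_triangle_ineq by (intro mult_left_mono) auto
    also have "\<dots> \<le> (K1 + K2) * norm (t - s)"
      unfolding distrib_left distrib_right by (intro add_mono 1 2)
    finally show ?thesis .
  qed
  then show ?case
    unfolding iter_partial_snoc_mult_translate[OF f g b bs] by blast
qed

text \<open>Derivatives that fall on \<open>g\<close> contribute nothing, as the integral of a
  derivative vanishes; only the derivatives of \<open>f\<close> survive.\<close>

lemma translation_superposition:
  assumes "set bs \<subseteq> Basis" "schwartz f" "schwartz g"
  shows "has_bochner_integral lborel (\<lambda>t. iter_partial bs (mult_translate f g t) x)
    (iter_partial bs f x * (LBINT y. g y))"
  using assms
proof (induction bs arbitrary: f g rule: rev_induct)
  case Nil
  have "has_bochner_integral lborel (\<lambda>t. g (x - t)) (LBINT y. g y)"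
    using lborel_integrable_translate(2)[OF schwartz_integrable[OF Nil(3)], of x]
      lborel_integral_translate(2)[OF borel_measurable_schwartz[OF Nil(3)], of x]
    by (simp add: has_bochner_integral_iff)
  from has_bochner_integral_mult_right[OF this, of "f x"] show ?case by simp
next
  case (snoc b bs)
  then have b: "b \<in> Basis" and bs: "set bs \<subseteq> Basis" by auto
  note f = snoc.prems(2) and g = snoc.prems(3)
  have "(LBINT y. partial b g y) = 0"
    by (intro integral_partial_eq_0 schwartz_integrable schwartz_partial g b smooth_differentiable
        smooth_continuous_on schwartz_smooth)
  with has_bochner_integral_add[OF snoc.IH[OF bs schwartz_partial[OF f b] g] snoc.IH[OF bs f schwartz_partial[OF g b]]]
  show ?case
    unfolding iter_partial_snoc_mult_translate[OF f g b bs] by (simp add: iter_partial_snoc)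
qed

text \<open>The translates \<open>f x * g (x - t)\<close> are superposed with the constant coefficient \<open>1\<close>; a power \<open>w t\<close> of
  \<open>1 + (norm t)\<^sup>2\<close> is moved into the family so that the coefficient \<open>1 / w t\<close> becomes integrable.\<close>

lemma tempered_eq_0_translations:
  fixes u :: "('a::euclidean_space \<Rightarrow> complex) \<Rightarrow> complex"
  assumes u: "tempered_distribution u" and f: "schwartz f" and g: "schwartz g"
    and g0: "(LBINT y. g y) \<noteq> 0"
    and z: "\<And>t. u (mult_translate f g t) = 0"
  shows "u f = 0"
proof -
  \<comment> \<open>\<open>w\<close> grows with exponent \<open>2 * ?J\<close>, twice what
    integrability asks for. Hence \<open>1 / w\<close> remains integrable against the additional
    weight \<open>1 + norm t\<close>, the case \<open>M = 0\<close> of the superposition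
    principle.\<close>
  let ?J = "2 * DIM('a)"
  define w where "w t = complex_of_real (1 + (norm t)\<^sup>2) ^ ?J" for t :: 'a
  have w: "moderate w"
    unfolding w_def[abs_def] of_real_add by (intro moderate_power moderate_add moderate_const moderate_norm_square)
  have pos: "0 < 1 + (norm t)\<^sup>2" for t :: 'a by (smt (verit) zero_le_power2)
  have w0: "w t \<noteq> 0" for t unfolding w_def using pos[of t] by (metis less_irrefl of_real_eq_0_iff power_not_zero)
  let ?F = "\<lambda>t x. w t * (f x * g (x - t))"
  have sch: "schwartz (mult_translate f g t)" for t
    by (intro schwartz_mult f schwartz_translate g)
  have it: "iter_partial bs (?F t) x = w t * iter_partial bs (mult_translate f g t) x" if "set bs \<subseteq> Basis" for bs t x
    using iter_partial_cmult[OF schwartz_smooth[OF sch] that] by simp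
  have "u (\<lambda>x. (LBINT y. g y) * f x) = 0"
  proof (rule tempered_superposition_eq_0[where F="?F" and c="\<lambda>t. 1 / w t", OF u])
    show "schwartz (?F t)" for t by (intro schwartz_cmult sch)
    show "u (?F t) = 0" for t using tempered_cmult[OF u sch] z by simp
    show "schwartz (\<lambda>x. (LBINT y. g y) * f x)" by (intro schwartz_cmult f)
    show wm: "(\<lambda>t. 1 / w t) \<in> borel_measurable borel"
      using borel_measurable_smooth[OF moderate_smooth[OF w]] by simp
    show "has_bochner_integral lborel (\<lambda>t. 1 / w t * iter_partial bs (?F t) x)
        (iter_partial bs (\<lambda>x. (LBINT y. g y) * f x) x)" if bs: "set bs \<subseteq> Basis" for bs x
    proof -
      have "iter_partial bs (\<lambda>x. (LBINT y. g y) * f x) x = iter_partial bs f x * (LBINT y. g y)"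
        by (simp add: iter_partial_cmult[OF schwartz_smooth[OF f] bs])
      moreover have "1 / w t * iter_partial bs (?F t) x = iter_partial bs (mult_translate f g t) x" for t
        by (simp add: it[OF bs] w0)
      ultimately show ?thesis
        using translation_superposition[OF bs f g, of x] by (simp only:)
    qed
    fix bs :: "'a list" and N assume bs: "set bs \<subseteq> Basis"
    obtain K where "\<And>t s x. (1 + norm x) ^ N *
      norm (w t * iter_partial bs (mult_translate f g t) x - w s * iter_partial bs (mult_translate f g s) x) \<le> K * norm (t - s)"
      using translation_lipschitz[OF bs f g w, of N] by blast
    then have "\<forall>t s x. (1 + norm x) ^ N * norm (iter_partial bs (?F t) x - iter_partial bs (?F s) x)
        \<le> K * (1 + norm t + norm s) ^ 0 * norm (t - s)"
      by (simp add: it[OF bs])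
    moreover have "integrable lborel (\<lambda>t. (1 + norm t) ^ Suc 0 * norm (1 / w t))"
    proof (rule integrable_of_decay[where K="2 ^ ?J"])
      fix t :: 'a
      have t: "0 < 1 + norm t" by simp
      have "(1 + norm t)\<^sup>2 \<le> 2 * (1 + (norm t)\<^sup>2)"
        using zero_le_power2[of "1 - norm t"] by (simp add: power2_eq_square algebra_simps)
      then have "((1 + norm t)\<^sup>2) ^ ?J \<le> (2 * (1 + (norm t)\<^sup>2)) ^ ?J" by (intro power_mono) auto
      moreover have "(1 + norm t) * (1 + norm t) ^ ?J \<le> ((1 + norm t)\<^sup>2) ^ ?J"
      proof -
        have "Suc ?J \<le> 2 * ?J" using DIM_positive[where 'a='a] by linarith
        then have "(1 + norm t) ^ Suc ?J \<le> (1 + norm t) ^ (2 * ?J)" by (intro power_increasing) auto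
        then show ?thesis by (simp only: power_mult power_Suc)
      qed
      ultimately have "(1 + norm t) * (1 + norm t) ^ ?J \<le> 2 ^ ?J * (1 + (norm t)\<^sup>2) ^ ?J"
        by (simp only: power_mult_distrib)
      moreover have "norm (w t) = (1 + (norm t)\<^sup>2) ^ ?J"
        unfolding w_def norm_power norm_of_real using pos[of t] by simp
      ultimately have "(1 + norm t) * (1 + norm t) ^ ?J \<le> 2 ^ ?J * norm (w t)" by simp
      moreover have "0 < norm (w t)" "0 < (1 + norm t) ^ ?J" using w0 t by simp_all
      ultimately show "norm ((1 + norm t) ^ Suc 0 * norm (1 / w t)) \<le> 2 ^ ?J / (1 + norm t) ^ ?J"
        using t by (simp add: norm_divide field_simps)
    qed (use wm in measurable)
    ultimately show "\<exists>K M. integrable lborel (\<lambda>p. (1 + norm p) ^ Suc M * norm (1 / w p)) \<and>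
        (\<forall>p q x. (1 + norm x) ^ N * norm (iter_partial bs (?F p) x - iter_partial bs (?F q) x)
          \<le> K * (1 + norm p + norm q) ^ M * norm (p - q))"
      by blast
  qed
  then show ?thesis using tempered_cmult[OF u f] g0 by simp
qed

section \<open>Gaussian wave packets and uniqueness of the Wigner kernel\<close>

lemma integral_gauss_ne_0: "(LBINT x. complex_of_real (exp (- 2 * pi * (norm (x :: 'a::euclidean_space))\<^sup>2))) \<noteq> 0"
proof -
  let ?g = "\<lambda>x :: 'a. complex_of_real (exp (- 2 * pi * (norm x)\<^sup>2))"
  have "?g \<in> borel_measurable borel" by measurable
  then have "(LBINT x. ?g x) = \<bar>1 / sqrt 2\<bar> ^ DIM('a) *\<^sub>R (LBINT x. ?g (0 + (1 / sqrt 2) *\<^sub>R x))"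
    by (intro lborel_integral_affine) auto
  also have "(\<lambda>x. ?g (0 + (1 / sqrt 2) *\<^sub>R x)) = (\<lambda>x. complex_of_real (exp (- pi * (norm x)\<^sup>2)))"
    by (auto simp: power_divide power_mult_distrib)
  finally have eq: "(LBINT x. ?g x) = \<bar>1 / sqrt 2\<bar> ^ DIM('a) *\<^sub>R 1"
    unfolding integral_gauss .
  show ?thesis unfolding eq by simp
qed

text \<open>The exponent \<open>2 * pi\<close> is the one that the Wigner distribution of a Gaussian
  with exponent \<open>pi\<close> has on phase space.\<close>

lemma tempered_eq_0_wave_packets:
  fixes u :: "('a::euclidean_space \<Rightarrow> complex) \<Rightarrow> complex"
  assumes u: "tempered_distribution u" and \<phi>: "schwartz \<phi>"
    and z: "\<And>t y. u (\<lambda>x. of_real (exp (- 2 * pi * (norm (x - t))\<^sup>2)) * cis (2 * pi * (y \<bullet> x))) = 0"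
  shows "u \<phi> = 0"
proof (rule tempered_eq_0_translations[OF u \<phi> _ integral_gauss_ne_0])
  show g: "schwartz (\<lambda>x :: 'a. complex_of_real (exp (- 2 * pi * (norm x)\<^sup>2)))"
    using schwartz_gauss[of "2 * pi"] by simp
  show "u (\<lambda>x. \<phi> x * of_real (exp (- 2 * pi * (norm (x - t))\<^sup>2))) = 0" for t
    using tempered_eq_0_modulations[OF u schwartz_translate[OF g] \<phi>, of t] z by simp
qed

definition wave_packet :: "'a::euclidean_space \<Rightarrow> 'a \<Rightarrow> 'a \<Rightarrow> complex" where
  "wave_packet a b x = of_real (exp (- pi * (norm (x - a))\<^sup>2)) * cis (2 * pi * (b \<bullet> x))"

lemma schwartz_gauss_wave: "c > 0 \<Longrightarrow> schwartz (\<lambda>x. of_real (exp (- c * (norm (x - a))\<^sup>2)) * cis (2 * pi * (b \<bullet> x)))"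
  using schwartz_mult_cis[OF schwartz_translate[OF schwartz_gauss], of c a "(2 * pi) *\<^sub>R b"] by simp

lemma schwartz_wave_packet: "schwartz (wave_packet a b)"
  using schwartz_gauss_wave[of pi a b] by (simp add: wave_packet_def[abs_def])

text \<open>The means of the two positions and of the two frequencies place the result at
  \<open>(m, \<beta>)\<close>, while their differences become its modulation \<open>(p, q)\<close>.
  As these vary independently, every time-frequency shift of the phase space Gaussian is
  reached.\<close>

lemma wigner_wave_packet:
  fixes m q \<beta> p x \<xi> :: "'a::euclidean_space"
  shows "wigner (wave_packet (m - q /\<^sub>R 2) (\<beta> + p /\<^sub>R 2)) (wave_packet (m + q /\<^sub>R 2) (\<beta> - p /\<^sub>R 2)) (x, \<xi>)
    = (of_real (sqrt 2 ^ DIM('a)) * cis (- 2 * pi * (q \<bullet> \<beta>))) *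
      (of_real (exp (- 2 * pi * (norm ((x, \<xi>) - (m, \<beta>)))\<^sup>2)) * cis (2 * pi * ((p, q) \<bullet> (x, \<xi>))))"
proof -
  let ?g = "\<lambda>y :: 'a. complex_of_real (exp (- pi * (norm y)\<^sup>2))"
  let ?F = "\<lambda>y. wave_packet (m - q /\<^sub>R 2) (\<beta> + p /\<^sub>R 2) (x + y /\<^sub>R 2) *
      cnj (wave_packet (m + q /\<^sub>R 2) (\<beta> - p /\<^sub>R 2) (x - y /\<^sub>R 2)) * cis (- 2 * pi * (y \<bullet> \<xi>))"
  have cm: "continuous_on UNIV (wave_packet a b)" for a b :: 'a
    by (rule smooth_continuous_on[OF schwartz_smooth[OF schwartz_wave_packet]])
  have Fm: "?F \<in> borel_measurable borel"
    by (intro borel_measurable_continuous_onI continuous_intros continuous_on_compose2[OF cm] continuous_on_cis) auto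
  have aux: "- pi * a + - pi * b = - 2 * pi * c + - pi * d" if "a + b = 2 * c + d" for a b c d :: real
  proof -
    have "- pi * (a + b) = - pi * (2 * c + d)" using that by simp
    then show ?thesis by (simp add: algebra_simps)
  qed
  let ?C = "of_real (exp (- 2 * pi * (norm (x - m))\<^sup>2)) * cis (2 * pi * (p \<bullet> x)) * cis (- 2 * pi * (q \<bullet> (\<beta> - \<xi>)))"
  \<comment> \<open>The shift by \<open>- q\<close> centres the Gaussian in the integration variable
    and \<open>sqrt 2\<close> normalises it. By the parallelogram law the two exponents then
    separate into a part in \<open>x - m\<close> and a part in \<open>z\<close>.\<close>
  have F: "?F (- q + sqrt 2 *\<^sub>R z) = ?C * (?g z * cis (2 * pi * ((sqrt 2 *\<^sub>R (\<beta> - \<xi>)) \<bullet> z)))" for z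
  proof -
    let ?y = "- q + sqrt 2 *\<^sub>R z"
    have "x + ?y /\<^sub>R 2 - (m - q /\<^sub>R 2) = (x - m) + (sqrt 2 / 2) *\<^sub>R z" "x - ?y /\<^sub>R 2 - (m + q /\<^sub>R 2) = (x - m) - (sqrt 2 / 2) *\<^sub>R z"
      by (simp_all add: algebra_simps)
    then have "(norm (x + ?y /\<^sub>R 2 - (m - q /\<^sub>R 2)))\<^sup>2 + (norm (x - ?y /\<^sub>R 2 - (m + q /\<^sub>R 2)))\<^sup>2
      = 2 * (norm (x - m))\<^sup>2 + (norm z)\<^sup>2"
      by (simp only: power2_norm_eq_inner) (simp add: inner_add_left inner_add_right inner_diff_left inner_diff_right inner_commute power2_eq_square[symmetric] field_simps)
    from aux[OF this]
    have e: "exp (- pi * (norm (x + ?y /\<^sub>R 2 - (m - q /\<^sub>R 2)))\<^sup>2) * exp (- pi * (norm (x - ?y /\<^sub>R 2 - (m + q /\<^sub>R 2)))\<^sup>2)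
      = exp (- 2 * pi * (norm (x - m))\<^sup>2) * exp (- pi * (norm z)\<^sup>2)"
      by (simp only: exp_add[symmetric])
    have c: "cis (2 * pi * ((\<beta> + p /\<^sub>R 2) \<bullet> (x + ?y /\<^sub>R 2))) * cnj (cis (2 * pi * ((\<beta> - p /\<^sub>R 2) \<bullet> (x - ?y /\<^sub>R 2)))) * cis (- 2 * pi * (?y \<bullet> \<xi>))
      = cis (2 * pi * (p \<bullet> x)) * cis (- 2 * pi * (q \<bullet> (\<beta> - \<xi>))) * cis (2 * pi * ((sqrt 2 *\<^sub>R (\<beta> - \<xi>)) \<bullet> z))"
      unfolding cis_cnj cis_mult
      by (rule arg_cong[of _ _ cis]) (simp add: inner_add_left inner_add_right inner_diff_left inner_diff_right inner_commute field_simps)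
    have "?F ?y = of_real (exp (- pi * (norm (x + ?y /\<^sub>R 2 - (m - q /\<^sub>R 2)))\<^sup>2) * exp (- pi * (norm (x - ?y /\<^sub>R 2 - (m + q /\<^sub>R 2)))\<^sup>2)) *
       (cis (2 * pi * ((\<beta> + p /\<^sub>R 2) \<bullet> (x + ?y /\<^sub>R 2))) * cnj (cis (2 * pi * ((\<beta> - p /\<^sub>R 2) \<bullet> (x - ?y /\<^sub>R 2)))) * cis (- 2 * pi * (?y \<bullet> \<xi>)))"
      unfolding wave_packet_def complex_cnj_mult complex_cnj_complex_of_real of_real_mult by (simp only: mult_ac)
    then show ?thesis
      unfolding e c of_real_mult by (simp only: mult_ac)
  qed
  have "wigner (wave_packet (m - q /\<^sub>R 2) (\<beta> + p /\<^sub>R 2)) (wave_packet (m + q /\<^sub>R 2) (\<beta> - p /\<^sub>R 2)) (x, \<xi>) = (LBINT y. ?F y)"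
    by (simp add: wigner_def)
  also have "\<dots> = \<bar>sqrt 2\<bar> ^ DIM('a) *\<^sub>R (LBINT z. ?F (- q + sqrt 2 *\<^sub>R z))"
    by (rule lborel_integral_affine[OF _ Fm]) simp
  also have "\<dots> = sqrt 2 ^ DIM('a) *\<^sub>R (?C * inv_fourier ?g (sqrt 2 *\<^sub>R (\<beta> - \<xi>)))"
    unfolding F by (simp only: integral_mult_right_zero inv_fourier_def) simp
  also have "\<dots> = of_real (sqrt 2 ^ DIM('a)) * (?C * of_real (exp (- pi * (norm (sqrt 2 *\<^sub>R (\<beta> - \<xi>)))\<^sup>2)))"
    by (simp only: inv_fourier_gauss scaleR_conv_of_real)
  also have "exp (- pi * (norm (sqrt 2 *\<^sub>R (\<beta> - \<xi>)))\<^sup>2) = exp (- 2 * pi * (norm (\<xi> - \<beta>))\<^sup>2)"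
    by (simp add: power_mult_distrib norm_minus_commute)
  also have "cis (- 2 * pi * (q \<bullet> (\<beta> - \<xi>))) = cis (- 2 * pi * (q \<bullet> \<beta>)) * cis (2 * pi * (q \<bullet> \<xi>))"
    unfolding cis_mult by (rule arg_cong[of _ _ cis]) (simp add: inner_diff_right algebra_simps)
  also have "of_real (sqrt 2 ^ DIM('a)) * (of_real (exp (- 2 * pi * (norm (x - m))\<^sup>2)) * cis (2 * pi * (p \<bullet> x)) *
      (cis (- 2 * pi * (q \<bullet> \<beta>)) * cis (2 * pi * (q \<bullet> \<xi>))) * of_real (exp (- 2 * pi * (norm (\<xi> - \<beta>))\<^sup>2)))
    = (of_real (sqrt 2 ^ DIM('a)) * cis (- 2 * pi * (q \<bullet> \<beta>))) *
      (of_real (exp (- 2 * pi * (norm (x - m))\<^sup>2) * exp (- 2 * pi * (norm (\<xi> - \<beta>))\<^sup>2)) * (cis (2 * pi * (p \<bullet> x)) * cis (2 * pi * (q \<bullet> \<xi>))))"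
    unfolding of_real_mult by (simp only: mult_ac)
  also have "exp (- 2 * pi * (norm (x - m))\<^sup>2) * exp (- 2 * pi * (norm (\<xi> - \<beta>))\<^sup>2) = exp (- 2 * pi * (norm ((x, \<xi>) - (m, \<beta>)))\<^sup>2)"
    unfolding exp_add[symmetric] by (simp add: norm_Pair algebra_simps)
  also have "cis (2 * pi * (p \<bullet> x)) * cis (2 * pi * (q \<bullet> \<xi>)) = cis (2 * pi * ((p, q) \<bullet> (x, \<xi>)))"
    unfolding cis_mult by (simp add: distrib_left)
  finally show ?thesis .
qed

text \<open>A shifted Gaussian on the doubled phase space splits into one factor in \<open>z\<close>
  and one in \<open>w\<close>. The first is an admissible \<open>\<Phi>\<close>, the second a Wigner
  distribution up to a nonzero constant, so both kernels agree on all shifted Gaussians.\<close>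

lemma wigner_kernel_unique:
  fixes k k' :: "(('a::euclidean_space \<times> 'a) \<times> ('a \<times> 'a) \<Rightarrow> complex) \<Rightarrow> complex"
  assumes k: "tempered_distribution k" "wigner_kernel_identity T k"
    and k': "tempered_distribution k'" "wigner_kernel_identity T k'"
    and \<Phi>: "schwartz \<Phi>"
  shows "k' \<Phi> = k \<Phi>"
proof -
  have u: "tempered_distribution (\<lambda>\<Phi>. k' \<Phi> - k \<Phi>)" by (rule tempered_distribution_diff[OF k'(1) k(1)])
  have "k' \<Phi> - k \<Phi> = 0"
  proof (rule tempered_eq_0_wave_packets[OF u \<Phi>])
    fix t y :: "('a \<times> 'a) \<times> ('a \<times> 'a)"
    obtain t1 m \<beta> where t: "t = (t1, (m, \<beta>))" by (metis surj_pair)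
    obtain y1 p q where y: "y = (y1, (p, q))" by (metis surj_pair)
    let ?\<kappa> = "of_real (sqrt 2 ^ DIM('a)) * cis (- 2 * pi * (q \<bullet> \<beta>))"
    let ?f = "wave_packet (m - q /\<^sub>R 2) (\<beta> + p /\<^sub>R 2)" and ?g = "wave_packet (m + q /\<^sub>R 2) (\<beta> - p /\<^sub>R 2)"
    let ?\<Phi> = "\<lambda>z. complex_of_real (exp (- (2 * pi) * (norm (z - t1))\<^sup>2)) * cis (2 * pi * (y1 \<bullet> z))"
    let ?E = "\<lambda>x. of_real (exp (- 2 * pi * (norm (x - t))\<^sup>2)) * cis (2 * pi * (y \<bullet> x))"
    have E: "schwartz ?E" using schwartz_gauss_wave[of "2 * pi" t y] by simp
    have \<Phi>': "schwartz ?\<Phi>" by (rule schwartz_gauss_wave) simp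
    note I = wigner_kernel_identity_def[THEN iffD1, rule_format, OF _ schwartz_wave_packet schwartz_wave_packet \<Phi>']
    have "k' (\<lambda>(z, w). ?\<Phi> z * wigner ?f ?g w) = k (\<lambda>(z, w). ?\<Phi> z * wigner ?f ?g w)"
      by (rule trans[OF I[OF k'(2), symmetric] I[OF k(2)]])
    moreover have "(\<lambda>(z, w). ?\<Phi> z * wigner ?f ?g w) = (\<lambda>x. ?\<kappa> * ?E x)"
    proof
      fix x :: "('a \<times> 'a) \<times> ('a \<times> 'a)"
      obtain z x1 \<xi> where x: "x = (z, (x1, \<xi>))" by (metis surj_pair)
      have "exp (- (2 * pi) * (norm (z - t1))\<^sup>2) * exp (- 2 * pi * (norm ((x1, \<xi>) - (m, \<beta>)))\<^sup>2) = exp (- 2 * pi * (norm (x - t))\<^sup>2)"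
        unfolding exp_add[symmetric] x t by (simp add: norm_Pair algebra_simps)
      moreover have "cis (2 * pi * (y1 \<bullet> z)) * cis (2 * pi * ((p, q) \<bullet> (x1, \<xi>))) = cis (2 * pi * (y \<bullet> x))"
        unfolding cis_mult x y by (simp add: distrib_left)
      moreover have "?\<Phi> z * (?\<kappa> * (of_real (exp (- 2 * pi * (norm ((x1, \<xi>) - (m, \<beta>)))\<^sup>2)) * cis (2 * pi * ((p, q) \<bullet> (x1, \<xi>)))))
        = ?\<kappa> * (of_real (exp (- (2 * pi) * (norm (z - t1))\<^sup>2) * exp (- 2 * pi * (norm ((x1, \<xi>) - (m, \<beta>)))\<^sup>2)) *
            (cis (2 * pi * (y1 \<bullet> z)) * cis (2 * pi * ((p, q) \<bullet> (x1, \<xi>)))))"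
        unfolding of_real_mult by (simp only: mult_ac)
      ultimately show "(case x of (z, w) \<Rightarrow> ?\<Phi> z * wigner ?f ?g w) = ?\<kappa> * ?E x"
        unfolding x case_prod_conv wigner_wave_packet by simp
    qed
    ultimately have "?\<kappa> * k' ?E = ?\<kappa> * k ?E"
      using tempered_cmult[OF k(1) E, of ?\<kappa>] tempered_cmult[OF k'(1) E, of ?\<kappa>] by simp
    then show "k' ?E - k ?E = 0" by simp
  qed
  then show ?thesis by simp
qed

section \<open>Multipliers with geometrically bounded derivatives\<close>

text \<open>The remainder is estimated under the integral by
  \<open>norm (cis x - (1 + \<i> * x)) \<le> x^2 / 2\<close>, so the second moment of
  \<open>\<phi>\<close> bounds it quadratically in \<open>h\<close>.\<close>

lemma inv_fourier_has_derivative: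
  fixes \<phi> :: "'a::euclidean_space \<Rightarrow> complex"
  assumes \<phi>: "schwartz \<phi>"
  shows "(inv_fourier \<phi> has_derivative (\<lambda>h. inv_fourier (\<lambda>s. (2 * pi * \<i> * (s \<bullet> h)) * \<phi> s) r)) (at r)"
proof -
  let ?l = "\<lambda>h s. (2 * pi * \<i> * (s \<bullet> h)) * \<phi> s"
  have ls: "schwartz (?l h)" for h
    using schwartz_cmult[OF schwartz_mult_moderate[OF \<phi> moderate_inner[of h]], of "2 * pi * \<i>"]
    by (simp add: mult_ac)
  have s1: "schwartz (\<lambda>s. complex_of_real ((norm s)\<^sup>2) * \<phi> s)"
    using schwartz_mult_moderate[OF \<phi> moderate_norm_square] by (simp add: mult.commute)
  define M where "M = (LBINT s. norm (complex_of_real ((norm s)\<^sup>2) * \<phi> s))"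
  have lin: "bounded_linear (\<lambda>h. inv_fourier (?l h) r)"
  proof (rule linear_conv_bounded_linear[THEN iffD1], rule linearI)
    show "inv_fourier (?l (x + y)) r = inv_fourier (?l x) r + inv_fourier (?l y) r" for x y
      using inv_fourier_add[OF ls[of x] ls[of y], of r] by (simp add: inner_add_right algebra_simps)
    show "inv_fourier (?l (c *\<^sub>R x)) r = c *\<^sub>R inv_fourier (?l x) r" for c x
      using inv_fourier_cmult[of "of_real c" "?l x" r] by (simp add: scaleR_conv_of_real mult_ac)
  qed
  have est: "norm (inv_fourier \<phi> (r + h) - inv_fourier \<phi> r - inv_fourier (?l h) r) \<le> 2 * pi\<^sup>2 * M * (norm h)\<^sup>2" for h
  proof -
    let ?e = "\<lambda>r s. cis (2 * pi * (r \<bullet> s))"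
    have i1: "integrable lborel (\<lambda>s. \<phi> s * ?e r s)" for r
      by (rule integrable_mult_cis[OF schwartz_integrable[OF \<phi>]]) simp
    have i2: "integrable lborel (\<lambda>s. ?l h s * ?e r s)"
      by (rule integrable_mult_cis[OF schwartz_integrable[OF ls]]) simp
    have eq: "inv_fourier \<phi> (r + h) - inv_fourier \<phi> r - inv_fourier (?l h) r
        = (LBINT s. \<phi> s * ?e (r + h) s - \<phi> s * ?e r s - ?l h s * ?e r s)"
      unfolding inv_fourier_def using i1 i2 by (subst Bochner_Integration.integral_diff; simp)+
    have "norm (inv_fourier \<phi> (r + h) - inv_fourier \<phi> r - inv_fourier (?l h) r)
        \<le> (LBINT s. norm (complex_of_real ((norm s)\<^sup>2) * \<phi> s) * (2 * pi\<^sup>2 * (norm h)\<^sup>2))"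
      unfolding eq
    proof (rule order_trans[OF integral_norm_bound integral_mono'])
      show "integrable lborel (\<lambda>s. norm (complex_of_real ((norm s)\<^sup>2) * \<phi> s) * (2 * pi\<^sup>2 * (norm h)\<^sup>2))"
        by (intro integrable_mult_left integrable_norm schwartz_integrable s1)
      fix s :: 'a
      let ?x = "2 * pi * (h \<bullet> s)"
      have "\<phi> s * ?e (r + h) s - \<phi> s * ?e r s - ?l h s * ?e r s = \<phi> s * ?e r s * (cis ?x - (1 + \<i> * ?x))"
      proof -
        have "?e (r + h) s = ?e r s * cis ?x"
          unfolding cis_mult by (rule arg_cong[of _ _ cis]) (simp add: inner_add_left algebra_simps)
        then show ?thesis by (simp add: inner_commute algebra_simps)
      qed
      moreover have "norm (cis ?x - (1 + \<i> * ?x)) \<le> ?x\<^sup>2 / 2"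
        using iexp_approx1[of ?x 1] by (simp add: cis_conv_exp numeral_2_eq_2 power2_eq_square)
      moreover have "?x\<^sup>2 / 2 \<le> 2 * pi\<^sup>2 * ((norm h)\<^sup>2 * (norm s)\<^sup>2)"
      proof -
        have "(h \<bullet> s)\<^sup>2 \<le> (norm h * norm s)\<^sup>2"
          using Cauchy_Schwarz_ineq2[of h s] by (metis abs_ge_zero power2_abs power_mono)
        then have "2 * pi\<^sup>2 * (h \<bullet> s)\<^sup>2 \<le> 2 * pi\<^sup>2 * (norm h * norm s)\<^sup>2" by (intro mult_left_mono) auto
        then show ?thesis by (simp add: power_mult_distrib)
      qed
      ultimately have "norm (\<phi> s * ?e (r + h) s - \<phi> s * ?e r s - ?l h s * ?e r s)
          \<le> norm (\<phi> s) * (2 * pi\<^sup>2 * ((norm h)\<^sup>2 * (norm s)\<^sup>2))"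
        by (simp add: norm_mult mult_left_mono)
      then show "norm (\<phi> s * ?e (r + h) s - \<phi> s * ?e r s - ?l h s * ?e r s)
          \<le> norm (complex_of_real ((norm s)\<^sup>2) * \<phi> s) * (2 * pi\<^sup>2 * (norm h)\<^sup>2)"
        by (simp add: norm_mult norm_power mult_ac)
    qed simp
    also have "\<dots> = M * (2 * pi\<^sup>2 * (norm h)\<^sup>2)"
      by (simp only: integral_mult_left_zero M_def)
    finally show ?thesis by (simp only: mult_ac)
  qed
  have quot: "norm (inv_fourier \<phi> y - inv_fourier \<phi> r - inv_fourier (?l (y - r)) r) / norm (y - r)
      \<le> 2 * pi\<^sup>2 * M * norm (y - r)" if "y \<noteq> r" for y
  proof -
    have "0 < norm (y - r)" using that by simp
    then show ?thesis
      using est[of "y - r"] by (simp add: divide_le_eq power2_eq_square mult_ac)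
  qed
  have "((\<lambda>y. 2 * pi\<^sup>2 * M * norm (y - r)) \<longlongrightarrow> 0) (at r)"
    by (auto intro!: tendsto_eq_intros)
  from has_derivativeI_sandwich[OF zero_less_one lin quot this]
  show ?thesis .
qed

text \<open>The hypothesis on \<open>\<sigma>\<close> is the case \<open>A = K = C\<close>. Keeping
  the two constants apart lets products, dilations and derivatives remain in the scale, with the
  rate \<open>K\<close> under control.\<close>

definition geom_bounded :: "real \<Rightarrow> real \<Rightarrow> ('a::euclidean_space \<Rightarrow> complex) \<Rightarrow> bool" where
  "geom_bounded A K m \<longleftrightarrow> smooth m \<and> (\<forall>bs x. set bs \<subseteq> Basis \<longrightarrow> norm (iter_partial bs m x) \<le> A * K ^ length bs)"

lemma geom_boundedD:
  assumes "geom_bounded A K m"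
  shows "smooth m" "set bs \<subseteq> Basis \<Longrightarrow> norm (iter_partial bs m x) \<le> A * K ^ length bs" "norm (m x) \<le> A" "0 \<le> A"
proof -
  show "smooth m" and *: "set bs \<subseteq> Basis \<Longrightarrow> norm (iter_partial bs m x) \<le> A * K ^ length bs" for bs x
    using assms by (auto simp: geom_bounded_def)
  from *[of "[]"] show "norm (m x) \<le> A" for x by simp
  then show "0 \<le> A" using norm_ge_zero order_trans by blast
qed

lemma geom_bounded_partial:
  assumes m: "geom_bounded A K m" and b: "b \<in> Basis"
  shows "geom_bounded (A * K) K (partial b m)"
  unfolding geom_bounded_def
proof (intro conjI allI impI)
  show "smooth (partial b m)" using m b by (simp add: geom_bounded_def smooth_partial)
  fix bs x assume "set bs \<subseteq> (Basis :: 'a set)"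
  then have "set (bs @ [b]) \<subseteq> Basis" using b by simp
  from geom_boundedD(2)[OF m this, of x] show "norm (iter_partial bs (partial b m) x) \<le> A * K * K ^ length bs"
    by (simp add: iter_partial_snoc mult.assoc)
qed

text \<open>A derivative of a product has two terms, each with one factor \<open>K\<close>; hence
  the rate doubles while the amplitudes multiply.\<close>

lemma geom_bounded_mult:
  assumes "geom_bounded A K f" "geom_bounded B K g"
  shows "geom_bounded (A * B) (2 * K) (\<lambda>x. f x * g x)"
proof -
  have "norm (iter_partial bs (\<lambda>x. f x * g x) x) \<le> A * B * (2 * K) ^ length bs"
    if "set bs \<subseteq> Basis" "geom_bounded A K f" "geom_bounded B K g" for bs x A B f and g :: "'a \<Rightarrow> complex"
    using that
  proof (induction bs arbitrary: A B f g rule: rev_induct)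
    case Nil
    then show ?case
      using mult_mono[OF geom_boundedD(3)[OF Nil(2), of x] geom_boundedD(3)[OF Nil(3), of x] geom_boundedD(4)[OF Nil(2)]]
      by (simp add: norm_mult)
  next
    case (snoc b bs)
    then have b: "b \<in> Basis" and bs: "set bs \<subseteq> Basis" by auto
    note f = snoc.prems(2) and g = snoc.prems(3)
    have "partial b (\<lambda>x. f x * g x) = (\<lambda>x. partial b f x * g x + f x * partial b g x)"
      using f g by (auto intro!: partial_mult smooth_differentiable geom_boundedD)
    then have "iter_partial (bs @ [b]) (\<lambda>x. f x * g x) x
        = iter_partial bs (\<lambda>x. partial b f x * g x) x + iter_partial bs (\<lambda>x. f x * partial b g x) x"
      using geom_boundedD(1)[OF f] geom_boundedD(1)[OF g] b
      by (simp add: iter_partial_snoc iter_partial_add[OF _ _ bs] smooth_mult smooth_partial)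
    also have "norm \<dots> \<le> A * K * B * (2 * K) ^ length bs + A * (B * K) * (2 * K) ^ length bs"
      by (intro order_trans[OF norm_triangle_ineq] add_mono snoc.IH bs f g geom_bounded_partial b)
    also have "\<dots> = A * B * (2 * K) ^ length (bs @ [b])" by (simp add: algebra_simps)
    finally show ?case .
  qed
  then show ?thesis
    using assms by (auto simp: geom_bounded_def smooth_mult)
qed

lemma geom_bounded_scale:
  assumes "geom_bounded A K f" "s \<noteq> 0"
  shows "geom_bounded A (\<bar>s\<bar> * K) (\<lambda>x. f (s *\<^sub>R x + c))"
  unfolding geom_bounded_def
proof (intro conjI allI impI)
  show "smooth (\<lambda>x. f (s *\<^sub>R x + c))"
    by (rule smooth_affine[where s=s]) (auto intro: geom_boundedD(1)[OF assms(1)] linear_scale_self)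
  fix bs x assume bs: "set bs \<subseteq> (Basis :: 'a set)"
  have "norm (iter_partial bs (\<lambda>x. f (s *\<^sub>R x + c)) x) = \<bar>s\<bar> ^ length bs * norm (iter_partial bs f (s *\<^sub>R x + c))"
    by (simp add: iter_partial_scale[OF geom_boundedD(1)[OF assms(1)] bs] power_abs)
  also have "\<dots> \<le> \<bar>s\<bar> ^ length bs * (A * K ^ length bs)"
    by (intro mult_left_mono geom_boundedD(2)[OF assms(1) bs]) simp
  finally show "norm (iter_partial bs (\<lambda>x. f (s *\<^sub>R x + c)) x) \<le> A * (\<bar>s\<bar> * K) ^ length bs"
    by (simp add: power_mult_distrib mult_ac)
qed

lemma geom_bounded_cnj: "geom_bounded A K f \<Longrightarrow> geom_bounded A K (\<lambda>x. cnj (f x))"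
  by (auto simp: geom_bounded_def smooth_cnj iter_partial_cnj)

text \<open>The arguments \<open>\<xi> + r/2\<close> and \<open>\<xi> - r/2\<close> halve the rate
  of each factor, which exactly compensates the doubling in the product. The rate of
  \<open>b\<close> in \<open>r\<close> is therefore again \<open>C\<close>, uniformly in
  \<open>\<xi>\<close>.\<close>

lemma geom_bounded_b_symbol:
  assumes "geom_bounded C C \<sigma>"
  shows "geom_bounded (C * C) C (b_symbol \<sigma> \<xi>)"
proof -
  have "geom_bounded (C * C) (2 * (1 / 2 * C)) (\<lambda>r. \<sigma> ((1 / 2) *\<^sub>R r + \<xi>) * cnj (\<sigma> ((- 1 / 2) *\<^sub>R r + \<xi>)))"
    using geom_bounded_scale[OF assms, of "1 / 2" \<xi>] geom_bounded_cnj[OF geom_bounded_scale[OF assms, of "- 1 / 2" \<xi>]]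
    by (intro geom_bounded_mult) auto
  moreover have "b_symbol \<sigma> \<xi> = (\<lambda>r. \<sigma> ((1 / 2) *\<^sub>R r + \<xi>) * cnj (\<sigma> ((- 1 / 2) *\<^sub>R r + \<xi>)))"
    by (auto simp: b_symbol_def add.commute)
  ultimately show ?thesis by simp
qed

section \<open>Integration by parts against multipliers with geometrically bounded
  derivatives\<close>

lemma integrable_geom_bounded_mult:
  assumes m: "geom_bounded A K m" and h: "integrable lborel h"
  shows "integrable lborel (\<lambda>x. m x * h x)"
proof (rule Bochner_Integration.integrable_bound)
  show "integrable lborel (\<lambda>x. A * norm (h x))" using h by (intro integrable_mult_right integrable_norm)
  show "(\<lambda>x. m x * h x) \<in> borel_measurable lborel"
    using borel_measurable_smooth[OF geom_boundedD(1)[OF m]] h by measurable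
  show "AE x in lborel. norm (m x * h x) \<le> norm (A * norm (h x))"
    using geom_boundedD(3)[OF m] geom_boundedD(4)[OF m] by (auto simp: norm_mult intro!: mult_right_mono)
qed

text \<open>Under the inverse transform, multiplication by
  \<open>2 * pi * \<i> * (s \<bullet> b)\<close> is differentiation. Integration by parts moves the
  derivative to \<open>m\<close>, and the sign turns \<open>1 / (2 * pi * \<i>)\<close> into
  \<open>\<i> / (2 * pi)\<close>.\<close>

lemma integral_mult_inv_fourier_inner:
  fixes \<phi> :: "'a::euclidean_space \<Rightarrow> complex"
  assumes m: "geom_bounded A K m" and \<phi>: "schwartz \<phi>" and b: "b \<in> Basis"
  shows "(LBINT r. m r * inv_fourier (\<lambda>s. of_real (s \<bullet> b) * \<phi> s) r)
    = (\<i> / (2 * pi)) * (LBINT r. partial b m r * inv_fourier \<phi> r)"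
proof -
  let ?H = "inv_fourier \<phi>" and ?\<phi> = "\<lambda>s. of_real (s \<bullet> b) * \<phi> s"
  have s: "schwartz ?\<phi>"
    using schwartz_mult_moderate[OF \<phi> moderate_inner[of b]] by (simp add: mult.commute)
  have dH: "?H differentiable at r" for r
    by (rule differentiableI[OF inv_fourier_has_derivative[OF \<phi>]])
  have dm: "m differentiable at r" for r
    by (rule smooth_differentiable[OF geom_boundedD(1)[OF m]])
  have pH: "partial b ?H r = (2 * pi * \<i>) * inv_fourier ?\<phi> r" for r
    using partial_has_derivative[OF inv_fourier_has_derivative[OF \<phi>], of b] inv_fourier_cmult[of "2 * pi * \<i>" ?\<phi> r]
    by (simp add: mult.assoc)
  have pm: "partial b (\<lambda>r. m r * ?H r) = (\<lambda>r. partial b m r * ?H r + (2 * pi * \<i>) * (m r * inv_fourier ?\<phi> r))"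
    by (rule ext, subst partial_mult[OF dm dH]) (simp add: pH mult_ac)
  have i1: "integrable lborel (\<lambda>r. partial b m r * ?H r)"
    by (rule integrable_geom_bounded_mult[OF geom_bounded_partial[OF m b] schwartz_inv_fourier_integrable[OF \<phi>]])
  have i2: "integrable lborel (\<lambda>r. m r * inv_fourier ?\<phi> r)"
    by (rule integrable_geom_bounded_mult[OF m schwartz_inv_fourier_integrable[OF s]])
  have cH: "continuous_on UNIV (inv_fourier \<psi>)" if "schwartz \<psi>" for \<psi> :: "'a \<Rightarrow> complex"
    using inv_fourier_has_derivative[OF that] has_derivative_continuous
    by (intro continuous_at_imp_continuous_on) blast
  have "(LBINT r. partial b (\<lambda>r. m r * ?H r) r) = 0"
  proof (rule integral_partial_eq_0)
    show "integrable lborel (\<lambda>r. m r * ?H r)"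
      by (rule integrable_geom_bounded_mult[OF m schwartz_inv_fourier_integrable[OF \<phi>]])
    show "integrable lborel (partial b (\<lambda>r. m r * ?H r))"
      unfolding pm by (intro Bochner_Integration.integrable_add integrable_mult_right i1 i2)
    show "(\<lambda>r. m r * ?H r) differentiable at x" for x by (intro differentiable_mult dm dH)
    show "continuous_on UNIV (partial b (\<lambda>r. m r * ?H r))"
      unfolding pm
      by (intro continuous_intros cH \<phi> s smooth_continuous_on geom_boundedD(1)[OF m]
          geom_boundedD(1)[OF geom_bounded_partial[OF m b]])
  qed
  then have "(LBINT r. partial b m r * ?H r) + (2 * pi * \<i>) * (LBINT r. m r * inv_fourier ?\<phi> r) = 0"
    unfolding pm using i1 i2 by simp
  then have "(LBINT r. partial b m r * ?H r) = - (2 * pi * \<i>) * (LBINT r. m r * inv_fourier ?\<phi> r)"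
    by (simp add: add_eq_0_iff)
  then show ?thesis by (simp add: field_simps)
qed

text \<open>One factor \<open>(norm s)^2\<close> is a sum of \<open>DIM('a)\<close> squares. Each
  square means two integrations by parts, with gain \<open>1 / (4 * pi^2)\<close> and cost
  \<open>K^2\<close>, whence the ratio. Induction on \<open>k\<close> is over all \<open>m\<close>,
  since \<open>m\<close> is replaced by its second derivatives.\<close>

lemma integral_mult_inv_fourier_norm_power:
  fixes \<phi> :: "'a::euclidean_space \<Rightarrow> complex" and A K :: real
  assumes "geom_bounded A K m" and \<phi>: "schwartz \<phi>"
  shows "norm (LBINT r. m r * inv_fourier (\<lambda>s. of_real ((norm s)\<^sup>2) ^ k * \<phi> s) r)
    \<le> A * (DIM('a) * K\<^sup>2 / (4 * pi\<^sup>2)) ^ k * (LBINT r. norm (inv_fourier \<phi> r))"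
  using assms(1)
proof (induction k arbitrary: A m)
  case 0
  note m = this
  have "norm (LBINT r. m r * inv_fourier \<phi> r) \<le> (LBINT r. A * norm (inv_fourier \<phi> r))"
    by (rule order_trans[OF integral_norm_bound integral_mono'])
      (use geom_boundedD(3,4)[OF m] schwartz_inv_fourier_integrable[OF \<phi>] in \<open>auto simp: norm_mult intro!: mult_right_mono\<close>)
  then show ?case by simp
next
  case (Suc k)
  note m = Suc.prems
  let ?\<psi> = "\<lambda>s. of_real ((norm s)\<^sup>2) ^ k * \<phi> s"
  have \<psi>: "schwartz ?\<psi>"
    using schwartz_mult_moderate[OF \<phi> moderate_power[OF moderate_norm_square, of k]] by (simp add: mult.commute)
  have s1: "schwartz (\<lambda>s. of_real (s \<bullet> b) * ?\<psi> s)" and s2: "schwartz (\<lambda>s. of_real (s \<bullet> b) * (of_real (s \<bullet> b) * ?\<psi> s))" for b :: 'a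
    using schwartz_mult_moderate[OF \<psi> moderate_inner[of b]]
      schwartz_mult_moderate[OF schwartz_mult_moderate[OF \<psi> moderate_inner[of b]] moderate_inner[of b]]
    by (simp_all add: mult_ac)
  have "(\<lambda>s. of_real ((norm s)\<^sup>2) ^ Suc k * \<phi> s) = (\<lambda>s. \<Sum>b\<in>Basis. of_real (s \<bullet> b) * (of_real (s \<bullet> b) * ?\<psi> s))"
  proof
    fix s :: 'a
    have "complex_of_real ((norm s)\<^sup>2) = (\<Sum>b\<in>Basis. of_real (s \<bullet> b) * of_real (s \<bullet> b))"
      unfolding power2_norm_eq_inner by (subst euclidean_inner) simp
    then show "of_real ((norm s)\<^sup>2) ^ Suc k * \<phi> s = (\<Sum>b\<in>Basis. of_real (s \<bullet> b) * (of_real (s \<bullet> b) * ?\<psi> s))"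
      by (simp only: power_Suc sum_distrib_right mult.assoc)
  qed
  moreover have "inv_fourier (\<lambda>s. \<Sum>b\<in>I. of_real (s \<bullet> b) * (of_real (s \<bullet> b) * ?\<psi> s)) r
      = (\<Sum>b\<in>I. inv_fourier (\<lambda>s. of_real (s \<bullet> b) * (of_real (s \<bullet> b) * ?\<psi> s)) r)" if "finite I" for r and I :: "'a set"
    using that
  proof (induction I rule: finite_induct)
    case empty
    then show ?case by (simp add: inv_fourier_def)
  next
    case (insert b I)
    then show ?case using inv_fourier_add[OF s2[of b] schwartz_sum[OF insert(1) s2]] by simp
  qed
  ultimately have "(LBINT r. m r * inv_fourier (\<lambda>s. of_real ((norm s)\<^sup>2) ^ Suc k * \<phi> s) r)
      = (LBINT r. (\<Sum>b\<in>Basis. m r * inv_fourier (\<lambda>s. of_real (s \<bullet> b) * (of_real (s \<bullet> b) * ?\<psi> s)) r))"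
    by (simp add: sum_distrib_left)
  also have "(LBINT r. (\<Sum>b\<in>Basis. m r * inv_fourier (\<lambda>s. of_real (s \<bullet> b) * (of_real (s \<bullet> b) * ?\<psi> s)) r))
      = (\<Sum>b\<in>Basis. (LBINT r. m r * inv_fourier (\<lambda>s. of_real (s \<bullet> b) * (of_real (s \<bullet> b) * ?\<psi> s)) r))"
    by (rule Bochner_Integration.integral_sum)
      (rule integrable_geom_bounded_mult[OF m schwartz_inv_fourier_integrable[OF s2]])
  also have "\<dots> = (\<Sum>b\<in>Basis. (\<i> / (2 * pi)) * ((\<i> / (2 * pi)) * (LBINT r. partial b (partial b m) r * inv_fourier ?\<psi> r)))"
    by (intro sum.cong refl)
      (simp only: integral_mult_inv_fourier_inner[OF m s1] integral_mult_inv_fourier_inner[OF geom_bounded_partial[OF m] \<psi>])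
  finally have eq: "(LBINT r. m r * inv_fourier (\<lambda>s. of_real ((norm s)\<^sup>2) ^ Suc k * \<phi> s) r)
      = (\<Sum>b\<in>Basis. (\<i> / (2 * pi)) * ((\<i> / (2 * pi)) * (LBINT r. partial b (partial b m) r * inv_fourier ?\<psi> r)))" .
  have "norm (LBINT r. m r * inv_fourier (\<lambda>s. of_real ((norm s)\<^sup>2) ^ Suc k * \<phi> s) r)
      \<le> (\<Sum>b\<in>(Basis :: 'a set). 1 / (4 * pi\<^sup>2) * (A * K * K * (DIM('a) * K\<^sup>2 / (4 * pi\<^sup>2)) ^ k * (LBINT r. norm (inv_fourier \<phi> r))))"
    unfolding eq
  proof (rule sum_norm_le)
    fix b :: 'a assume b: "b \<in> Basis"
    have "norm ((\<i> / (2 * pi)) * ((\<i> / (2 * pi)) * (LBINT r. partial b (partial b m) r * inv_fourier ?\<psi> r)))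
        = 1 / (4 * pi\<^sup>2) * norm (LBINT r. partial b (partial b m) r * inv_fourier ?\<psi> r)"
      by (simp add: norm_mult norm_divide power2_eq_square)
    also have "\<dots> \<le> 1 / (4 * pi\<^sup>2) * (A * K * K * (DIM('a) * K\<^sup>2 / (4 * pi\<^sup>2)) ^ k * (LBINT r. norm (inv_fourier \<phi> r)))"
      by (intro mult_left_mono Suc.IH geom_bounded_partial m b) simp
    finally show "norm ((\<i> / (2 * pi)) * ((\<i> / (2 * pi)) * (LBINT r. partial b (partial b m) r * inv_fourier ?\<psi> r)))
      \<le> 1 / (4 * pi\<^sup>2) * (A * K * K * (DIM('a) * K\<^sup>2 / (4 * pi\<^sup>2)) ^ k * (LBINT r. norm (inv_fourier \<phi> r)))" .
  qed
  also have "\<dots> = A * (DIM('a) * K\<^sup>2 / (4 * pi\<^sup>2)) ^ Suc k * (LBINT r. norm (inv_fourier \<phi> r))"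
    by (simp add: power2_eq_square)
  finally show ?case .
qed

section \<open>The support of the kernel\<close>

text \<open>Any compact set outside the ball may witness the vanishing, not just the support itself.
  This makes stability under derivatives and under smooth factors immediate.\<close>

definition exterior_test :: "real \<Rightarrow> ('a::euclidean_space \<Rightarrow> complex) \<Rightarrow> bool" where
  "exterior_test T \<phi> \<longleftrightarrow> smooth \<phi> \<and> (\<exists>S. compact S \<and> (\<forall>x\<in>S. T < norm x) \<and> (\<forall>x. x \<notin> S \<longrightarrow> \<phi> x = 0))"

lemma partial_eq_0_outside:
  assumes "open U" "x \<in> U" "\<And>y. y \<in> U \<Longrightarrow> f y = 0"
  shows "(f has_derivative (\<lambda>h. 0)) (at x)" "partial b f x = 0"
proof -
  show d: "(f has_derivative (\<lambda>h. 0)) (at x)"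
    by (rule has_derivative_transform_within_open[OF has_derivative_const[of 0] assms(1,2)]) (simp add: assms(3))
  show "partial b f x = 0" using partial_has_derivative[OF d] by simp
qed

lemma smooth_const_inner: "smooth (\<lambda>x :: 'a::euclidean_space. c * complex_of_real (x \<bullet> b))"
  by (intro smooth_cmult moderate_smooth moderate_inner)

lemma exterior_test_partial:
  assumes "exterior_test T \<phi>" "b \<in> Basis"
  shows "exterior_test T (partial b \<phi>)"
proof -
  obtain S where S: "smooth \<phi>" "compact S" "\<forall>x\<in>S. T < norm x" "\<And>x. x \<notin> S \<Longrightarrow> \<phi> x = 0"
    using assms(1) unfolding exterior_test_def by blast
  have "open (- S)" using compact_imp_closed[OF S(2)] by (simp add: open_Compl)
  from partial_eq_0_outside(2)[OF this, of _ \<phi>] S have "partial b \<phi> x = 0" if "x \<notin> S" for x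
    using that by auto
  then show ?thesis
    using S assms(2) unfolding exterior_test_def by (auto simp: smooth_partial)
qed

lemma exterior_test_mult:
  assumes "exterior_test T \<phi>" "smooth g"
  shows "exterior_test T (\<lambda>x. g x * \<phi> x)"
  using assms unfolding exterior_test_def by (auto simp: smooth_mult)

lemma exterior_test_schwartz_bound:
  assumes "exterior_test T \<phi>"
  shows "\<exists>K. \<forall>x. (1 + norm x) ^ N * norm (\<phi> x) \<le> K"
proof -
  obtain S where S: "smooth \<phi>" "compact S" "\<And>x. x \<notin> S \<Longrightarrow> \<phi> x = 0"
    using assms(1) unfolding exterior_test_def by blast
  have "compact ((\<lambda>x. (1 + norm x) ^ N * norm (\<phi> x)) ` S)"
    by (intro compact_continuous_image S continuous_intros smooth_continuous_on)
  from compact_imp_bounded[OF this]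
  obtain K where "\<forall>y\<in>(\<lambda>x. (1 + norm x) ^ N * norm (\<phi> x)) ` S. norm y \<le> K"
    unfolding bounded_iff by blast
  then have K: "\<bar>(1 + norm x) ^ N * norm (\<phi> x)\<bar> \<le> K" if "x \<in> S" for x
    using that by simp
  have "(1 + norm x) ^ N * norm (\<phi> x) \<le> \<bar>K\<bar>" for x
    using K[of x] S(3)[of x] by (cases "x \<in> S") auto
  then show ?thesis by blast
qed

lemma has_derivative_inverse_inner_power:
  assumes "x \<noteq> 0"
  shows "((\<lambda>x :: 'a::euclidean_space. complex_of_real (inverse (x \<bullet> x) ^ k)) has_derivative
    (\<lambda>h. of_real (- (2 * real k * (x \<bullet> h)) * inverse (x \<bullet> x) ^ Suc k))) (at x)"
proof (rule has_derivative_of_real)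
  have i: "((\<lambda>x. inverse (x \<bullet> x)) has_derivative (\<lambda>h. - (inverse (x \<bullet> x) * (x \<bullet> h + h \<bullet> x) * inverse (x \<bullet> x)))) (at x)"
    by (rule Deriv.has_derivative_inverse) (use assms in \<open>auto intro!: derivative_eq_intros\<close>)
  show "((\<lambda>x. inverse (x \<bullet> x) ^ k) has_derivative (\<lambda>h. - (2 * real k * (x \<bullet> h)) * inverse (x \<bullet> x) ^ Suc k)) (at x)"
    by (rule has_derivative_eq_rhs[OF has_derivative_power[OF i]])
      (cases k; auto simp: fun_eq_iff inner_commute algebra_simps)
qed

context
  fixes T :: real
  assumes T: "T > 0"
begin

text \<open>The quotient of \<open>\<phi>\<close> by \<open>(norm x)^(2k)\<close>. At the origin
  \<open>inverse 0 = 0\<close>, which is harmless: \<open>T > 0\<close> forces the test functions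
  considered here to vanish in a neighbourhood of it.\<close>

abbreviation divide_norm :: "nat \<Rightarrow> ('a::euclidean_space \<Rightarrow> complex) \<Rightarrow> 'a \<Rightarrow> complex" where
  "divide_norm k \<phi> \<equiv> \<lambda>x. \<phi> x * of_real (inverse (x \<bullet> x) ^ k)"

lemma exterior_test_divide:
  fixes \<phi> :: "'a::euclidean_space \<Rightarrow> complex"
  assumes \<phi>: "exterior_test T \<phi>"
  shows "(divide_norm k \<phi>) differentiable at x"
    and "partial b (divide_norm k \<phi>) x =
      partial b \<phi> x * of_real (inverse (x \<bullet> x) ^ k) +
      (of_real (- 2 * real k) * of_real (x \<bullet> b)) * \<phi> x * of_real (inverse (x \<bullet> x) ^ Suc k)"
proof -
  let ?q = "\<lambda>x :: 'a. complex_of_real (inverse (x \<bullet> x) ^ k)"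
  obtain S where S: "smooth \<phi>" "compact S" "\<And>x. x \<in> S \<Longrightarrow> T < norm x" "\<And>x. x \<notin> S \<Longrightarrow> \<phi> x = 0"
    using \<phi> unfolding exterior_test_def by blast
  have "(\<lambda>x. \<phi> x * ?q x) differentiable at x \<and> partial b (\<lambda>x. \<phi> x * ?q x) x =
      partial b \<phi> x * of_real (inverse (x \<bullet> x) ^ k) +
      (of_real (- 2 * real k) * of_real (x \<bullet> b)) * \<phi> x * of_real (inverse (x \<bullet> x) ^ Suc k)"
  proof (cases "x = 0")
    case True
    have 0: "open (- S)" "x \<in> - S" "\<And>y. y \<in> - S \<Longrightarrow> \<phi> y = 0"
      using compact_imp_closed[OF S(2)] S(3)[of x] S(4) True T by (auto simp: open_Compl)
    have "(\<lambda>x. \<phi> x * ?q x) differentiable at x" "partial b (\<lambda>x. \<phi> x * ?q x) x = 0"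
      using partial_eq_0_outside[OF 0(1,2), of "\<lambda>x. \<phi> x * ?q x"] 0(3) by (auto simp: differentiable_def)
    moreover have "partial b \<phi> x = 0" by (rule partial_eq_0_outside(2)[OF 0])
    ultimately show ?thesis using 0(2,3) by simp
  next
    case False
    note d = smooth_differentiable[OF S(1), of x] differentiableI[OF has_derivative_inverse_inner_power[OF False, of k]]
    have "partial b (\<lambda>x. \<phi> x * ?q x) x = partial b \<phi> x * ?q x + \<phi> x * of_real (- (2 * real k * (x \<bullet> b)) * inverse (x \<bullet> x) ^ Suc k)"
      by (subst partial_mult[OF d], subst partial_has_derivative[OF has_derivative_inverse_inner_power[OF False]]) simp
    then show ?thesis using differentiable_mult[OF d] by (simp add: mult_ac)
  qed
  then show "(\<lambda>x. \<phi> x * ?q x) differentiable at x"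
    "partial b (\<lambda>x. \<phi> x * ?q x) x = partial b \<phi> x * of_real (inverse (x \<bullet> x) ^ k) +
      (of_real (- 2 * real k) * of_real (x \<bullet> b)) * \<phi> x * of_real (inverse (x \<bullet> x) ^ Suc k)"
    by auto
qed

lemma exterior_test_divide_norm:
  fixes \<phi> :: "'a::euclidean_space \<Rightarrow> complex"
  assumes \<phi>: "exterior_test T \<phi>"
  shows "norm (\<phi> x * of_real (inverse (x \<bullet> x) ^ k)) \<le> inverse (T\<^sup>2) ^ k * norm (\<phi> x)"
proof (cases "\<phi> x = 0")
  case False
  then have "T < norm x" using \<phi> unfolding exterior_test_def by metis
  then have "T\<^sup>2 \<le> x \<bullet> x" unfolding power2_norm_eq_inner[symmetric] using T by (intro power_mono) auto
  then have "inverse (x \<bullet> x) ^ k \<le> inverse (T\<^sup>2) ^ k"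
    using T by (intro power_mono le_imp_inverse_le) auto
  then show ?thesis
    unfolding norm_mult norm_of_real by (simp add: mult.commute mult_left_mono)
qed simp

lemma schwartz_exterior_test_divide:
  fixes \<phi> :: "'a::euclidean_space \<Rightarrow> complex"
  assumes \<phi>: "exterior_test T \<phi>"
  shows "schwartz (divide_norm k \<phi>)"
proof (rule schwartz_coinduct)
  let ?P = "\<lambda>h. \<exists>k \<phi>. exterior_test T \<phi> \<and> h = (divide_norm k \<phi>)"
  have P: "sum_closure ?P (divide_norm k \<phi>)" if "exterior_test T \<phi>" for \<phi> k
    by (rule sum_closure.base) (use that in blast)
  show "sum_closure ?P (divide_norm k \<phi>)" by (rule P[OF \<phi>])
  fix h assume "?P h"
  then obtain k \<phi> where \<phi>: "exterior_test T \<phi>" and h: "h = (divide_norm k \<phi>)" by blast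
  show "h differentiable at x" for x unfolding h by (rule exterior_test_divide[OF \<phi>])
  show "sum_closure ?P (partial b h)" if b: "b \<in> Basis" for b
    unfolding h exterior_test_divide(2)[OF \<phi>, abs_def]
    by (intro sum_closure.add P exterior_test_partial exterior_test_mult \<phi> b smooth_const_inner)
  fix N
  obtain K where K: "\<And>x. (1 + norm x) ^ N * norm (\<phi> x) \<le> K"
    using exterior_test_schwartz_bound[OF \<phi>] by blast
  have "(1 + norm x) ^ N * norm (h x) \<le> inverse (T\<^sup>2) ^ k * K" for x
  proof -
    have "(1 + norm x) ^ N * norm (h x) \<le> (1 + norm x) ^ N * (inverse (T\<^sup>2) ^ k * norm (\<phi> x))"
      unfolding h by (intro mult_left_mono exterior_test_divide_norm \<phi>) simp
    also have "\<dots> = inverse (T\<^sup>2) ^ k * ((1 + norm x) ^ N * norm (\<phi> x))" by (simp only: mult_ac)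
    also have "\<dots> \<le> inverse (T\<^sup>2) ^ k * K" by (intro mult_left_mono K) simp
    finally show ?thesis .
  qed
  then show "\<exists>K. \<forall>x. (1 + norm x) ^ N * norm (h x) \<le> K" by blast
qed

text \<open>Differentiating the quotient either hits \<open>\<phi>\<close> or costs a factor
  \<open>k\<close> and raises \<open>k\<close> by one. A fixed number of derivatives thus costs only
  a polynomial in \<open>k\<close> beside the geometric gain. The constant precedes
  \<open>k\<close>, so the inductive bound may be applied at \<open>Suc k\<close>.\<close>

lemma exterior_test_divide_iter_partial:
  fixes \<phi> :: "'a::euclidean_space \<Rightarrow> complex"
  assumes "set bs \<subseteq> Basis" "exterior_test T \<phi>"
  shows "\<exists>K\<ge>0. \<forall>k x. norm (iter_partial bs (divide_norm k \<phi>) x)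
    \<le> K * (1 + real k) ^ length bs * inverse (T\<^sup>2) ^ k * decay x"
  using assms
proof (induction bs arbitrary: \<phi> rule: rev_induct)
  case Nil
  \<comment> \<open>The case \<open>k = 0\<close> of the preceding lemma says that
    \<open>\<phi>\<close> itself is Schwartz.\<close>
  obtain K where K: "K > 0" "\<And>x. norm (\<phi> x) \<le> K / (1 + norm x) ^ (2 * DIM('a))"
    using schwartz_decay[OF schwartz_exterior_test_divide[OF Nil(2), of 0]] by (metis (no_types, lifting) mult.right_neutral of_real_1 power_0 ext)
  have "norm (\<phi> x * of_real (inverse (x \<bullet> x) ^ k)) \<le> K * inverse (T\<^sup>2) ^ k * decay x" for k x
  proof -
    have "inverse (T\<^sup>2) ^ k * norm (\<phi> x) \<le> inverse (T\<^sup>2) ^ k * (K * decay x)"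
      using K(2)[of x] by (intro mult_left_mono) (auto simp: decay_def)
    with exterior_test_divide_norm[OF Nil(2), of x k] show ?thesis by (simp only: mult_ac)
  qed
  then show ?case using K(1) by (intro exI[of _ K]) auto
next
  case (snoc b bs)
  then have b: "b \<in> Basis" and bs: "set bs \<subseteq> Basis" by auto
  note \<phi> = snoc.prems(2)
  let ?q = "\<lambda>k x :: 'a. complex_of_real (inverse (x \<bullet> x) ^ k)"
  let ?\<psi> = "\<lambda>x. (- 2 * of_real (x \<bullet> b)) * \<phi> x"
  have \<psi>: "exterior_test T ?\<psi>"
    by (intro exterior_test_mult \<phi> smooth_const_inner)
  obtain K1 where 1: "K1 \<ge> 0" "\<And>k x. norm (iter_partial bs (\<lambda>x. partial b \<phi> x * ?q k x) x)
      \<le> K1 * (1 + real k) ^ length bs * inverse (T\<^sup>2) ^ k * decay x"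
    using snoc.IH[OF bs exterior_test_partial[OF \<phi> b]] by blast
  obtain K2 where 2: "K2 \<ge> 0" "\<And>k x. norm (iter_partial bs (\<lambda>x. ?\<psi> x * ?q k x) x)
      \<le> K2 * (1 + real k) ^ length bs * inverse (T\<^sup>2) ^ k * decay x"
    using snoc.IH[OF bs \<psi>] by blast
  \<comment> \<open>The second term is evaluated at \<open>Suc k\<close>: it yields one more
    \<open>inverse (T^2)\<close> and, by \<open>1 + Suc k \<le> 2 * (1 + k)\<close>, the power of
    2.\<close>
  define K where "K = K1 + 2 ^ length bs * K2 * inverse (T\<^sup>2)"
  have "norm (iter_partial (bs @ [b]) (\<lambda>x. \<phi> x * ?q k x) x)
      \<le> K * (1 + real k) ^ length (bs @ [b]) * inverse (T\<^sup>2) ^ k * decay x" for k x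
  proof -
    let ?n = "length bs" and ?D = "inverse (T\<^sup>2) ^ k * decay x"
    have D0: "0 \<le> ?D" by simp
    have "partial b (\<lambda>x. \<phi> x * ?q k x) = (\<lambda>x. partial b \<phi> x * ?q k x + of_nat k * (?\<psi> x * ?q (Suc k) x))"
      by (rule ext, subst exterior_test_divide(2)[OF \<phi>]) simp
    moreover have sm: "smooth (\<lambda>x. partial b \<phi> x * ?q k x)" "smooth (\<lambda>x. ?\<psi> x * ?q (Suc k) x)"
      by (intro schwartz_smooth schwartz_exterior_test_divide exterior_test_partial \<phi> b \<psi>)+
    ultimately have "iter_partial (bs @ [b]) (\<lambda>x. \<phi> x * ?q k x) x
        = iter_partial bs (\<lambda>x. partial b \<phi> x * ?q k x) x + of_nat k * iter_partial bs (\<lambda>x. ?\<psi> x * ?q (Suc k) x) x"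
      unfolding iter_partial_snoc
      by (simp only: iter_partial_add[OF sm(1) smooth_cmult[OF sm(2)] bs] iter_partial_cmult[OF sm(2) bs])
    then have "norm (iter_partial (bs @ [b]) (\<lambda>x. \<phi> x * ?q k x) x)
        \<le> norm (iter_partial bs (\<lambda>x. partial b \<phi> x * ?q k x) x) + real k * norm (iter_partial bs (\<lambda>x. ?\<psi> x * ?q (Suc k) x) x)"
      using norm_triangle_ineq[of "iter_partial bs (\<lambda>x. partial b \<phi> x * ?q k x) x" "of_nat k * iter_partial bs (\<lambda>x. ?\<psi> x * ?q (Suc k) x) x"]
      by (simp only: norm_mult norm_of_nat)
    also have "\<dots> \<le> K1 * (1 + real k) ^ ?n * inverse (T\<^sup>2) ^ k * decay x
        + real k * (K2 * (1 + real (Suc k)) ^ ?n * inverse (T\<^sup>2) ^ Suc k * decay x)"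
      by (intro add_mono mult_left_mono 1 2) auto
    also have "\<dots> = (K1 * (1 + real k) ^ ?n + real k * (K2 * (1 + real (Suc k)) ^ ?n * inverse (T\<^sup>2))) * ?D"
      by (simp add: algebra_simps)
    also have "\<dots> \<le> (K * (1 + real k) ^ Suc ?n) * ?D"
    proof (rule mult_right_mono[OF _ D0])
      have "K1 * (1 + real k) ^ ?n \<le> K1 * (1 + real k) ^ Suc ?n"
        by (intro mult_left_mono power_increasing 1) auto
      moreover have "real k * (K2 * (1 + real (Suc k)) ^ ?n * inverse (T\<^sup>2))
          \<le> (1 + real k) * (K2 * (2 * (1 + real k)) ^ ?n * inverse (T\<^sup>2))"
        by (intro mult_mono mult_left_mono mult_right_mono power_mono mult_nonneg_nonneg 2) auto
      moreover have "(1 + real k) * (K2 * (2 * (1 + real k)) ^ ?n * inverse (T\<^sup>2))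
          = (2 ^ ?n * K2 * inverse (T\<^sup>2)) * (1 + real k) ^ Suc ?n"
        by (simp only: power_mult_distrib power_Suc mult_ac)
      ultimately show "K1 * (1 + real k) ^ ?n + real k * (K2 * (1 + real (Suc k)) ^ ?n * inverse (T\<^sup>2))
          \<le> K * (1 + real k) ^ Suc ?n"
        unfolding K_def distrib_right by linarith
    qed
    finally show ?thesis by (simp add: mult_ac)
  qed
  moreover have "K \<ge> 0" using 1(1) 2(1) by (simp add: K_def)
  ultimately show ?case by blast
qed

text \<open>\<open>inv_fourier_decay\<close> of order \<open>2 * DIM('a)\<close> makes the transform
  integrable using exactly that many derivatives, which is the degree of the polynomial in
  \<open>k\<close>.\<close>

lemma exterior_test_divide_inv_fourier:
  fixes \<phi> :: "'a::euclidean_space \<Rightarrow> complex"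
  assumes \<phi>: "exterior_test T \<phi>"
  shows "\<exists>K. \<forall>k. (LBINT r. norm (inv_fourier (divide_norm k \<phi>) r))
    \<le> K * (1 + real k) ^ (2 * DIM('a)) * inverse (T\<^sup>2) ^ k"
proof -
  let ?n = "2 * DIM('a)"
  let ?f = "\<lambda>k x. \<phi> x * of_real (inverse (x \<bullet> x) ^ k)"
  define J where "J = (LBINT x. decay (x :: 'a))"
  have J0: "0 \<le> J" unfolding J_def by (intro integral_nonneg_AE) simp
  have int: "\<exists>K. \<forall>k. (LBINT x. norm (iter_partial bs (?f k) x)) \<le> K * (1 + real k) ^ ?n * inverse (T\<^sup>2) ^ k"
    if bs: "set bs \<subseteq> Basis" "length bs \<le> ?n" for bs
  proof -
    obtain K where K: "K \<ge> 0" "\<And>k x. norm (iter_partial bs (?f k) x) \<le> K * (1 + real k) ^ length bs * inverse (T\<^sup>2) ^ k * decay x"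
      using exterior_test_divide_iter_partial[OF bs(1) \<phi>] by blast
    have "(LBINT x. norm (iter_partial bs (?f k) x)) \<le> (J * K) * (1 + real k) ^ ?n * inverse (T\<^sup>2) ^ k" for k
    proof -
      have "(LBINT x. norm (iter_partial bs (?f k) x)) \<le> (LBINT x. decay (x :: 'a) * (K * (1 + real k) ^ ?n * inverse (T\<^sup>2) ^ k))"
      proof (rule integral_mono')
        show "integrable lborel (\<lambda>x :: 'a. decay x * (K * (1 + real k) ^ ?n * inverse (T\<^sup>2) ^ k))"
          by (intro integrable_mult_left integrable_decay)
        fix x :: 'a
        have "K * (1 + real k) ^ length bs * inverse (T\<^sup>2) ^ k * decay x \<le> K * (1 + real k) ^ ?n * inverse (T\<^sup>2) ^ k * decay x"
          using K(1) bs(2) by (intro mult_right_mono mult_left_mono power_increasing) auto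
        then show "norm (iter_partial bs (?f k) x) \<le> decay x * (K * (1 + real k) ^ ?n * inverse (T\<^sup>2) ^ k)"
          using K(2)[of k x] by (simp only: mult_ac)
      qed (use K(1) in simp)
      then show ?thesis by (simp only: integral_mult_left_zero J_def mult.assoc)
    qed
    then show ?thesis by blast
  qed
  obtain K0 where K0: "\<And>k. (LBINT x. norm (?f k x)) \<le> K0 * (1 + real k) ^ ?n * inverse (T\<^sup>2) ^ k"
    using int[of "[]"] by auto
  have "\<forall>b\<in>Basis. \<exists>K. \<forall>k. (LBINT x. norm (iter_partial (replicate ?n b) (?f k) x)) \<le> K * (1 + real k) ^ ?n * inverse (T\<^sup>2) ^ k"
    using int by auto
  from bchoice[OF this] obtain K1 where K1: "\<And>b k. b \<in> Basis \<Longrightarrow>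
      (LBINT x. norm (iter_partial (replicate ?n b) (?f k) x)) \<le> K1 b * (1 + real k) ^ ?n * inverse (T\<^sup>2) ^ k"
    by blast
  define K where "K = (2 * DIM('a)) ^ ?n * (K0 + (\<Sum>b\<in>Basis. K1 b))"
  have "(LBINT r. norm (inv_fourier (?f k) r)) \<le> (J * K) * (1 + real k) ^ ?n * inverse (T\<^sup>2) ^ k" for k
  proof -
    let ?D = "(1 + real k) ^ ?n * inverse (T\<^sup>2) ^ k"
    have b: "(1 + norm r) ^ ?n * norm (inv_fourier (?f k) r) \<le> K * ?D" for r
    proof -
      have "(1 + norm r) ^ ?n * norm (inv_fourier (?f k) r) \<le> (2 * DIM('a)) ^ ?n *
        ((LBINT x. norm (?f k x)) + (\<Sum>b\<in>Basis. (LBINT x. norm (iter_partial (replicate ?n b) (?f k) x))))"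
        by (rule inv_fourier_decay[OF schwartz_exterior_test_divide[OF \<phi>]])
      also have "\<dots> \<le> (2 * DIM('a)) ^ ?n * (K0 * ?D + (\<Sum>b\<in>Basis. K1 b * ?D))"
        using K0[of k] K1[of _ k] by (intro mult_left_mono add_mono sum_mono) (auto simp: mult.assoc)
      also have "\<dots> = K * ?D" by (simp only: K_def sum_distrib_right[symmetric] distrib_right[symmetric] mult.assoc)
      finally show ?thesis .
    qed
    have "(LBINT r. norm (inv_fourier (?f k) r)) \<le> (LBINT r. decay (r :: 'a) * (K * ?D))"
    proof (rule integral_mono)
      show "integrable lborel (\<lambda>r. norm (inv_fourier (?f k) r))"
        by (intro integrable_norm schwartz_inv_fourier_integrable schwartz_exterior_test_divide \<phi>)
      show "integrable lborel (\<lambda>r :: 'a. decay r * (K * ?D))"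
        by (intro integrable_mult_left integrable_decay)
      fix r :: 'a
      show "norm (inv_fourier (?f k) r) \<le> decay r * (K * ?D)"
        by (rule le_decay_mult[OF b])
    qed
    then show ?thesis by (simp only: integral_mult_left_zero J_def mult.assoc)
  qed
  then show ?thesis by blast
qed

text \<open>The pairing does not depend on \<open>k\<close>, whereas its bound is a polynomial in
  \<open>k\<close> times \<open>\<rho> ^ k\<close> with \<open>\<rho> < 1\<close>; letting
  \<open>k\<close> tend to infinity forces it to be zero.\<close>

lemma exterior_test_annihilated:
  fixes \<phi> :: "'a::euclidean_space \<Rightarrow> complex" and A C :: real
  assumes \<phi>: "exterior_test T \<phi>" and m: "geom_bounded A C m" and C: "DIM('a) * C\<^sup>2 \<le> T\<^sup>2"
  shows "(LBINT r. m r * inv_fourier \<phi> r) = 0"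
proof -
  let ?n = "2 * DIM('a)"
  let ?f = "\<lambda>k x. \<phi> x * of_real (inverse (x \<bullet> x) ^ k)"
  let ?I = "LBINT r. m r * inv_fourier \<phi> r"
  obtain K where K: "\<And>k. (LBINT r. norm (inv_fourier (?f k) r)) \<le> K * (1 + real k) ^ ?n * inverse (T\<^sup>2) ^ k"
    using exterior_test_divide_inv_fourier[OF \<phi>] by blast
  \<comment> \<open>Cost of the derivatives of \<open>m\<close> times gain of the division, per
    step. The assumption on \<open>T\<close> leaves at most \<open>1 / (4 * pi^2)\<close>.\<close>
  define \<rho> where "\<rho> = DIM('a) * C\<^sup>2 / (4 * pi\<^sup>2) * inverse (T\<^sup>2)"
  have A0: "0 \<le> A" by (rule geom_boundedD(4)[OF m])
  have bound: "norm ?I \<le> A * K * ((1 + real k) ^ ?n * \<rho> ^ k)" for k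
  proof -
    have "(\<lambda>s. of_real ((norm s)\<^sup>2) ^ k * ?f k s) = \<phi>"
    proof
      fix s :: 'a
      show "of_real ((norm s)\<^sup>2) ^ k * ?f k s = \<phi> s"
      proof (cases "s = 0")
        case True
        then have "\<phi> s = 0" using \<phi> T unfolding exterior_test_def by force
        then show ?thesis by simp
      next
        case False
        then have "((norm s)\<^sup>2) ^ k * inverse (s \<bullet> s) ^ k = 1"
          unfolding power2_norm_eq_inner power_mult_distrib[symmetric] by simp
        then have "complex_of_real ((norm s)\<^sup>2) ^ k * of_real (inverse (s \<bullet> s) ^ k) = 1"
          by (metis of_real_1 of_real_mult of_real_power)
        then show ?thesis by (metis mult.left_commute mult.right_neutral)
      qed
    qed
    with integral_mult_inv_fourier_norm_power[OF m schwartz_exterior_test_divide[OF \<phi>, of k], of k]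
    have "norm ?I \<le> A * (DIM('a) * C\<^sup>2 / (4 * pi\<^sup>2)) ^ k * (LBINT r. norm (inv_fourier (?f k) r))"
      by simp
    also have "\<dots> \<le> A * (DIM('a) * C\<^sup>2 / (4 * pi\<^sup>2)) ^ k * (K * (1 + real k) ^ ?n * inverse (T\<^sup>2) ^ k)"
      using A0 by (intro mult_left_mono K) auto
    also have "\<dots> = A * K * ((1 + real k) ^ ?n * \<rho> ^ k)"
      unfolding \<rho>_def power_mult_distrib[of _ "inverse (T\<^sup>2)"] by (simp only: mult_ac)
    finally show ?thesis .
  qed
  have \<rho>0: "0 \<le> \<rho>" by (simp add: \<rho>_def)
  \<comment> \<open>A ratio below \<open>1 / exp 1\<close> allows comparison with
    \<open>(1 + k) ^ n / exp (1 + k)\<close>, whose limit is known to be zero.\<close>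
  have \<rho>1: "exp 1 * \<rho> \<le> 1"
  proof -
    have "DIM('a) * C\<^sup>2 * inverse (T\<^sup>2) \<le> 1" using C T by (simp add: field_simps)
    then have "\<rho> \<le> 1 / (4 * pi\<^sup>2)" unfolding \<rho>_def using divide_right_mono[of _ 1 "4 * pi\<^sup>2"] by (simp add: field_simps)
    also have "\<dots> \<le> 1 / 3"
    proof -
      have "3 * 1 \<le> pi * pi" using pi_gt3 by (intro mult_mono) auto
      then show ?thesis by (simp add: power2_eq_square field_simps)
    qed
    finally have "exp 1 * \<rho> \<le> 3 * (1 / 3)" using exp_le \<rho>0 by (intro mult_mono) auto
    then show ?thesis by simp
  qed
  have up: "(1 + real k) ^ ?n * \<rho> ^ k \<le> exp 1 * ((1 + real k) ^ ?n / exp (1 + real k))" for k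
  proof -
    have "exp (1 + real k) = exp 1 * exp 1 ^ k"
      by (simp add: exp_add exp_of_nat_mult[symmetric])
    then have "(1 + real k) ^ ?n * \<rho> ^ k = exp 1 * ((1 + real k) ^ ?n / exp (1 + real k)) * (exp 1 * \<rho>) ^ k"
      by (simp add: power_mult_distrib)
    also have "\<dots> \<le> exp 1 * ((1 + real k) ^ ?n / exp (1 + real k)) * 1"
      using \<rho>0 \<rho>1 by (intro mult_left_mono power_le_one) auto
    finally show ?thesis by simp
  qed
  have "(\<lambda>k. (1 + real k) ^ ?n / exp (1 + real k)) \<longlonglongrightarrow> 0"
    by (rule filterlim_compose[OF tendsto_power_div_exp_0])
      (intro filterlim_tendsto_add_at_top[OF tendsto_const] filterlim_real_sequentially)
  then have "(\<lambda>k. \<bar>A * K\<bar> * (exp 1 * ((1 + real k) ^ ?n / exp (1 + real k)))) \<longlonglongrightarrow> \<bar>A * K\<bar> * (exp 1 * 0)"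
    by (intro tendsto_intros)
  moreover have "norm ?I \<le> \<bar>A * K\<bar> * (exp 1 * ((1 + real k) ^ ?n / exp (1 + real k)))" for k
  proof -
    have "norm ?I \<le> \<bar>A * K\<bar> * ((1 + real k) ^ ?n * \<rho> ^ k)"
      by (rule order_trans[OF bound[of k]]) (use \<rho>0 in \<open>intro mult_right_mono; simp\<close>)
    also have "\<dots> \<le> \<bar>A * K\<bar> * (exp 1 * ((1 + real k) ^ ?n / exp (1 + real k)))"
      by (intro mult_left_mono up) simp
    finally show ?thesis .
  qed
  ultimately have "norm ?I \<le> 0"
    using LIMSEQ_le_const[of _ "\<bar>A * K\<bar> * (exp 1 * 0)" "norm ?I"] by auto
  then show ?thesis by simp
qed

end

text \<open>The complement of the closed ball is itself one of the open sets removed in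
  \<open>dist_support\<close>, since a smooth function with compact support inside it is an exterior
  test function.\<close>

lemma dist_support_a_dist:
  fixes \<sigma> :: "'a::euclidean_space \<Rightarrow> complex" and C T :: real
  assumes \<sigma>: "geom_bounded C C \<sigma>" and T: "T > 0" "DIM('a) * C\<^sup>2 \<le> T\<^sup>2"
  shows "dist_support (a_dist \<sigma> \<xi>) \<subseteq> cball 0 T"
proof -
  have "a_dist \<sigma> \<xi> \<phi> = 0"
    if "smooth \<phi>" "compact (closure {x. \<phi> x \<noteq> 0})" "closure {x. \<phi> x \<noteq> 0} \<subseteq> - cball 0 T" for \<phi>
  proof -
    have "exterior_test T \<phi>"
      unfolding exterior_test_def
    proof (intro conjI exI[of _ "closure {x. \<phi> x \<noteq> 0}"])
      show "\<forall>x\<in>closure {x. \<phi> x \<noteq> 0}. T < norm x" using that(3) by (auto simp: subset_iff)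
      show "\<forall>x. x \<notin> closure {x. \<phi> x \<noteq> 0} \<longrightarrow> \<phi> x = 0" using closure_subset[of "{x. \<phi> x \<noteq> 0}"] by blast
    qed (use that in auto)
    from exterior_test_annihilated[OF T(1) this geom_bounded_b_symbol[OF \<sigma>] T(2)]
    show ?thesis by (simp add: a_dist_def inv_fourier_dist_def reg_dist_def)
  qed
  then have "- cball 0 T \<subseteq> \<Union>{U. open U \<and>
      (\<forall>\<phi>. smooth \<phi> \<and> compact (closure {x. \<phi> x \<noteq> 0}) \<and> closure {x. \<phi> x \<noteq> 0} \<subseteq> U \<longrightarrow> a_dist \<sigma> \<xi> \<phi> = 0)}"
    by (intro Union_upper) (auto simp: open_Compl)
  then show ?thesis unfolding dist_support_def by blast
qed

theorem theorem4p3: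
  fixes C :: real
  assumes "C > 0"
  shows "\<exists>T>0. \<forall>\<sigma> :: real ^ 'd \<Rightarrow> complex.
    smooth \<sigma> \<longrightarrow>
    (\<forall>\<alpha> \<xi>. norm (mderiv \<alpha> \<sigma> \<xi>) \<le> C ^ (mi_order \<alpha> + 1)) \<longrightarrow>
      is_wigner_kernel (fourier_multiplier \<sigma>) (delta_kernel (a_dist \<sigma>)) \<and>
      (\<forall>\<xi>. tempered_distribution (a_dist \<sigma> \<xi>) \<and>
           dist_support (a_dist \<sigma> \<xi>) \<subseteq> cball 0 T)"
proof (intro exI[of _ "DIM(real ^ 'd) * C"] conjI allI impI)
  \<comment> \<open>The witness is \<open>d * C\<close> with \<open>d\<close> the dimension: as
    \<open>d \<ge> 1\<close>, its square is at least \<open>d * C^2\<close>, and it is fixed before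
    \<open>\<sigma>\<close> and \<open>\<xi>\<close>.\<close>
  show T: "DIM(real ^ 'd) * C > 0" using assms by simp
  fix \<sigma> :: "real ^ 'd \<Rightarrow> complex"
  assume s: "smooth \<sigma>" and bd: "\<forall>\<alpha> \<xi>. norm (mderiv \<alpha> \<sigma> \<xi>) \<le> C ^ (mi_order \<alpha> + 1)"
  \<comment> \<open>The exponent \<open>mi_order \<alpha> + 1\<close> supplies the amplitude:
    \<open>C ^ (n + 1)\<close> is \<open>C * C ^ n\<close>, so \<open>C\<close> serves as amplitude
    and rate alike.\<close>
  have g: "geom_bounded C C \<sigma>"
    unfolding geom_bounded_def
  proof (intro conjI allI impI s)
    fix bs x assume bs: "set bs \<subseteq> (Basis :: (real ^ 'd) set)"
    show "norm (iter_partial bs \<sigma> x) \<le> C * C ^ length bs"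
      using bd[rule_format, of "count_list bs" x] iter_partial_eq_mderiv[OF s bs] by simp
  qed
  have m: "\<sigma> \<in> borel_measurable borel" by (rule borel_measurable_smooth[OF s])
  have B: "norm (\<sigma> x) \<le> C" for x by (rule geom_boundedD(3)[OF g])
  show "is_wigner_kernel (fourier_multiplier \<sigma>) (delta_kernel (a_dist \<sigma>))"
    unfolding is_wigner_kernel_def
    using continuous_linear_op_fourier_multiplier[OF m B] tempered_delta_kernel[OF m B]
      wigner_kernel_identity_delta_kernel[OF m B] wigner_kernel_unique by blast
  show "tempered_distribution (a_dist \<sigma> \<xi>)" for \<xi> by (rule tempered_a_dist[OF m B])
  have "real (DIM(real ^ 'd)) \<le> (real (DIM(real ^ 'd)))\<^sup>2"
    using DIM_positive[where 'a="real ^ 'd"] by (simp add: power2_eq_square del: DIM_cart)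
  then have "DIM(real ^ 'd) * C\<^sup>2 \<le> (DIM(real ^ 'd) * C)\<^sup>2"
    unfolding power_mult_distrib by (rule mult_right_mono) simp
  then show "dist_support (a_dist \<sigma> \<xi>) \<subseteq> cball 0 (DIM(real ^ 'd) * C)" for \<xi>
    by (rule dist_support_a_dist[OF g T])
qed


end
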